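(* Let $l$ be a prime, $E$ an elliptic curve defined over a field $K$ with $\operatorname{char} K\nmid l$, and $P\in E(K)$. Then at least one of the following holds: (i) $\delta_l^P$ is irreducible over $K$; (ii) $E$ admits an isogeny of degree $l$ to another elliptic curve, defined over $K$ (equivalently, $E$ has a cyclic subgroup of order $l$ stable under $\operatorname{Gal}(\bar K/K)$); (iii) there exists $Q\in E(K)$ with $lQ=P$.
   Context: For an elliptic curve $E$ over a field $K$ with Weierstrass coordinate functions $x,y$ and $m\in\mathbb{Z}$, $\psi_m$ denotes the $m$-th division polynomial, so that $\psi_m^2\in K[x]$, and $\theta_m=x\psi_m^2-\psi_{m+1}\psi_{m-1}\in K[x]$, so that $x([m]R)=\theta_m(x(R))/\psi_m^2(x(R))$. For $P\in E(K)$, $\delta_m^P=\theta_m-x(P)\psi_m^2$ if $P\ne O$ and $\delta_m^P=\psi_m^2$ if $P=O$. *)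

theory Defs
  imports "HOL-Algebra.Algebraic_Closure_Type"
begin

text \<open>The curve y^2 + a1 x y + a3 y = x^3 + a2 x^2 + a4 x + a6 is represented
  by its coefficient record.\<close>

record 'a wcurve =
  a1 :: 'a
  a2 :: 'a
  a3 :: 'a
  a4 :: 'a
  a6 :: 'a

definition b2 :: "('a::comm_ring_1) wcurve \<Rightarrow> 'a" where
  "b2 E = a1 E ^ 2 + 4 * a2 E"
definition b4 :: "('a::comm_ring_1) wcurve \<Rightarrow> 'a" where
  "b4 E = 2 * a4 E + a1 E * a3 E"
definition b6 :: "('a::comm_ring_1) wcurve \<Rightarrow> 'a" where
  "b6 E = a3 E ^ 2 + 4 * a6 E"
definition b8 :: "('a::comm_ring_1) wcurve \<Rightarrow> 'a" where
  "b8 E = a1 E ^ 2 * a6 E + 4 * a2 E * a6 E - a1 E * a3 E * a4 E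
          + a2 E * a3 E ^ 2 - a4 E ^ 2"

definition disc :: "('a::comm_ring_1) wcurve \<Rightarrow> 'a" where
  "disc E = - (b2 E ^ 2 * b8 E) - 8 * b4 E ^ 3 - 27 * b6 E ^ 2 + 9 * b2 E * b4 E * b6 E"

definition elliptic :: "('a::field) wcurve \<Rightarrow> bool" where
  "elliptic E \<longleftrightarrow> disc E \<noteq> 0"

definition map_wcurve :: "('a \<Rightarrow> 'b) \<Rightarrow> 'a wcurve \<Rightarrow> 'b wcurve" where
  "map_wcurve f E = \<lparr>a1 = f (a1 E), a2 = f (a2 E), a3 = f (a3 E), a4 = f (a4 E), a6 = f (a6 E)\<rparr>"

datatype 'a point = Infinity | Pt 'a 'a

fun on_curve :: "('a::field) wcurve \<Rightarrow> 'a point \<Rightarrow> bool" where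
  "on_curve E Infinity = True"
| "on_curve E (Pt x y) \<longleftrightarrow>
     y ^ 2 + a1 E * x * y + a3 E * y = x ^ 3 + a2 E * x ^ 2 + a4 E * x + a6 E"

fun map_point :: "('a \<Rightarrow> 'b) \<Rightarrow> 'a point \<Rightarrow> 'b point" where
  "map_point f Infinity = Infinity"
| "map_point f (Pt x y) = Pt (f x) (f y)"

text \<open>Addition law (Silverman, Algorithm III.2.3).\<close>
fun add :: "('a::field) wcurve \<Rightarrow> 'a point \<Rightarrow> 'a point \<Rightarrow> 'a point" where
  "add E Infinity Q = Q"
| "add E P Infinity = P"
| "add E (Pt x1 y1) (Pt x2 y2) =
     (if x1 = x2 \<and> y1 + y2 + a1 E * x2 + a3 E = 0 then Infinity
      else
        let lam = (if x1 = x2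
                   then (3 * x1 ^ 2 + 2 * a2 E * x1 + a4 E - a1 E * y1) / (2 * y1 + a1 E * x1 + a3 E)
                   else (y2 - y1) / (x2 - x1));
            nu  = (if x1 = x2
                   then (- (x1 ^ 3) + a4 E * x1 + 2 * a6 E - a3 E * y1) / (2 * y1 + a1 E * x1 + a3 E)
                   else (y1 * x2 - y2 * x1) / (x2 - x1));
            x3 = lam ^ 2 + a1 E * lam - a2 E - x1 - x2;
            y3 = - (lam + a1 E) * x3 - nu - a3 E
        in Pt x3 y3)"

fun smul :: "('a::field) wcurve \<Rightarrow> nat \<Rightarrow> 'a point \<Rightarrow> 'a point" where
  "smul E 0 P = Infinity"
| "smul E (Suc n) P = add E P (smul E n P)"

text \<open>F = psi_2^2 = (2y + a1 x + a3)^2, reduced to a polynomial in x via the curve equation.\<close>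
definition Fpoly :: "('a::comm_ring_1) wcurve \<Rightarrow> 'a poly" where
  "Fpoly E = [: b6 E, 2 * b4 E, b2 E, 4 :]"

text \<open>Reduced division polynomials f_n in K[x]: psi_n = f_n for n odd and
  psi_n = psi_2 * f_n for n even, where psi_n are the usual division
  polynomials given by the standard recursion
  psi_{2m+1} = psi_{m+2} psi_m^3 - psi_{m-1} psi_{m+1}^3,
  psi_{2m} = psi_m (psi_{m+2} psi_{m-1}^2 - psi_{m-2} psi_{m+1}^2) / psi_2.\<close>
function dpred :: "('a::comm_ring_1) wcurve \<Rightarrow> nat \<Rightarrow> 'a poly" where
  "dpred E n =
    (if n = 0 then 0
     else if n = 1 then 1
     else if n = 2 then 1
     else if n = 3 then [: b8 E, 3 * b6 E, 3 * b4 E, b2 E, 3 :]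
     else if n = 4 then [: b4 E * b8 E - b6 E ^ 2, b2 E * b8 E - b4 E * b6 E,
                           10 * b8 E, 10 * b6 E, 5 * b4 E, b2 E, 2 :]
     else if even n then
       dpred E (n div 2) *
         (dpred E (n div 2 + 2) * dpred E (n div 2 - 1) ^ 2
          - dpred E (n div 2 - 2) * dpred E (n div 2 + 1) ^ 2)
     else if even (n div 2) then
       Fpoly E ^ 2 * dpred E (n div 2 + 2) * dpred E (n div 2) ^ 3
         - dpred E (n div 2 - 1) * dpred E (n div 2 + 1) ^ 3
     else
       dpred E (n div 2 + 2) * dpred E (n div 2) ^ 3
         - Fpoly E ^ 2 * dpred E (n div 2 - 1) * dpred E (n div 2 + 1) ^ 3)"
  by pat_completeness auto
termination
  by (relation "measure (\<lambda>(E, n). n)") auto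

definition psi_sq :: "('a::comm_ring_1) wcurve \<Rightarrow> nat \<Rightarrow> 'a poly" where
  "psi_sq E m = (if even m then Fpoly E * dpred E m ^ 2 else dpred E m ^ 2)"

text \<open>psi_{m+1} psi_{m-1} as an element of K[x] (m \<ge> 1).\<close>
definition psi_nb :: "('a::comm_ring_1) wcurve \<Rightarrow> nat \<Rightarrow> 'a poly" where
  "psi_nb E m = (if even m then dpred E (m + 1) * dpred E (m - 1)
                 else Fpoly E * dpred E (m + 1) * dpred E (m - 1))"

definition theta :: "('a::comm_ring_1) wcurve \<Rightarrow> nat \<Rightarrow> 'a poly" where
  "theta E m = [:0, 1:] * psi_sq E m - psi_nb E m"

fun delta :: "('a::comm_ring_1) wcurve \<Rightarrow> nat \<Rightarrow> 'a point \<Rightarrow> 'a poly" where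
  "delta E m Infinity = psi_sq E m"
| "delta E m (Pt x y) = theta E m - [:x:] * psi_sq E m"

definition gal_aut :: "('a::field alg_closure \<Rightarrow> 'a alg_closure) \<Rightarrow> bool" where
  "gal_aut \<sigma> \<longleftrightarrow> bij \<sigma> \<and> (\<forall>u v. \<sigma> (u + v) = \<sigma> u + \<sigma> v) \<and> (\<forall>u v. \<sigma> (u * v) = \<sigma> u * \<sigma> v)
      \<and> \<sigma> 1 = 1 \<and> (\<forall>c. \<sigma> (to_ac c) = to_ac c)"

text \<open>E admits a cyclic subgroup of order l (in E(Kbar)) stable under Gal(Kbar/K):
  a point T of exact order l (l prime) whose generated subgroup is Galois stable.\<close>
definition has_rational_cyclic_subgroup :: "('a::field) wcurve \<Rightarrow> nat \<Rightarrow> bool" where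
  "has_rational_cyclic_subgroup E l \<longleftrightarrow>
    (let EE = map_wcurve to_ac E in
     \<exists>T. on_curve EE T \<and> T \<noteq> Infinity \<and> smul EE l T = Infinity \<and>
         (let C = range (\<lambda>n. smul EE n T) in
          \<forall>\<sigma>. gal_aut \<sigma> \<longrightarrow> map_point \<sigma> ` C = C))"

end

(*  A point R of E with l R = P is determined by its x-coordinate up to sign, and the roots of
    delta_l^P are exactly these x-coordinates. If P is affine and not a 2-torsion point, they are
    l^2 distinct numbers, so a proper factor of delta_l^P over K splits the set X = {R. l R = P},
    on which the Galois group acts by affine maps of the plane E[l] over F_l, into two stable parts.
    (If 2P = O, then lP = P for odd l, and P generates a stable line for l = 2.)

    Assume there is no stable line in E[l]. If l does not divide the size of some stable part, its
    barycentre is a fixed point. Otherwise the action contains no translation, and an orbit count on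
    E[l] yields a transvection; two transvections with different axes generate the map -1, whose
    unique fixed point on X (for odd l) is fixed by the whole group. For l = 2 a stable part has
    two elements, and their difference spans a stable line. A Galois-fixed R in X is rational,
    since its x-coordinate is a simple root of delta_l^P.

    The description of the roots rests on three facts. Points of E form a group, since P corresponds
    to the class of the ideal (x - x(P), y - y(P)). The values W(m) = psi_m(R) satisfy
    W(m+1) W(m-1) = (x(R) - x(mR)) W(m)^2, and W(m) = 0 iff mR = O; the recursion for psi_m
    translates into the formula for x(A+B) - x(A-B). Finally card E[l] = l^2: the Wronskian
    of theta_l and psi_l^2 has leading coefficient l^2, so a general fibre is reduced.  *)

theory Submission
  imports Defs "HOL-Library.Function_Algebras" "HOL-Number_Theory.Cong"
begin

section \<open>The addition law\<close>

text \<open>Clearing denominators in the associative law splits into many cases (coinciding points,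
  tangents, partial sums equal to O); ideal classes replace them by one computation for a
  non-vertical line and one for a vertical line. In the induction for psi_m the obstacle is that
  x(mR) has no meaning when mR = O, while the recursion passes through such indices; the inductive
  statement therefore also relates the values on the two sides of a zero. Points with 2R = O are
  evaluated separately, since the even recursion divides by psi_2(R). For the size of E[l] one good
  fibre suffices, all fibres being translates of E[l]. The transvection comes from a pigeonhole: the
  maps fixing a vector v act on the quotient line by one of l - 1 scalars, and at least l such maps
  exist, so two share their scalar; their quotient is unipotent, and it is not the identity because
  translations are excluded. The map -1 is central only modulo translations, and the same exclusion
  makes it commute with the whole action on X.\<close>

fun neg :: "('a::field) wcurve \<Rightarrow> 'a point \<Rightarrow> 'a point" where
  "neg E Infinity = Infinity"
| "neg E (Pt x y) = Pt x (- y - a1 E * x - a3 E)"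

lemma neg_neg [simp]: "neg E (neg E P) = P"
  by (cases P) auto

lemma on_curve_neg [simp]: "on_curve E (neg E P) \<longleftrightarrow> on_curve E P"
proof (cases P)
  case (Pt x y)
  have "(- y - a1 E * x - a3 E)^2 + a1 E * x * (- y - a1 E * x - a3 E) + a3 E * (- y - a1 E * x - a3 E)
      = y^2 + a1 E * x * y + a3 E * y" by Groebner_Basis.algebra
  then show ?thesis using Pt by simp
qed simp

lemma neg_eq_Infinity_iff [simp]: "neg E P = Infinity \<longleftrightarrow> P = Infinity"
  by (cases P) auto

lemma add_Infinity_right [simp]: "add E P Infinity = P"
  by (cases P) auto

lemma same_x_cases:
  assumes "on_curve E (Pt x y)" "on_curve E (Pt x y')"
  shows "y' = y \<or> y' = - y - a1 E * x - a3 E"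
proof -
  have "(y' - y) * (y' + y + a1 E * x + a3 E) = 0"
    using assms[unfolded on_curve.simps] by Groebner_Basis.algebra
  then have "y' - y = 0 \<or> y' + y + a1 E * x + a3 E = 0"
    by simp
  then show ?thesis
    by (auto simp: algebra_simps eq_neg_iff_add_eq_0)
qed

lemma add_neg_iff:
  "add E P Q = Infinity \<longleftrightarrow> Q = neg E P"
  by (cases P; cases Q) (auto simp: Let_def algebra_simps eq_neg_iff_add_eq_0)

text \<open>Chord and tangent are treated together as a line y = l x + n. Substituting it into the
  curve gives a monic cubic in x with roots \<open>x1\<close>, \<open>x2\<close>, \<open>x3\<close>;
  this factorisation serves both closure under addition and the ideal computation behind
  associativity.\<close>

lemma add_line:
  fixes E :: "('a::field) wcurve"
  assumes P: "on_curve E (Pt x1 y1)" and Q: "on_curve E (Pt x2 y2)"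
    and ne: "Pt x2 y2 \<noteq> neg E (Pt x1 y1)"
  obtains l n x3 where
    "add E (Pt x1 y1) (Pt x2 y2) = Pt x3 (- (l + a1 E) * x3 - n - a3 E)"
    "y1 = l * x1 + n" "y2 = l * x2 + n"
    "x3 = l^2 + a1 E * l - a2 E - x1 - x2"
    "\<And>x. x^3 + a2 E * x^2 + a4 E * x + a6 E - (l * x + n)^2 - (a1 E * x + a3 E) * (l * x + n)
         = (x - x1) * (x - x2) * (x - x3)"
    "x1 = x2 \<Longrightarrow> y1 = y2 \<and> 2 * y1 + a1 E * x1 + a3 E \<noteq> 0
       \<and> l * (2 * y1 + a1 E * x1 + a3 E) = 3 * x1^2 + 2 * a2 E * x1 + a4 E - a1 E * y1"
proof (cases "x1 = x2")
  case False
  define l where "l = (y2 - y1) / (x2 - x1)"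
  define n where "n = (y1 * x2 - y2 * x1) / (x2 - x1)"
  define x3 where "x3 = l^2 + a1 E * l - a2 E - x1 - x2"
  have d: "x2 - x1 \<noteq> 0" using False by simp
  have l: "l * (x2 - x1) = y2 - y1" unfolding l_def using d by simp
  have "n * (x2 - x1) = (y1 - l * x1) * (x2 - x1)"
    unfolding l_def n_def using d by (simp add: field_simps)
  then have n: "n = y1 - l * x1" using d by simp
  have y1: "y1 = l * x1 + n" using n by simp
  have y2: "y2 = l * x2 + n" using n l by Groebner_Basis.algebra
  \<comment> \<open>After subtracting (x - x1)(x - x2)(x - x3) the quadratic terms cancel by the
    choice of \<open>x3\<close>, which leaves \<open>?A * x + ?B\<close>; on a chord it vanishes at
    the two distinct values \<open>x1\<close> and \<open>x2\<close>.\<close>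
  let ?A = "a4 E - 2 * l * n - a1 E * n - a3 E * l - (x1 * x2 + x1 * x3 + x2 * x3)"
  let ?B = "a6 E - n^2 - a3 E * n + x1 * x2 * x3"
  have e1: "?A * x1 + ?B = 0"
    using P unfolding y1 x3_def by (simp, Groebner_Basis.algebra)
  have e2: "?A * x2 + ?B = 0"
    using Q unfolding y2 x3_def by (simp, Groebner_Basis.algebra)
  have "?A * (x2 - x1) = 0" using e1 e2 by Groebner_Basis.algebra
  then have A: "?A = 0" using d by simp
  with e1 have B: "?B = 0" by (simp only: A mult_zero_left add_0_left)
  show thesis
  proof (rule that[of x3 l n])
    show "add E (Pt x1 y1) (Pt x2 y2) = Pt x3 (- (l + a1 E) * x3 - n - a3 E)"
      using False by (simp add: Let_def l_def n_def x3_def)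
    fix x
    show "x^3 + a2 E * x^2 + a4 E * x + a6 E - (l * x + n)^2 - (a1 E * x + a3 E) * (l * x + n)
         = (x - x1) * (x - x2) * (x - x3)"
    proof -
      have "x^3 + a2 E * x^2 + a4 E * x + a6 E - (l * x + n)^2 - (a1 E * x + a3 E) * (l * x + n)
         - (x - x1) * (x - x2) * (x - x3) = ?A * x + ?B"
        unfolding x3_def by Groebner_Basis.algebra
      also have "\<dots> = 0" by (simp only: A B mult_zero_left add_0_left)
      finally show ?thesis by (simp only: right_minus_eq)
    qed
  qed (use y1 y2 x3_def False in auto)
next
  case True
  have yy: "y2 = y1" using same_x_cases[OF P Q[folded True]] ne True by auto
  let ?e = "2 * y1 + a1 E * x1 + a3 E"
  have e: "?e \<noteq> 0"
  proof
    assume "?e = 0"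
    then have "y1 = - y1 - a1 E * x1 - a3 E" by Groebner_Basis.algebra
    then show False using ne True yy by simp
  qed
  define l where "l = (3 * x1^2 + 2 * a2 E * x1 + a4 E - a1 E * y1) / ?e"
  define n where "n = (- (x1^3) + a4 E * x1 + 2 * a6 E - a3 E * y1) / ?e"
  define x3 where "x3 = l^2 + a1 E * l - a2 E - x1 - x2"
  have l: "l * ?e = 3 * x1^2 + 2 * a2 E * x1 + a4 E - a1 E * y1"
    unfolding l_def using e by simp
  have "n * ?e = - (x1^3) + a4 E * x1 + 2 * a6 E - a3 E * y1"
    unfolding n_def using e by simp
  \<comment> \<open>The intercept of the addition law agrees with y1 - l x1 up to twice the curve
    equation at the point.\<close>
  then have "(n - (y1 - l * x1)) * ?e
      = - (x1^3) + a4 E * x1 + 2 * a6 E - a3 E * y1 - y1 * ?e + x1 * (l * ?e)"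
    by (simp add: left_diff_distrib mult_ac)
  also have "\<dots> = 2 * (x1^3 + a2 E * x1^2 + a4 E * x1 + a6 E - (y1^2 + a1 E * x1 * y1 + a3 E * y1))"
    unfolding l by Groebner_Basis.algebra
  also have "\<dots> = 0" using P by simp
  finally have "(n - (y1 - l * x1)) * ?e = 0" .
  then have n: "n = y1 - l * x1" using e by simp
  have y1: "y1 = l * x1 + n" using n by simp
  let ?A = "a4 E - 2 * l * n - a1 E * n - a3 E * l - (x1 * x2 + x1 * x3 + x2 * x3)"
  let ?B = "a6 E - n^2 - a3 E * n + x1 * x2 * x3"
  \<comment> \<open>On a tangent only one root is at hand; the second relation is the slope
    equation, which says that this root is double.\<close>
  have A: "?A = 0"
  proof -
    have "?A = (3 * x1^2 + 2 * a2 E * x1 + a4 E - a1 E * y1) - l * ?e"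
      unfolding x3_def n True[symmetric] by Groebner_Basis.algebra
    then show ?thesis using l by simp
  qed
  have "?A * x1 + ?B = x1^3 + a2 E * x1^2 + a4 E * x1 + a6 E - (y1^2 + a1 E * x1 * y1 + a3 E * y1)"
    unfolding x3_def n True[symmetric] by Groebner_Basis.algebra
  also have "\<dots> = 0" using P by simp
  finally have "?A * x1 + ?B = 0" .
  then have B: "?B = 0" by (simp only: A mult_zero_left add_0_left)
  show thesis
  proof (rule that[of x3 l n])
    have "y1 + y1 + a1 E * x2 + a3 E \<noteq> 0" using e unfolding mult_2 True .
    then show "add E (Pt x1 y1) (Pt x2 y2) = Pt x3 (- (l + a1 E) * x3 - n - a3 E)"
      unfolding True[symmetric] yy l_def n_def x3_def by (simp only: add.simps Let_def refl simp_thms if_True if_False)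
    fix x
    show "x^3 + a2 E * x^2 + a4 E * x + a6 E - (l * x + n)^2 - (a1 E * x + a3 E) * (l * x + n)
         = (x - x1) * (x - x2) * (x - x3)"
    proof -
      have "x^3 + a2 E * x^2 + a4 E * x + a6 E - (l * x + n)^2 - (a1 E * x + a3 E) * (l * x + n)
         - (x - x1) * (x - x2) * (x - x3) = ?A * x + ?B"
        unfolding x3_def by Groebner_Basis.algebra
      also have "\<dots> = 0" by (simp only: A B mult_zero_left add_0_left)
      finally show ?thesis by (simp only: right_minus_eq)
    qed
    show "y1 = l * x1 + n" "y2 = l * x2 + n" using y1 yy True by simp_all
    show "y1 = y2 \<and> ?e \<noteq> 0 \<and> l * ?e = 3 * x1^2 + 2 * a2 E * x1 + a4 E - a1 E * y1"
      using yy e l by simp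
  qed (fact x3_def)
qed

lemma on_curve_add:
  assumes "on_curve E P" "on_curve E Q"
  shows "on_curve E (add E P Q)"
proof (cases "P = Infinity \<or> Q = Infinity \<or> Q = neg E P")
  case True
  then show ?thesis using assms add_neg_iff[of E P Q] by (cases P; auto)
next
  case False
  then obtain x1 y1 x2 y2 where PQ: "P = Pt x1 y1" "Q = Pt x2 y2"
    by (meson point.exhaust)
  obtain l n x3 where
    s: "add E (Pt x1 y1) (Pt x2 y2) = Pt x3 (- (l + a1 E) * x3 - n - a3 E)"
    and c: "\<And>x. x^3 + a2 E * x^2 + a4 E * x + a6 E - (l * x + n)^2 - (a1 E * x + a3 E) * (l * x + n)
         = (x - x1) * (x - x2) * (x - x3)"
    using add_line[of E x1 y1 x2 y2] assms False unfolding PQ by metis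
  show ?thesis
    unfolding PQ s using c[of x3] by (simp, Groebner_Basis.algebra)
qed

lemma on_curve_smul: "on_curve E P \<Longrightarrow> on_curve E (smul E n P)"
  by (induction n) (auto simp: on_curve_add)

lemma add_comm:
  assumes "on_curve E P" "on_curve E Q"
  shows "add E P Q = add E Q P"
proof (cases "P = Infinity \<or> Q = Infinity \<or> Q = neg E P")
  case True
  then show ?thesis using add_neg_iff[of E P Q] add_neg_iff[of E Q P] by auto
next
  case False
  then obtain x1 y1 x2 y2 where PQ: "P = Pt x1 y1" "Q = Pt x2 y2"
    by (meson point.exhaust)
  show ?thesis
  proof (cases "x1 = x2")
    case True
    then show ?thesis using False same_x_cases assms unfolding PQ by (metis neg.simps(2))
  next
    case F: False
    obtain l n x3 where
      s: "add E (Pt x1 y1) (Pt x2 y2) = Pt x3 (- (l + a1 E) * x3 - n - a3 E)"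
      "y1 = l * x1 + n" "y2 = l * x2 + n" "x3 = l^2 + a1 E * l - a2 E - x1 - x2"
      using add_line[of E x1 y1 x2 y2] assms False unfolding PQ by metis
    obtain l' n' x3' where
      s': "add E (Pt x2 y2) (Pt x1 y1) = Pt x3' (- (l' + a1 E) * x3' - n' - a3 E)"
      "y2 = l' * x2 + n'" "y1 = l' * x1 + n'" "x3' = l'^2 + a1 E * l' - a2 E - x2 - x1"
      using add_line[of E x2 y2 x1 y1] assms False unfolding PQ by (metis neg_neg)
    have "(l - l') * (x2 - x1) = 0" using s(2-) s'(2-) by Groebner_Basis.algebra
    then have "l' = l" using F by simp
    moreover from this have "n' = n" using s(2) s'(3) by simp
    moreover from \<open>l' = l\<close> have "x3' = x3" unfolding s(4) s'(4) by simp
    ultimately show ?thesis unfolding PQ s(1) s'(1) by simp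
  qed
qed

text \<open>The two cofactors multiply psi_2^2 and the numerator theta_2 of x(2R). Writing
  \<open>disc\<close> as a combination of these shows that they have no common zero on an elliptic
  curve; the identity rests on 4 b8 = b2 b6 - b4^2.\<close>

lemma disc_bezout:
  fixes x :: "'a::field"
  shows "disc E = (12*x^3 - b2 E*x^2 - 10*b4 E*x + b2 E*b4 E - 27*b6 E) * (4*x^3 + b2 E*x^2 + 2*b4 E*x + b6 E)
     - (48*x^2 + 8*b2 E*x + 32*b4 E - b2 E^2) * (x^4 - b4 E*x^2 - 2*b6 E*x - b8 E)"
proof -
  have "4 * b8 E = b2 E * b6 E - b4 E ^ 2"
    unfolding b2_def b4_def b6_def b8_def by Groebner_Basis.algebra
  moreover have "(12*x^3 - b2 E*x^2 - 10*b4 E*x + b2 E*b4 E - 27*b6 E) * (4*x^3 + b2 E*x^2 + 2*b4 E*x + b6 E)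
     - (48*x^2 + 8*b2 E*x + 32*b4 E - b2 E^2) * (x^4 - b4 E*x^2 - 2*b6 E*x - b8 E) - disc E
     = (12*x^2 + 2*b2 E*x + 8*b4 E) * (4 * b8 E - b2 E * b6 E + b4 E ^ 2)"
    unfolding disc_def by Groebner_Basis.algebra
  ultimately show ?thesis by simp
qed

text \<open>Let e and n be the denominator and numerator of the tangent slope. If both vanished, so
  would psi_2^2 = e^2 and theta_2 = n^2 + a1 n e - (a2 + 2x) e^2, which \<open>disc_bezout\<close>
  forbids.\<close>

lemma nonsingular:
  assumes "elliptic E" "on_curve E (Pt x y)" "2 * y + a1 E * x + a3 E = 0"
  shows "3 * x^2 + 2 * a2 E * x + a4 E - a1 E * y \<noteq> 0"
proof
  assume N: "3 * x^2 + 2 * a2 E * x + a4 E - a1 E * y = 0"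
  have F: "4*x^3 + b2 E*x^2 + 2*b4 E*x + b6 E = 0"
  proof -
    have "4*x^3 + b2 E*x^2 + 2*b4 E*x + b6 E = (2 * y + a1 E * x + a3 E)^2"
      using assms(2)[unfolded on_curve.simps] unfolding b2_def b4_def b6_def by Groebner_Basis.algebra
    then show ?thesis using assms(3) by simp
  qed
  have T: "x^4 - b4 E*x^2 - 2*b6 E*x - b8 E = 0"
  proof -
    let ?e = "2 * y + a1 E * x + a3 E" and ?n = "3 * x^2 + 2 * a2 E * x + a4 E - a1 E * y"
    have "x^4 - b4 E*x^2 - 2*b6 E*x - b8 E = ?n^2 + a1 E * ?n * ?e - (a2 E + 2 * x) * ?e^2"
    proof -
      have a6: "a6 E = y^2 + a1 E * x * y + a3 E * y - (x^3 + a2 E * x^2 + a4 E * x)"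
        using assms(2) by (simp add: algebra_simps)
      show ?thesis
        unfolding b8_def b4_def b6_def unfolding a6 by Groebner_Basis.algebra
    qed
    then show ?thesis using assms(3) N by simp
  qed
  show False using assms(1) disc_bezout[of E x] F T by (simp add: elliptic_def)
qed

section \<open>Associativity from ideal classes of the coordinate ring\<close>

lemma infinite_alg_closed: "infinite (UNIV :: 'a::alg_closed_field set)"
proof
  assume fin: "finite (UNIV :: 'a set)"
  define p :: "'a poly" where "p = (\<Prod>a\<in>UNIV. [:-a, 1:]) + 1"
  have d: "Polynomial.degree (\<Prod>a\<in>(UNIV::'a set). [:-a, 1:]) = card (UNIV :: 'a set)"
    by (subst degree_prod_eq_sum_degree) auto
  moreover have "card (UNIV :: 'a set) > 0" using fin by (simp add: card_gt_0_iff)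
  ultimately have "Polynomial.degree p > 0"
    unfolding p_def by (subst degree_add_eq_left) auto
  then obtain x where "poly p x = 0" using alg_closed_imp_poly_has_root by blast
  moreover have "poly p x = 1" unfolding p_def using fin by (simp add: poly_prod)
  ultimately show False by simp
qed

lemma poly_eqI_infinite:
  fixes p q :: "'a::idom poly"
  assumes "infinite A" "\<And>x. x \<in> A \<Longrightarrow> poly p x = poly q x"
  shows "p = q"
proof (rule ccontr)
  assume "p \<noteq> q"
  then have "finite {x. poly (p - q) x = 0}" by (intro poly_roots_finite) simp
  moreover have "A \<subseteq> {x. poly (p - q) x = 0}" using assms(2) by auto
  ultimately show False using assms(1) finite_subset by blast
qed

locale elliptic_curve =
  fixes E :: "('k::alg_closed_field) wcurve"
  assumes ell: "elliptic E"
begin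

text \<open>The curve equation reads y^2 + \<open>lin\<close>(x) y = \<open>cubic\<close>(x), so
  that 1 and y form a basis of the coordinate ring over the polynomials in x.\<close>

definition cubic :: "'k poly" where "cubic = [:a6 E, a4 E, a2 E, 1:]"
definition lin :: "'k poly" where "lin = [:a3 E, a1 E:]"

text \<open>Elements \<open>p(x) + q(x) y\<close> of the coordinate ring are functions on the plane vanishing off the
  curve, so that they live in the ring of all functions; its unit is \<open>cfun 1 0\<close>, not \<open>1\<close>.\<close>
definition cfun :: "'k poly \<Rightarrow> 'k poly \<Rightarrow> 'k \<times> 'k \<Rightarrow> 'k" where
  "cfun p q = (\<lambda>z. if on_curve E (Pt (fst z) (snd z)) then poly p (fst z) + poly q (fst z) * snd z else 0)"

definition CR :: "('k \<times> 'k \<Rightarrow> 'k) set" where "CR = {cfun p q |p q. True}"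

text \<open>The norm down to the polynomials in x: the product of p + q y with its conjugate p + q
  (- y - \<open>lin\<close>), reduced by the curve equation.\<close>

definition nrm :: "'k poly \<Rightarrow> 'k poly \<Rightarrow> 'k poly" where
  "nrm p q = p^2 - p * q * lin - q^2 * cubic"

lemma poly_cubic [simp]: "poly cubic x = x^3 + a2 E * x^2 + a4 E * x + a6 E"
  by (simp add: cubic_def power2_eq_square power3_eq_cube algebra_simps)
lemma poly_lin [simp]: "poly lin x = a1 E * x + a3 E"
  by (simp add: lin_def)

lemma on_curve_iff: "on_curve E (Pt x y) \<longleftrightarrow> y * y = poly cubic x - poly lin x * y"
  by (auto simp: power2_eq_square algebra_simps)

lemma cfun_add: "cfun p q + cfun r s = cfun (p + r) (q + s)"
  by (auto simp: cfun_def fun_eq_iff algebra_simps)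

lemma cfun_mult: "cfun p q * cfun r s = cfun (p * r + q * s * cubic) (p * s + q * r - q * s * lin)"
proof
  fix z :: "'k \<times> 'k"
  obtain x y where z: "z = (x, y)" by (cases z)
  show "(cfun p q * cfun r s) z = cfun (p * r + q * s * cubic) (p * s + q * r - q * s * lin) z"
  proof (cases "on_curve E (Pt x y)")
    case True
    have "(poly p x + poly q x * y) * (poly r x + poly s x * y)
       = poly p x * poly r x + (poly p x * poly s x + poly q x * poly r x) * y + poly q x * poly s x * (y * y)"
      by (simp add: algebra_simps)
    also have "\<dots> = poly (p * r + q * s * cubic) x + poly (p * s + q * r - q * s * lin) x * y"
      unfolding True[unfolded on_curve_iff] by (simp only: poly_add poly_mult poly_diff) (simp add: algebra_simps)
    finally show ?thesis using True by (simp add: cfun_def z del: poly_cubic poly_lin)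
  qed (simp add: cfun_def z)
qed

lemma cfun_mult_const: "cfun [:c:] 0 * cfun r s = cfun (smult c r) (smult c s)"
  unfolding cfun_mult by simp

lemma R_cfun [simp]: "cfun p q \<in> CR" unfolding CR_def by blast
lemma R_add: "f \<in> CR \<Longrightarrow> g \<in> CR \<Longrightarrow> f + g \<in> CR"
  unfolding CR_def using cfun_add by blast
lemma R_mult: "f \<in> CR \<Longrightarrow> g \<in> CR \<Longrightarrow> f * g \<in> CR"
  unfolding CR_def using cfun_mult by blast

lemma R_one [simp]: "f \<in> CR \<Longrightarrow> cfun 1 0 * f = f"
  unfolding CR_def using cfun_mult_const[of 1] by (auto simp: one_pCons)

lemma cfun_0 [simp]: "cfun 0 0 = 0"
  by (auto simp: cfun_def fun_eq_iff)
lemma R_0 [simp]: "0 \<in> CR" using R_cfun[of 0 0] by simp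

lemma nrm_mult: "nrm (p * r + q * s * cubic) (p * s + q * r - q * s * lin) = nrm p q * nrm r s"
  unfolding nrm_def by Groebner_Basis.algebra

lemma degree_cubic: "Polynomial.degree cubic = 3" unfolding cubic_def by simp

text \<open>The degree of p^2 is even, that of q^2 \<open>cubic\<close> is odd, and the cross term
  stays below the larger of the two, so nothing cancels. The gap below degree 3 is what keeps the
  ideal of an affine point from being principal.\<close>

lemma nrm_cases:
  obtains "q = 0" "nrm p q = p^2"
  | "q \<noteq> 0" "Polynomial.degree (nrm p q) \<ge> 3"
proof (cases "q = 0")
  case True
  then show thesis using that(1) by (simp add: nrm_def)
next
  case False
  let ?d = "Polynomial.degree"
  have dq: "?d (q^2 * cubic) = 2 * ?d q + 3"
    using False degree_cubic by (subst degree_mult_eq) (auto simp: degree_power_eq)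
  have dD: "?d lin \<le> 1" unfolding lin_def by simp
  have d1: "?d (p * q * lin) \<le> ?d p + ?d q + 1"
    using degree_mult_le[of "p * q" lin] degree_mult_le[of p q] dD by simp
  show thesis
  proof (cases "?d p \<le> ?d q + 1")
    case True
    have "?d (p^2) \<le> 2 * ?d p" by (simp add: degree_power_le mult.commute)
    then have "?d (p^2 - p * q * lin) < ?d (q^2 * cubic)"
      using d1 True dq by (intro degree_diff_less) auto
    then have "?d (nrm p q) = 2 * ?d q + 3"
      unfolding nrm_def using dq degree_add_eq_right[of "p^2 - p * q * lin" "- (q^2 * cubic)"] by simp
    then show thesis using that(2) False by simp
  next
    case F: False
    then have "p \<noteq> 0" by auto
    then have dp: "?d (p^2) = 2 * ?d p" by (simp add: degree_power_eq)
    have "?d (p * q * lin + q^2 * cubic) < 2 * ?d p"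
      using d1 dq F by (intro degree_add_less) auto
    then have "?d (p^2 - (p * q * lin + q^2 * cubic)) = 2 * ?d p"
      using dp degree_add_eq_left[of "- (p * q * lin + q^2 * cubic)" "p^2"]
      unfolding diff_conv_add_uminus degree_minus by simp
    moreover have "nrm p q = p^2 - (p * q * lin + q^2 * cubic)" unfolding nrm_def by simp
    ultimately show thesis using that(2) False F by simp
  qed
qed

lemma nrm_eq_0: "nrm p q = 0 \<longleftrightarrow> p = 0 \<and> q = 0"
  by (rule nrm_cases[where p = p and q = q]) auto

lemma ex_on_curve: "\<exists>y. on_curve E (Pt x y)"
proof -
  obtain y where "poly [:- poly cubic x, poly lin x, 1:] y = 0"
    using alg_closed_imp_poly_has_root[of "[:- poly cubic x, poly lin x, 1:]"] by auto
  then have "on_curve E (Pt x y)"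
    unfolding on_curve_iff by (simp add: algebra_simps eq_neg_iff_add_eq_0)
  then show ?thesis ..
qed

text \<open>Above every x the function vanishes at a point and at its negative, so its norm vanishes
  at every x and is the zero polynomial. Hence \<open>p\<close> and \<open>q\<close> are determined
  by the function, and identities can be compared coefficient by coefficient.\<close>

lemma cfun_eq_0_iff: "cfun p q = 0 \<longleftrightarrow> p = 0 \<and> q = 0"
proof
  assume 0: "cfun p q = 0"
  have "poly (nrm p q) x = 0" for x
  proof -
    obtain y where y: "on_curve E (Pt x y)" using ex_on_curve by blast
    then have y': "on_curve E (Pt x (- y - a1 E * x - a3 E))"
      using on_curve_neg[of E "Pt x y"] by simp
    have "poly p x + poly q x * y = 0" "poly p x + poly q x * (- y - a1 E * x - a3 E) = 0"
      using fun_cong[OF 0, of "(x, y)"] y fun_cong[OF 0, of "(x, - y - a1 E * x - a3 E)"] y'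
      by (auto simp: cfun_def)
    moreover have "poly (nrm p q) x = (poly p x + poly q x * y) * (poly p x + poly q x * (- y - poly lin x))"
    proof -
      have "(poly p x + poly q x * y) * (poly p x + poly q x * (- y - poly lin x))
         = poly p x ^ 2 - poly p x * poly q x * poly lin x - poly q x ^ 2 * (y * y + poly lin x * y)"
        by Groebner_Basis.algebra
      then show ?thesis
        using y[unfolded on_curve_iff] unfolding nrm_def by (simp del: poly_cubic poly_lin)
    qed
    ultimately show ?thesis by simp
  qed
  then have "nrm p q = 0" using poly_eqI_infinite[OF infinite_alg_closed, of "nrm p q" 0] by simp
  then show "p = 0 \<and> q = 0" by (simp add: nrm_eq_0)
qed simp

lemma cfun_minus: "- cfun p q = cfun (- p) (- q)"
  by (auto simp: cfun_def fun_eq_iff)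

lemma cfun_diff: "cfun p q - cfun r s = cfun (p - r) (q - s)"
  unfolding diff_conv_add_uminus cfun_minus cfun_add ..

lemma cfun_eq_iff: "cfun p q = cfun r s \<longleftrightarrow> p = r \<and> q = s"
  using cfun_eq_0_iff[of "p - r" "q - s"] unfolding cfun_diff[symmetric] by simp

text \<open>The norm is multiplicative and vanishes only at 0.\<close>

lemma R_integral:
  assumes "f \<in> CR" "g \<in> CR"
  shows "f * g = 0 \<longleftrightarrow> f = 0 \<or> g = 0"
proof -
  obtain p q r s where fg: "f = cfun p q" "g = cfun r s"
    using assms unfolding CR_def by blast
  have "f * g = 0 \<longleftrightarrow> nrm p q * nrm r s = 0"
    unfolding fg cfun_mult cfun_eq_0_iff nrm_eq_0[symmetric] nrm_mult ..
  then show ?thesis unfolding fg cfun_eq_0_iff by (simp add: nrm_eq_0)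
qed

lemma R_minus: "f \<in> CR \<Longrightarrow> - f \<in> CR"
  unfolding CR_def using cfun_minus by blast

lemma R_cancel:
  assumes "f \<in> CR" "g \<in> CR" "h \<in> CR" "h \<noteq> 0" "h * f = h * g"
  shows "f = g"
proof -
  have "h * (f - g) = 0" using assms(5) by (simp add: right_diff_distrib)
  moreover have "f - g \<in> CR" using R_add[OF assms(1) R_minus[OF assms(2)]] by simp
  ultimately show ?thesis using R_integral assms by simp
qed

section \<open>Ideals of the coordinate ring given by generators, and their classes\<close>

definition idl :: "('k \<times> 'k \<Rightarrow> 'k) set \<Rightarrow> ('k \<times> 'k \<Rightarrow> 'k) set" where
  "idl G = \<Inter>{S. 0 \<in> S \<and> (\<forall>g\<in>G. \<forall>r\<in>CR. \<forall>a\<in>S. r * g + a \<in> S)}"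

lemma idl_zero: "0 \<in> idl G"
  unfolding idl_def by blast

lemma idl_step: "g \<in> G \<Longrightarrow> r \<in> CR \<Longrightarrow> a \<in> idl G \<Longrightarrow> r * g + a \<in> idl G"
  unfolding idl_def by blast

lemma idl_induct [consumes 1, case_names zero step]:
  assumes "a \<in> idl G" "P 0"
    and "\<And>g r a. g \<in> G \<Longrightarrow> r \<in> CR \<Longrightarrow> a \<in> idl G \<Longrightarrow> P a \<Longrightarrow> P (r * g + a)"
  shows "P a"
proof -
  have "idl G \<subseteq> {a \<in> idl G. P a}"
    using assms(2,3) by (subst idl_def, intro Inter_lower) (auto intro: idl_zero idl_step)
  then show ?thesis using assms(1) by blast
qed

lemma idl_add:
  assumes "a \<in> idl G" "b \<in> idl G"
  shows "a + b \<in> idl G"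
proof (rule idl_induct[of a G "\<lambda>a. a + b \<in> idl G"])
  fix g r a assume "g \<in> G" "r \<in> CR" "a + b \<in> idl G"
  then show "r * g + a + b \<in> idl G" using idl_step[of g G r "a + b"] by (simp only: add.assoc)
qed (use assms in simp_all)

lemma idl_mult:
  assumes "a \<in> idl G" "s \<in> CR"
  shows "s * a \<in> idl G"
proof (rule idl_induct[of a G "\<lambda>a. s * a \<in> idl G"])
  fix g r a assume "g \<in> G" "r \<in> CR" "s * a \<in> idl G"
  then show "s * (r * g + a) \<in> idl G"
    using idl_step[of g G "s * r" "s * a"] assms by (simp only: R_mult distrib_left mult.assoc)
qed (use assms idl_zero in simp_all)

lemma idl_gen: "g \<in> G \<Longrightarrow> g \<in> CR \<Longrightarrow> g \<in> idl G"
  using idl_step[of g G "cfun 1 0" 0] by (simp add: idl_zero)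

lemma idl_mono:
  assumes "G \<subseteq> idl H"
  shows "idl G \<subseteq> idl H"
proof
  fix a assume "a \<in> idl G"
  then show "a \<in> idl H"
  proof (rule idl_induct[of a G "\<lambda>a. a \<in> idl H"])
    fix g r a assume "g \<in> G" "r \<in> CR" "a \<in> idl H"
    then show "r * g + a \<in> idl H" using assms idl_add idl_mult by blast
  qed (rule idl_zero)
qed

lemma idl_eqI: "G \<subseteq> idl H \<Longrightarrow> H \<subseteq> idl G \<Longrightarrow> idl G = idl H"
  using idl_mono by blast

lemma idl_subset_R:
  assumes "G \<subseteq> CR"
  shows "idl G \<subseteq> CR"
proof
  fix a assume "a \<in> idl G"
  then show "a \<in> CR"
  proof (rule idl_induct[of a G "\<lambda>a. a \<in> CR"])
    fix g r a assume "g \<in> G" "r \<in> CR" "a \<in> CR"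
    then show "r * g + a \<in> CR" using assms R_add R_mult by blast
  qed (rule R_0)
qed

text \<open>Products of ideals are formed on generating sets, where commutativity and associativity
  are plain identities of sets; \<open>idl_gprod_cong\<close> shows that the ideal obtained depends
  only on the ideals generated.\<close>

definition gprod :: "('k \<times> 'k \<Rightarrow> 'k) set \<Rightarrow> ('k \<times> 'k \<Rightarrow> 'k) set \<Rightarrow> ('k \<times> 'k \<Rightarrow> 'k) set" where
  "gprod G H = {g * h |g h. g \<in> G \<and> h \<in> H}"

lemma gprod_comm: "gprod G H = gprod H G"
  unfolding gprod_def by (metis (no_types, lifting) mult.commute)

lemma gprod_assoc: "gprod (gprod G H) K = gprod G (gprod H K)"
proof
  show "gprod (gprod G H) K \<subseteq> gprod G (gprod H K)"
    unfolding gprod_def by clarsimp (metis mult.assoc)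
  show "gprod G (gprod H K) \<subseteq> gprod (gprod G H) K"
    unfolding gprod_def by clarsimp (metis mult.assoc)
qed

lemma gprod_left_comm: "gprod G (gprod H K) = gprod H (gprod G K)"
  by (metis gprod_assoc gprod_comm)

lemmas gprod_ac = gprod_assoc gprod_comm gprod_left_comm

lemma gprod_R: "G \<subseteq> CR \<Longrightarrow> H \<subseteq> CR \<Longrightarrow> gprod G H \<subseteq> CR"
  unfolding gprod_def by (auto intro: R_mult)

lemma gprod_one: "G \<subseteq> CR \<Longrightarrow> gprod {cfun 1 0} G = G"
proof -
  have "gprod {cfun 1 0} G = (\<lambda>h. cfun 1 0 * h) ` G" unfolding gprod_def by blast
  also have "\<dots> = G" if "G \<subseteq> CR" using that R_one by (metis (no_types, lifting) image_cong image_ident subsetD)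
  finally show "gprod {cfun 1 0} G = G" if "G \<subseteq> CR" using that by simp
qed

lemma idl_gprod_left:
  assumes "a \<in> idl G" "h \<in> H"
  shows "a * h \<in> idl (gprod G H)"
proof (rule idl_induct[of a G "\<lambda>a. a * h \<in> idl (gprod G H)"])
  fix g r a assume *: "g \<in> G" "r \<in> CR" "a * h \<in> idl (gprod G H)"
  then have "g * h \<in> gprod G H" unfolding gprod_def using assms(2) by blast
  then show "(r * g + a) * h \<in> idl (gprod G H)"
    using idl_step[of "g * h" "gprod G H" r "a * h"] * by (simp only: distrib_right mult.assoc)
qed (use assms idl_zero in simp_all)

lemma idl_gprod_cong: "idl G = idl G' \<Longrightarrow> G \<subseteq> CR \<Longrightarrow> G' \<subseteq> CR \<Longrightarrow> idl (gprod G H) = idl (gprod G' H)"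
proof (rule idl_eqI)
  assume eq: "idl G = idl G'" and CR: "G \<subseteq> CR" "G' \<subseteq> CR"
  show "gprod G H \<subseteq> idl (gprod G' H)"
  proof
    fix x assume "x \<in> gprod G H"
    then obtain g h where "x = g * h" "g \<in> G" "h \<in> H" unfolding gprod_def by blast
    moreover have "g \<in> idl G'" using eq CR \<open>g \<in> G\<close> idl_gen[of g G] by blast
    ultimately show "x \<in> idl (gprod G' H)" using idl_gprod_left by blast
  qed
  show "gprod G' H \<subseteq> idl (gprod G H)"
  proof
    fix x assume "x \<in> gprod G' H"
    then obtain g h where "x = g * h" "g \<in> G'" "h \<in> H" unfolding gprod_def by blast
    moreover have "g \<in> idl G" using eq CR \<open>g \<in> G'\<close> idl_gen[of g G'] by blast
    ultimately show "x \<in> idl (gprod G H)" using idl_gprod_left by blast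
  qed
qed

text \<open>Equality in the ideal class group, written as a G = b H with nonzero ring elements so
  that no fractional ideals occur.\<close>

definition cls :: "('k \<times> 'k \<Rightarrow> 'k) set \<Rightarrow> ('k \<times> 'k \<Rightarrow> 'k) set \<Rightarrow> bool" where
  "cls G H \<longleftrightarrow> (\<exists>a b. a \<in> CR \<and> b \<in> CR \<and> a \<noteq> 0 \<and> b \<noteq> 0 \<and> idl (gprod {a} G) = idl (gprod {b} H))"

lemma one_ne_0: "cfun 1 0 \<noteq> 0" by (simp add: cfun_eq_0_iff)

lemma cls_refl: "cls G G"
  unfolding cls_def using one_ne_0 R_cfun by blast

lemma cls_sym: "cls G H \<Longrightarrow> cls H G"
  unfolding cls_def by metis

lemma cls_gprod:
  assumes "cls G G'" "G \<subseteq> CR" "G' \<subseteq> CR"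
  shows "cls (gprod G H) (gprod G' H)"
proof -
  obtain a b where ab: "a \<in> CR" "b \<in> CR" "a \<noteq> 0" "b \<noteq> 0" "idl (gprod {a} G) = idl (gprod {b} G')"
    using assms unfolding cls_def by blast
  have "idl (gprod (gprod {a} G) H) = idl (gprod (gprod {b} G') H)"
    using ab assms by (intro idl_gprod_cong gprod_R) auto
  then show ?thesis unfolding cls_def gprod_assoc using ab by blast
qed

lemma cls_trans:
  assumes "cls G H" "cls H K" and CR: "G \<subseteq> CR" "H \<subseteq> CR" "K \<subseteq> CR"
  shows "cls G K"
proof -
  obtain a b where ab: "a \<in> CR" "b \<in> CR" "a \<noteq> 0" "b \<noteq> 0" "idl (gprod {a} G) = idl (gprod {b} H)"
    using assms unfolding cls_def by blast
  obtain c d where cd: "c \<in> CR" "d \<in> CR" "c \<noteq> 0" "d \<noteq> 0" "idl (gprod {c} H) = idl (gprod {d} K)"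
    using assms unfolding cls_def by blast
  have "idl (gprod (gprod {a} G) {c}) = idl (gprod (gprod {b} H) {c})"
    using ab cd CR by (intro idl_gprod_cong gprod_R) auto
  moreover have "idl (gprod (gprod {c} H) {b}) = idl (gprod (gprod {d} K) {b})"
    using ab cd CR by (intro idl_gprod_cong gprod_R) auto
  moreover have "gprod (gprod {b} H) {c} = gprod (gprod {c} H) {b}"
    by (simp only: gprod_ac)
  moreover have "gprod (gprod {a} G) {c} = gprod {c * a} G" "gprod (gprod {d} K) {b} = gprod {b * d} K"
  proof -
    have *: "gprod {u} {v} = {u * v}" for u v unfolding gprod_def by blast
    show "gprod (gprod {a} G) {c} = gprod {c * a} G"
      unfolding gprod_comm[of "gprod {a} G" "{c}"] gprod_assoc[symmetric] * ..
    show "gprod (gprod {d} K) {b} = gprod {b * d} K"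
      unfolding gprod_comm[of "gprod {d} K" "{b}"] gprod_assoc[symmetric] * ..
  qed
  ultimately have "idl (gprod {c * a} G) = idl (gprod {b * d} K)" by simp
  moreover have "c * a \<noteq> 0" "b * d \<noteq> 0" "c * a \<in> CR" "b * d \<in> CR"
    using ab cd R_integral R_mult by auto
  ultimately show ?thesis unfolding cls_def by blast
qed

end

section \<open>The ideal class of a point\<close>

context elliptic_curve
begin

text \<open>For an affine point this generates the maximal ideal of the functions vanishing there. O
  lies off the affine curve and receives the unit ideal, so that it becomes the neutral
  class.\<close>

definition pt_ideal :: "'k point \<Rightarrow> ('k \<times> 'k \<Rightarrow> 'k) set" where
  "pt_ideal P = (case P of Infinity \<Rightarrow> {cfun 1 0} | Pt x y \<Rightarrow> {cfun [:-x, 1:] 0, cfun [:-y:] 1})"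

lemma pt_ideal_R [simp]: "pt_ideal P \<subseteq> CR"
  unfolding pt_ideal_def by (cases P) auto

lemma R_eqI:
  assumes "f \<in> CR" "g \<in> CR" "\<And>x y. on_curve E (Pt x y) \<Longrightarrow> f (x, y) = g (x, y)"
  shows "f = g"
proof
  fix z :: "'k \<times> 'k"
  obtain x y where z: "z = (x, y)" by (cases z)
  show "f z = g z"
  proof (cases "on_curve E (Pt x y)")
    case False
    then show ?thesis using assms(1,2) unfolding CR_def z by (auto simp: cfun_def)
  qed (use assms(3) z in simp)
qed

lemma cfun_apply: "on_curve E (Pt x y) \<Longrightarrow> cfun p q (x, y) = poly p x + poly q x * y"
  by (simp add: cfun_def)

lemma idl_const:
  assumes "cfun [:c:] 0 * f \<in> idl G" "c \<noteq> 0" "f \<in> CR"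
  shows "f \<in> idl G"
proof -
  have "cfun [:1/c:] 0 * (cfun [:c:] 0 * f) \<in> idl G"
    using assms(1) by (rule idl_mult) simp
  moreover have "cfun [:1/c:] 0 * (cfun [:c:] 0 * f) = f"
    unfolding mult.assoc[symmetric] cfun_mult_const using assms(2,3) R_one by (simp add: one_pCons del: times_fun_apply)
  ultimately show ?thesis by simp
qed

lemma idl_gprod_unit:
  assumes "cfun 1 0 \<in> idl G" "G \<subseteq> CR" "a \<in> CR"
  shows "idl (gprod {a} G) = idl {a}"
proof (rule idl_eqI)
  show "gprod {a} G \<subseteq> idl {a}"
    unfolding gprod_def using assms idl_gen[of a "{a}"] idl_mult[of a "{a}"]
    by (auto simp: mult.commute[of a])
  have "cfun 1 0 * a \<in> idl (gprod G {a})" using assms(1) by (rule idl_gprod_left) simp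
  then show "{a} \<subseteq> idl (gprod {a} G)" using assms(3) by (simp add: gprod_comm)
qed

lemma cls_principal:
  assumes "cfun 1 0 \<in> idl G" "G \<subseteq> CR" "a \<in> CR" "a \<noteq> 0"
  shows "cls (gprod {a} G) {cfun 1 0}"
proof -
  have "gprod {cfun 1 0} (gprod {a} G) = gprod {a} G"
    using assms by (intro gprod_one gprod_R) auto
  moreover have "gprod {a} {cfun 1 0} = {a}" using gprod_one[of "{a}"] assms by (simp add: gprod_comm)
  ultimately show ?thesis
    unfolding cls_def using idl_gprod_unit[OF assms(1-3)] one_ne_0 assms(3,4) R_cfun by metis
qed

text \<open>This is the vertical line. As P lies on the curve, (y - y1)(y - y(-P)) is divisible by x
  - x1, with quotient \<open>Q\<close>; so all four products of generators are multiples of x - x1,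
  and the cofactors \<open>XX\<close>, \<open>Y\<close>, \<open>Y'\<close>, \<open>Q\<close>
  generate the unit ideal because the curve is smooth at P.\<close>

lemma pt_ideal_mult_neg:
  assumes "on_curve E P"
  shows "cls (gprod (pt_ideal P) (pt_ideal (neg E P))) {cfun 1 0}"
proof (cases P)
  case Infinity
  then show ?thesis using cls_refl[of "{cfun 1 0}"] gprod_one[of "{cfun 1 0}"]
    by (simp add: pt_ideal_def)
next
  case (Pt x1 y1)
  define e where "e = 2 * y1 + a1 E * x1 + a3 E"
  define n where "n = 3 * x1^2 + 2 * a2 E * x1 + a4 E - a1 E * y1"
  define XX where "XX = cfun [:-x1, 1:] 0"
  define Y where "Y = cfun [:-y1:] 1"
  define Y' where "Y' = cfun [:y1 + a1 E * x1 + a3 E:] 1"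
  define Q where "Q = cfun [:x1^2 + a2 E * x1 + a4 E, x1 + a2 E, 1:] [:- a1 E:]"
  define G where "G = {XX, Y, Y', Q}"
  have CR: "XX \<in> CR" "Y \<in> CR" "Y' \<in> CR" "Q \<in> CR" unfolding XX_def Y_def Y'_def Q_def by auto
  have GR: "G \<subseteq> CR" unfolding G_def using CR by auto
  have curve1: "y1^2 + a1 E * x1 * y1 + a3 E * y1 = x1^3 + a2 E * x1^2 + a4 E * x1 + a6 E"
    using assms Pt by simp
  have YY: "Y * Y' = XX * Q"
  proof (rule R_eqI)
    fix x y assume xy: "on_curve E (Pt x y)"
    have "(y - y1) * (y + (y1 + a1 E * x1 + a3 E)) - (x - x1) * (x^2 + (x1 + a2 E) * x + (x1^2 + a2 E * x1 + a4 E) - a1 E * y)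
      = (y^2 + a1 E * x * y + a3 E * y - (x^3 + a2 E * x^2 + a4 E * x + a6 E))
        - (y1^2 + a1 E * x1 * y1 + a3 E * y1 - (x1^3 + a2 E * x1^2 + a4 E * x1 + a6 E))"
      by Groebner_Basis.algebra
    also have "\<dots> = 0" using curve1 xy by simp
    finally show "(Y * Y') (x, y) = (XX * Q) (x, y)"
      using xy unfolding XX_def Y_def Y'_def Q_def
      by (simp add: cfun_apply algebra_simps power2_eq_square del: on_curve.simps)
  qed (use CR in \<open>auto intro: R_mult\<close>)
  have "gprod (pt_ideal P) (pt_ideal (neg E P)) = {XX * XX, XX * Y', Y * XX, Y * Y'}"
    unfolding gprod_def Pt pt_ideal_def XX_def Y_def Y'_def by (auto simp: algebra_simps)
  also have "\<dots> = gprod {XX} G"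
    unfolding gprod_def G_def YY by (auto simp: mult.commute)
  finally have eq: "gprod (pt_ideal P) (pt_ideal (neg E P)) = gprod {XX} G" .
  have gen: "XX \<in> idl G" "Y \<in> idl G" "Y' \<in> idl G" "Q \<in> idl G"
    using idl_gen CR by (auto simp: G_def)
  \<comment> \<open>\<open>e\<close> and \<open>n\<close> are the values of \<open>Y'\<close> and
    \<open>Q\<close> at P. By smoothness one of them is nonzero, and subtracting multiples of the
    other generators leaves that constant in the ideal.\<close>
  have one: "cfun 1 0 \<in> idl G"
  proof (cases "e = 0")
    case False
    have "cfun [:e:] 0 * cfun 1 0 = Y' + cfun [:-1:] 0 * Y"
      unfolding Y_def Y'_def cfun_mult_const cfun_add cfun_eq_iff e_def by (simp add: algebra_simps one_pCons)
    also have "\<dots> \<in> idl G" using gen by (intro idl_add idl_mult) auto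
    finally show ?thesis by (rule idl_const) (use False in simp_all)
  next
    case True
    then have "n \<noteq> 0" using nonsingular[OF ell, of x1 y1] assms unfolding Pt e_def n_def by simp
    have "cfun [:n:] 0 * cfun 1 0 = Q + (cfun [:- (2 * x1 + a2 E), -1:] 0 * XX + cfun [:a1 E:] 0 * Y)"
      unfolding XX_def Y_def Q_def cfun_mult_const n_def cfun_mult cfun_add cfun_eq_iff
      by (simp add: one_pCons power2_eq_square algebra_simps)
    also have "\<dots> \<in> idl G" using gen by (intro idl_add idl_mult) auto
    finally show ?thesis by (rule idl_const) (use \<open>n \<noteq> 0\<close> in simp_all)
  qed
  show ?thesis unfolding eq
    by (rule cls_principal[OF one GR CR(1)]) (simp add: XX_def cfun_eq_0_iff)
qed

lemma idl_pair_shift: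
  assumes "f \<in> CR" "g \<in> CR" "r \<in> CR"
  shows "idl {f, g} = idl {f, g + r * f}"
proof (rule idl_eqI)
  show "{f, g + r * f} \<subseteq> idl {f, g}"
  proof -
    have "f \<in> idl {f, g}" "g \<in> idl {f, g}" using assms by (auto intro!: idl_gen)
    then show ?thesis using idl_add[OF _ idl_mult[OF _ assms(3)]] by blast
  qed
  have "g + r * f \<in> CR" using assms by (intro R_add R_mult)
  then have "(g + r * f) + (- r) * f \<in> idl {f, g + r * f}"
    using assms by (intro idl_add idl_mult idl_gen R_minus) simp_all
  moreover have "(g + r * f) + (- r) * f = g" by simp
  ultimately show "{f, g} \<subseteq> idl {f, g + r * f}"
    using assms idl_gen[of f "{f, g + r * f}"] by (metis empty_subsetI insertI1 insert_subset)
qed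

text \<open>Let \<open>L\<close> be the line through the two points and \<open>M\<close> its
  conjugate up to sign, which passes through the sum. The curve equation becomes (x - x1)(x - x2)(x
  - x3) = \<open>L * M\<close>. In each point ideal the generator y - y(P) may be replaced by
  \<open>L\<close> or \<open>M\<close>; multiplying the two ideals by x - x3 then makes every
  generator divisible by \<open>L\<close>, and the quotient is the ideal of the sum.\<close>

lemma pt_ideal_add_line:
  assumes P: "on_curve E (Pt x1 y1)" and Q: "on_curve E (Pt x2 y2)"
    and ne: "Pt x2 y2 \<noteq> neg E (Pt x1 y1)"
  shows "cls (gprod (pt_ideal (Pt x1 y1)) (pt_ideal (Pt x2 y2))) (pt_ideal (add E (Pt x1 y1) (Pt x2 y2)))"
proof -
  obtain l n x3 where
    s: "add E (Pt x1 y1) (Pt x2 y2) = Pt x3 (- (l + a1 E) * x3 - n - a3 E)"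
    and y1: "y1 = l * x1 + n" and y2: "y2 = l * x2 + n"
    and c: "\<And>x. x^3 + a2 E * x^2 + a4 E * x + a6 E - (l * x + n)^2 - (a1 E * x + a3 E) * (l * x + n)
         = (x - x1) * (x - x2) * (x - x3)"
    and t: "x1 = x2 \<Longrightarrow> 2 * y1 + a1 E * x1 + a3 E \<noteq> 0"
    using add_line[OF P Q ne] by metis
  define e where "e = 2 * y1 + a1 E * x1 + a3 E"
  define XX where "XX = (\<lambda>a. cfun [:-a, 1:] 0)"
  define L where "L = cfun [:-n, -l:] 1"
  define M where "M = cfun [:n + a3 E, l + a1 E:] 1"
  have CR: "XX a \<in> CR" "L \<in> CR" "M \<in> CR" for a unfolding XX_def L_def M_def by auto
  have XXX: "XX x1 * XX x2 * XX x3 = L * M"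
  proof (rule R_eqI)
    fix x y assume xy: "on_curve E (Pt x y)"
    have "(x - x1) * (x - x2) * (x - x3) - (y - l * x - n) * (y + l * x + n + a1 E * x + a3 E)
      = (x^3 + a2 E * x^2 + a4 E * x + a6 E - (y^2 + a1 E * x * y + a3 E * y))"
      unfolding c[symmetric] by Groebner_Basis.algebra
    also have "\<dots> = 0" using xy by simp
    finally show "(XX x1 * XX x2 * XX x3) (x, y) = (L * M) (x, y)"
      using xy unfolding XX_def L_def M_def
      by (simp add: cfun_apply algebra_simps del: on_curve.simps)
  qed (use CR in \<open>auto intro: R_mult\<close>)
  have IP: "idl (pt_ideal (Pt x1 y1)) = idl {XX x1, L}"
  proof -
    have "L = cfun [:-y1:] 1 + cfun [:-l:] 0 * XX x1"
      unfolding L_def XX_def cfun_mult cfun_add cfun_eq_iff y1 by simp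
    then show ?thesis using idl_pair_shift[of "XX x1" "cfun [:-y1:] 1" "cfun [:-l:] 0"] CR
      by (simp add: pt_ideal_def XX_def)
  qed
  have IQ: "idl (pt_ideal (Pt x2 y2)) = idl {XX x2, L}"
  proof -
    have "L = cfun [:-y2:] 1 + cfun [:-l:] 0 * XX x2"
      unfolding L_def XX_def cfun_mult cfun_add cfun_eq_iff y2 by simp
    then show ?thesis using idl_pair_shift[of "XX x2" "cfun [:-y2:] 1" "cfun [:-l:] 0"] CR
      by (simp add: pt_ideal_def XX_def)
  qed
  have IS: "idl (pt_ideal (add E (Pt x1 y1) (Pt x2 y2))) = idl {XX x3, M}"
  proof -
    have "M = cfun [:- (- (l + a1 E) * x3 - n - a3 E):] 1 + cfun [:l + a1 E:] 0 * XX x3"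
      unfolding M_def XX_def cfun_mult cfun_add cfun_eq_iff by (simp add: algebra_simps)
    then show ?thesis
      using idl_pair_shift[of "XX x3" "cfun [:- (- (l + a1 E) * x3 - n - a3 E):] 1" "cfun [:l + a1 E:] 0"] CR
      unfolding s by (simp add: pt_ideal_def XX_def)
  qed
  define G where "G = {M, XX x1 * XX x3, XX x2 * XX x3, L * XX x3}"
  have GR: "G \<subseteq> CR" unfolding G_def using CR by (auto intro: R_mult)
  have gen: "g \<in> G \<Longrightarrow> g \<in> idl G" for g using GR idl_gen by blast
  have "idl (gprod {XX x3} (gprod (pt_ideal (Pt x1 y1)) (pt_ideal (Pt x2 y2)))) = idl (gprod {XX x3} (gprod {XX x1, L} {XX x2, L}))"
  proof -
    have "idl (gprod (pt_ideal (Pt x1 y1)) (gprod (pt_ideal (Pt x2 y2)) {XX x3})) = idl (gprod {XX x1, L} (gprod (pt_ideal (Pt x2 y2)) {XX x3}))"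
      using CR by (intro idl_gprod_cong IP) auto
    also have "\<dots> = idl (gprod (pt_ideal (Pt x2 y2)) (gprod {XX x3} {XX x1, L}))"
      by (simp add: gprod_assoc gprod_comm[of "{XX x1, L}"])
    also have "\<dots> = idl (gprod {XX x2, L} (gprod {XX x3} {XX x1, L}))"
      using CR by (intro idl_gprod_cong IQ) auto
    finally show ?thesis
      by (simp only: gprod_ac)
  qed
  also have "gprod {XX x3} (gprod {XX x1, L} {XX x2, L}) = gprod {L} G"
  proof -
    have 1: "gprod {XX x3} (gprod {XX x1, L} {XX x2, L}) =
      {XX x3 * (XX x1 * XX x2), XX x3 * (XX x1 * L), XX x3 * (L * XX x2), XX x3 * (L * L)}"
      unfolding gprod_def by auto
    have 2: "gprod {L} G = {L * M, L * (XX x1 * XX x3), L * (XX x2 * XX x3), L * (L * XX x3)}"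
      unfolding gprod_def G_def by auto
    have "XX x3 * (XX x1 * XX x2) = L * M" "XX x3 * (XX x1 * L) = L * (XX x1 * XX x3)"
      "XX x3 * (L * XX x2) = L * (XX x2 * XX x3)" "XX x3 * (L * L) = L * (L * XX x3)"
      using XXX by (simp_all only: mult_ac)
    then show ?thesis unfolding 1 2 by (simp only:)
  qed
  also have "idl (gprod {L} G) = idl (gprod {L} (pt_ideal (add E (Pt x1 y1) (Pt x2 y2))))"
  proof -
    have "idl G = idl {XX x3, M}"
    proof (rule idl_eqI)
      have "XX x3 \<in> idl {XX x3, M}" "M \<in> idl {XX x3, M}" using CR by (auto intro!: idl_gen)
      then show "G \<subseteq> idl {XX x3, M}"
        unfolding G_def using CR by (auto intro!: idl_mult)
      \<comment> \<open>For a chord the difference of x - x1 and x - x2 is a nonzero constant. For a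
        tangent the constant comes from \<open>M\<close> - \<open>L\<close> = e + (2 l + a1)(x -
        x1).\<close>
      have "XX x3 \<in> idl G"
      proof (cases "x1 = x2")
        case False
        have "cfun [:x2 - x1:] 0 * XX x3 = XX x1 * XX x3 + cfun [:-1:] 0 * (XX x2 * XX x3)"
          unfolding XX_def cfun_mult cfun_add cfun_eq_iff by (simp add: algebra_simps)
        also have "\<dots> \<in> idl G" by (intro idl_add idl_mult gen) (auto simp: G_def)
        finally show ?thesis by (rule idl_const) (use False CR in simp_all)
      next
        case True
        have "cfun [:e:] 0 * XX x3 = XX x3 * M + (cfun [:-1:] 0 * (L * XX x3) + cfun [:- (2 * l + a1 E):] 0 * (XX x1 * XX x3))"
          unfolding XX_def L_def M_def cfun_mult cfun_add cfun_eq_iff e_def y1 by (simp add: algebra_simps)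
        also have "\<dots> \<in> idl G" using CR by (intro idl_add idl_mult gen) (auto simp: G_def)
        finally show ?thesis by (rule idl_const) (use t[OF True] CR in \<open>simp_all add: e_def\<close>)
      qed
      then show "{XX x3, M} \<subseteq> idl G" using gen by (auto simp: G_def)
    qed
    then have "idl (gprod G {L}) = idl (gprod (pt_ideal (add E (Pt x1 y1) (Pt x2 y2))) {L})"
      using GR IS by (intro idl_gprod_cong) auto
    then show ?thesis by (simp add: gprod_comm)
  qed
  finally show ?thesis
    unfolding cls_def using CR
    by (intro exI[of _ "XX x3"] exI[of _ L]) (auto simp: XX_def L_def cfun_eq_0_iff)
qed

lemma pt_ideal_add:
  assumes "on_curve E P" "on_curve E Q"
  shows "cls (gprod (pt_ideal P) (pt_ideal Q)) (pt_ideal (add E P Q))"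
proof (cases "P = Infinity \<or> Q = Infinity")
  case True
  then show ?thesis
  proof
    assume "P = Infinity"
    then show ?thesis using gprod_one[of "pt_ideal Q"] cls_refl[of "pt_ideal Q"] by (simp add: pt_ideal_def[of Infinity])
  next
    assume "Q = Infinity"
    then show ?thesis using gprod_one[of "pt_ideal P"] cls_refl[of "pt_ideal P"]
      by (simp add: pt_ideal_def[of Infinity] gprod_comm[of "pt_ideal P"])
  qed
next
  case F: False
  show ?thesis
  proof (cases "Q = neg E P")
    case True
    then have "add E P Q = Infinity" by (simp add: add_neg_iff)
    then show ?thesis using pt_ideal_mult_neg[OF assms(1)] True by (simp add: pt_ideal_def[of Infinity])
  next
    case False
    then show ?thesis using F assms pt_ideal_add_line by (cases P; cases Q) (auto simp del: on_curve.simps add.simps neg.simps)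
  qed
qed

lemma idl_gprD:
  assumes "f \<in> idl (gprod {a} G)"
  shows "\<exists>u\<in>idl G. f = a * u"
proof (rule idl_induct[OF assms])
  show "\<exists>u\<in>idl G. 0 = a * u" using idl_zero by (intro bexI[of _ 0]) simp_all
  fix g r b assume *: "g \<in> gprod {a} G" "r \<in> CR" "\<exists>u\<in>idl G. b = a * u"
  then obtain u g' where "u \<in> idl G" "b = a * u" "g' \<in> G" "g = a * g'"
    unfolding gprod_def by blast
  then have "r * g' + u \<in> idl G" "r * g + b = a * (r * g' + u)"
    using idl_step * by (simp_all only: distrib_left mult.left_commute)
  then show "\<exists>u\<in>idl G. r * g + b = a * u" by blast
qed

text \<open>A generator c of the point ideal divides x - x1, so its norm divides (x - x1)^2; by the
  degree gap c is a polynomial in x. It also divides y - y1, whose coefficient of y is 1, so c is a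
  nonzero constant. But every element of the ideal vanishes at the point.\<close>

lemma pt_ideal_principal_imp:
  assumes "cls (pt_ideal P) {cfun 1 0}" "on_curve E P"
  shows "P = Infinity"
proof (rule ccontr)
  assume "P \<noteq> Infinity"
  then obtain x1 y1 where P: "P = Pt x1 y1" by (cases P) auto
  define XX where "XX = cfun [:-x1, 1:] 0"
  define Y where "Y = cfun [:-y1:] 1"
  have CR: "XX \<in> CR" "Y \<in> CR" unfolding XX_def Y_def by auto
  have pt_ideal: "pt_ideal P = {XX, Y}" by (simp add: P pt_ideal_def XX_def Y_def)
  obtain a b where ab: "a \<in> CR" "b \<in> CR" "a \<noteq> 0" "b \<noteq> 0" and
    eq: "idl (gprod {a} {XX, Y}) = idl (gprod {b} {cfun 1 0})"
    using assms(1) unfolding cls_def pt_ideal by blast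
  have b: "gprod {b} {cfun 1 0} = {b}" using gprod_one[of "{b}"] ab by (simp add: gprod_comm)
  have XYR: "{XX, Y} \<subseteq> CR" using CR by simp
  have "b \<in> idl (gprod {b} {cfun 1 0})" unfolding b using ab by (intro idl_gen) simp_all
  then obtain c where c: "c \<in> idl {XX, Y}" "b = a * c"
    unfolding eq[symmetric] using idl_gprD[of b a "{XX, Y}"] XYR by blast
  have cR: "c \<in> CR" using c idl_subset_R[OF XYR] by blast
  have div: "\<exists>u\<in>CR. f = c * u" if "f \<in> {XX, Y}" for f
  proof -
    have fR: "f \<in> CR" using that CR by auto
    have "a * f \<in> idl (gprod {a} {XX, Y})"
      using that ab fR by (intro idl_gen R_mult) (auto simp: gprod_def)
    then obtain u where u: "u \<in> idl {cfun 1 0}" "a * f = b * u"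
      unfolding eq using idl_gprD[of "a * f" b "{cfun 1 0}"] by auto
    have uR: "u \<in> CR" using u idl_subset_R[of "{cfun 1 0}"] by auto
    have "a * f = a * (c * u)" using u c by (simp only: mult.assoc)
    then have "f = c * u" using ab fR cR uR by (intro R_cancel[of f "c * u" a] R_mult)
    then show ?thesis using uR by blast
  qed
  obtain p q where pq: "c = cfun p q" using cR unfolding CR_def by blast
  obtain r s where rs: "XX = c * cfun r s" using div[of XX] unfolding CR_def by blast
  obtain r' s' where rs': "Y = c * cfun r' s'" using div[of Y] unfolding CR_def by blast
  have "[:-x1, 1:] = p * r + q * s * cubic" "0 = p * s + q * r - q * s * lin"
    using rs unfolding pq XX_def cfun_mult cfun_eq_iff by auto
  then have N: "nrm p q * nrm r s = [:-x1, 1:]^2"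
    unfolding nrm_mult[symmetric] by (simp add: nrm_def)
  then have "nrm p q dvd [:-x1, 1:]^2" by (metis dvd_triv_left)
  then have "Polynomial.degree (nrm p q) \<le> Polynomial.degree ([:-x1, 1:]^2)"
    by (rule dvd_imp_degree_le) simp
  also have "\<dots> = 2" by (simp add: degree_power_eq)
  finally have "q = 0" using nrm_cases[of q p] by force
  then have "p * s' = 1"
    using rs' unfolding pq Y_def cfun_mult cfun_eq_iff by simp
  then have "p dvd 1" by (rule dvdI[OF sym])
  then obtain k where "p = [:k:]" "k dvd 1"
    unfolding is_unit_poly_iff by blast
  then have k: "p = [:k:]" "k \<noteq> 0" by auto
  have oc: "on_curve E (Pt x1 y1)" using assms(2) P by simp
  have "c (x1, y1) = 0"
  proof (rule idl_induct[OF c(1)])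
    fix g r a :: "'k \<times> 'k \<Rightarrow> 'k" assume "g \<in> {XX, Y}" and a: "a (x1, y1) = 0"
    then have "g (x1, y1) = 0"
      unfolding XX_def Y_def using oc by (auto simp: cfun_apply simp del: on_curve.simps)
    then show "(r * g + a) (x1, y1) = 0" using a by simp
  qed simp
  then show False using k \<open>q = 0\<close> unfolding pq cfun_apply[OF oc] by simp
qed

lemma pt_ideal_add3:
  assumes "on_curve E P" "on_curve E Q" "on_curve E S"
  shows "cls (gprod (gprod (pt_ideal P) (pt_ideal Q)) (pt_ideal S)) (pt_ideal (add E (add E P Q) S))"
proof (rule cls_trans)
  show "cls (gprod (gprod (pt_ideal P) (pt_ideal Q)) (pt_ideal S)) (gprod (pt_ideal (add E P Q)) (pt_ideal S))"
    using assms by (intro cls_gprod pt_ideal_add gprod_R pt_ideal_R)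
  show "cls (gprod (pt_ideal (add E P Q)) (pt_ideal S)) (pt_ideal (add E (add E P Q) S))"
    using assms by (intro on_curve_add pt_ideal_add)
qed (intro gprod_R pt_ideal_R)+

text \<open>Both bracketings A and B have the class of the product of the three point ideals. So the
  class of A - B is trivial, and \<open>pt_ideal_principal_imp\<close> gives A - B = O.\<close>

lemma add_assoc:
  assumes "on_curve E P" "on_curve E Q" "on_curve E S"
  shows "add E (add E P Q) S = add E P (add E Q S)"
proof -
  note oc = assms on_curve_add
  define A where "A = add E (add E P Q) S"
  define B where "B = add E P (add E Q S)"
  have AB: "on_curve E A" "on_curve E B" unfolding A_def B_def using oc by blast+
  have 1: "cls (gprod (gprod (pt_ideal P) (pt_ideal Q)) (pt_ideal S)) (pt_ideal A)"
    unfolding A_def using assms by (rule pt_ideal_add3)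
  have "cls (gprod (gprod (pt_ideal Q) (pt_ideal S)) (pt_ideal P)) (pt_ideal B)"
    unfolding B_def add_comm[OF assms(1) on_curve_add[OF assms(2,3)]]
    using assms(2,3,1) by (rule pt_ideal_add3)
  moreover have "gprod (gprod (pt_ideal Q) (pt_ideal S)) (pt_ideal P) = gprod (gprod (pt_ideal P) (pt_ideal Q)) (pt_ideal S)"
    by (simp only: gprod_ac)
  ultimately have 2: "cls (gprod (gprod (pt_ideal P) (pt_ideal Q)) (pt_ideal S)) (pt_ideal B)" by simp
  have AB': "cls (pt_ideal A) (pt_ideal B)"
    by (rule cls_trans[OF cls_sym[OF 1] 2]) (intro gprod_R pt_ideal_R)+
  have "cls (gprod (pt_ideal A) (pt_ideal (neg E B))) (gprod (pt_ideal B) (pt_ideal (neg E B)))"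
    using AB' by (rule cls_gprod) auto
  from cls_trans[OF this pt_ideal_mult_neg[OF AB(2)]]
  have 3: "cls (gprod (pt_ideal A) (pt_ideal (neg E B))) {cfun 1 0}" by (simp add: gprod_R)
  have 4: "cls (gprod (pt_ideal A) (pt_ideal (neg E B))) (pt_ideal (add E A (neg E B)))"
    using AB by (intro pt_ideal_add) auto
  have "cls (pt_ideal (add E A (neg E B))) {cfun 1 0}"
    by (rule cls_trans[OF cls_sym[OF 4] 3]) (simp_all add: gprod_R)
  then have "add E A (neg E B) = Infinity"
    using AB by (intro pt_ideal_principal_imp on_curve_add) auto
  then have "neg E B = neg E A" by (simp add: add_neg_iff)
  then show ?thesis unfolding A_def B_def by (metis neg_neg)
qed

end

section \<open>Elliptic divisibility sequences\<close>

text \<open>For a point \<open>R\<close> with \<open>2R \<noteq> O\<close>, read \<open>x m\<close>, \<open>p m\<close> and \<open>W m\<close> as \<open>x(mR)\<close>, \<open>\<psi>\<^sub>2(mR)\<close> and \<open>\<psi>\<^sub>m(R)\<close>,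
  and \<open>Z m\<close> as \<open>mR = O\<close>; the values of \<open>x\<close> and \<open>p\<close> at zeros of \<open>Z\<close> are junk.\<close>
locale eds =
  fixes x p W :: "int \<Rightarrow> 'a::field" and Z :: "int \<Rightarrow> bool"
  assumes Z0: "Z 0" and Z1: "\<not> Z 1" and Z2: "\<not> Z 2"
    and Z_add: "\<And>m n. Z m \<Longrightarrow> Z (m + n) = Z n"
    and x_add: "\<And>m n. Z m \<Longrightarrow> x (m + n) = x n"
    and p_add: "\<And>m n. Z m \<Longrightarrow> p (m + n) = p n"
    and Z_uminus: "\<And>m. Z (- m) = Z m"
    and x_uminus: "\<And>m. x (- m) = x m"
    and p_uminus: "\<And>m. p (- m) = - p m"
    and x_eq_iff: "\<And>m n. \<not> Z m \<Longrightarrow> \<not> Z n \<Longrightarrow> x m = x n \<longleftrightarrow> Z (m + n) \<or> Z (m - n)"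
    and p_eq_0_iff: "\<And>m. \<not> Z m \<Longrightarrow> p m = 0 \<longleftrightarrow> Z (2 * m)"
    and x_diff: "\<And>m n. \<not> Z m \<Longrightarrow> \<not> Z n \<Longrightarrow> x m \<noteq> x n \<Longrightarrow>
      (x (m + n) - x (m - n)) * (x m - x n)^2 = - (p m * p n)"
    and x_double: "\<And>m n. \<not> Z m \<Longrightarrow> \<not> Z n \<Longrightarrow> x m \<noteq> x n \<Longrightarrow> p m \<noteq> 0 \<Longrightarrow>
      (x (2 * m) - x n) * (p m)^2 = (x m - x (m + n)) * (x m - x (m - n)) * (x m - x n)^2"
    and p_sum: "\<And>m n. \<not> Z m \<Longrightarrow> \<not> Z n \<Longrightarrow> x m \<noteq> x n \<Longrightarrow> p m = 0 \<Longrightarrow>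
      p (m + n) * (x m - x n) = - (p n * (x m - x (m + n)))"
    and W_uminus: "\<And>m. W (- m) = - W m"
    and W0: "W 0 = 0" and W1: "W 1 = 1" and W2: "W 2 = p 1"
    and W3: "W 3 = (x 1 - x 2) * W 2 ^ 2" and W4: "W 4 = p 2 * W 2 ^ 4"
    and W_odd: "\<And>m. W (2 * m + 1) = W (m + 2) * W m ^ 3 - W (m - 1) * W (m + 1) ^ 3"
    and W_even: "\<And>m. W (2 * m) * W 2 = W m * (W (m + 2) * W (m - 1) ^ 2 - W (m - 2) * W (m + 1) ^ 2)"
begin

text \<open>The last clause keeps what the induction needs of the quasi-periodicity
  \<open>W (m + k) = a b\<^sup>k W k\<close> at a zero \<open>m\<close>.\<close>
definition S :: "int \<Rightarrow> bool" where
  "S m \<longleftrightarrow> (W m = 0 \<longleftrightarrow> Z m) \<and>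
     (\<not> Z m \<longrightarrow> W (m + 1) * W (m - 1) = (x 1 - x m) * W m ^ 2) \<and>
     (Z m \<longrightarrow> W (m + 1) ^ 3 * W 2 ^ 2 = - (W (m - 1) * W (m + 2) ^ 2) \<and>
               W (m - 1) ^ 3 * W 2 ^ 2 = - (W (m + 1) * W (m - 2) ^ 2))"

lemma W_neg: "W (- m + k) = - W (m - k)" "W (- m - k) = - W (m + k)"
proof -
  have *: "- m + k = - (m - k)" "- m - k = - (m + k)" by simp_all
  show "W (- m + k) = - W (m - k)" "W (- m - k) = - W (m + k)" unfolding * W_uminus by (rule refl)+
qed

lemma minus_eq_swap: "- a = b \<longleftrightarrow> a = - b" for a b :: 'a
  by (metis minus_minus)

lemma S_uminus: "S (- m) \<longleftrightarrow> S m"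
  unfolding S_def W_neg Z_uminus x_uminus W_uminus by (auto simp: mult.commute minus_eq_swap)

lemma S_flip: "S (- m + k) \<longleftrightarrow> S (m - k)" "S (- m - k) \<longleftrightarrow> S (m + k)"
proof -
  have *: "- m + k = - (m - k)" "- m - k = - (m + k)" by simp_all
  show "S (- m + k) \<longleftrightarrow> S (m - k)" "S (- m - k) \<longleftrightarrow> S (m + k)" unfolding * S_uminus by (rule refl)+
qed

lemma W2_ne: "W 2 \<noteq> 0"
  using p_eq_0_iff[of 1] Z1 Z2 by (simp add: W2)

lemma Z_near:
  assumes "Z m"
  shows "\<not> Z (m + 1)" "\<not> Z (m - 1)" "\<not> Z (m + 2)" "\<not> Z (m - 2)"
  using Z_add[OF assms, of 1] Z_add[OF assms, of "-1"] Z_add[OF assms, of 2] Z_add[OF assms, of "-2"]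
    Z_uminus[of 1] Z_uminus[of 2] Z1 Z2 by auto

lemma S_zero: "S m \<Longrightarrow> W m = 0 \<longleftrightarrow> Z m"
  and S_step: "S m \<Longrightarrow> \<not> Z m \<Longrightarrow> W (m + 1) * W (m - 1) = (x 1 - x m) * W m ^ 2"
  and S_per1: "S m \<Longrightarrow> Z m \<Longrightarrow> W (m + 1) ^ 3 * W 2 ^ 2 = - (W (m - 1) * W (m + 2) ^ 2)"
  and S_per2: "S m \<Longrightarrow> Z m \<Longrightarrow> W (m - 1) ^ 3 * W 2 ^ 2 = - (W (m + 1) * W (m - 2) ^ 2)"
  unfolding S_def by auto

text \<open>The case a = m + 1, b = m of the classical relation psi_(a+b) psi_(a-b) = (x(bR) -
  x(aR)) psi_a^2 psi_b^2.\<close>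

lemma W_odd_eq:
  assumes "S m" "S (m + 1)" "\<not> Z m" "\<not> Z (m + 1)"
  shows "W (2 * m + 1) = (x m - x (m + 1)) * W m ^ 2 * W (m + 1) ^ 2"
proof -
  have 1: "W (m + 1) * W (m - 1) = (x 1 - x m) * W m ^ 2"
    using S_step assms by blast
  have 2: "W (m + 2) * W m = (x 1 - x (m + 1)) * W (m + 1) ^ 2"
    using S_step[OF assms(2,4)] by (simp add: add.commute)
  have "W (2 * m + 1) = (W (m + 2) * W m) * W m ^ 2 - (W (m + 1) * W (m - 1)) * W (m + 1) ^ 2"
    unfolding W_odd by Groebner_Basis.algebra
  then show ?thesis unfolding 1 2 by Groebner_Basis.algebra
qed

text \<open>In the language of points, psi_(2m)(R) = psi_2(mR) psi_m(R)^4. Generically this is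
  \<open>x_diff\<close> for m and 1; if a neighbour of m is a zero, its x-value is junk and the
  periodicity clause of \<open>S\<close> supplies the missing relation.\<close>

lemma W_even_eq:
  assumes S: "S (m - 1)" "S m" "S (m + 1)" and Z: "\<not> Z m"
  shows "W (2 * m) = p m * W m ^ 4"
proof -
  have "W (2 * m) * W 2 = (p m * W m ^ 4) * W 2"
  proof (cases "Z (m - 1) \<or> Z (m + 1)")
    case True
    then show ?thesis
    proof
      assume z: "Z (m - 1)"
      have "p m = p 1" using p_add[OF z, of 1] by simp
      moreover have "W m ^ 3 * W 2 ^ 2 = - (W (m - 2) * W (m + 1) ^ 2)"
        using S_per1[OF S(1) z] by (simp add: add.commute)
      moreover have "W (m - 1) = 0" using S_zero[OF S(1)] z by simp
      then have "W (2 * m) * W 2 = W m * - (W (m - 2) * W (m + 1) ^ 2)" using W_even[of m] by simp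
      ultimately show ?thesis using W2 by (simp add: eval_nat_numeral mult_ac)
    next
      assume z: "Z (m + 1)"
      have "p m = - p 1" using p_add[OF z, of "-1"] p_uminus[of 1] by simp
      moreover have "W m ^ 3 * W 2 ^ 2 = - (W (m + 2) * W (m - 1) ^ 2)"
        using S_per2[OF S(3) z] by (simp add: add.commute)
      moreover have "W (m + 1) = 0" using S_zero[OF S(3)] z by simp
      then have "W (2 * m) * W 2 = - (W m * - (W (m + 2) * W (m - 1) ^ 2))" using W_even[of m] by simp
      ultimately show ?thesis using W2 by (simp add: eval_nat_numeral mult_ac)
    qed
  next
    case False
    then have ne: "x m \<noteq> x 1" using x_eq_iff[OF Z Z1] by simp
    have 0: "W (m + 1) * W (m - 1) = (x 1 - x m) * W m ^ 2" using S_step S Z by blast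
    have 1: "W m * W (m - 2) = (x 1 - x (m - 1)) * W (m - 1) ^ 2"
      using S_step[OF S(1)] False by (simp add: add.commute)
    have 2: "W (m + 2) * W m = (x 1 - x (m + 1)) * W (m + 1) ^ 2"
      using S_step[OF S(3)] False by (simp add: add.commute)
    have 3: "(x (m + 1) - x (m - 1)) * (x m - x 1)^2 = - (p m * p 1)"
      using x_diff[OF Z Z1 ne] .
    have "W (2 * m) * W 2 = (W (m + 2) * W m) * W (m - 1) ^ 2 - (W m * W (m - 2)) * W (m + 1) ^ 2"
      unfolding W_even by Groebner_Basis.algebra
    also have "\<dots> = (x (m - 1) - x (m + 1)) * (W (m + 1) * W (m - 1)) ^ 2"
      unfolding 1 2 by Groebner_Basis.algebra
    also have "\<dots> = - ((x (m + 1) - x (m - 1)) * (x m - x 1)^2) * W m ^ 4"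
      unfolding 0 by Groebner_Basis.algebra
    finally show ?thesis unfolding 3 W2 by simp
  qed
  then show ?thesis using W2_ne by simp
qed

lemma S1_even:
  assumes S: "S (m - 1)" "S m" "S (m + 1)"
  shows "W (2 * m) = 0 \<longleftrightarrow> Z (2 * m)"
proof (cases "Z m")
  case True
  then have "Z (2 * m)" using Z_add[of m m] by (simp add: algebra_simps)
  moreover have "W (2 * m) * W 2 = 0" using W_even[of m] S_zero[OF S(2)] True by simp
  ultimately show ?thesis using W2_ne by simp
next
  case False
  then show ?thesis using W_even_eq[OF S False] S_zero[OF S(2)] p_eq_0_iff[OF False] by simp
qed

lemma S1_odd:
  assumes S: "S (m - 1)" "S m" "S (m + 1)" "S (m + 2)"
  shows "W (2 * m + 1) = 0 \<longleftrightarrow> Z (2 * m + 1)"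
proof -
  consider (a) "Z m" | (b) "Z (m + 1)" | (c) "\<not> Z m" "\<not> Z (m + 1)" by blast
  then show ?thesis
  proof cases
    case a
    have "Z (2 * m + 1) = Z (m + 1)" using Z_add[OF a, of "m + 1"] by (simp add: algebra_simps)
    then show ?thesis using W_odd[of m] Z_near[OF a] S_zero[OF S(1)] S_zero[OF S(2)] S_zero[OF S(3)] a by simp
  next
    case b
    have "Z (2 * m + 1) = Z m" using Z_add[OF b, of m] by (simp add: algebra_simps)
    then show ?thesis using W_odd[of m] Z_near[OF b] S_zero[OF S(4)] S_zero[OF S(2)] S_zero[OF S(3)] b
      by (simp add: algebra_simps)
  next
    case c
    have "x m = x (m + 1) \<longleftrightarrow> Z (2 * m + 1)"
      using x_eq_iff[OF c] Z_uminus[of 1] Z1 by (simp add: algebra_simps)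
    then show ?thesis using W_odd_eq[OF S(2,3) c] S_zero[OF S(2)] S_zero[OF S(3)] c by simp
  qed
qed

text \<open>The generic case is \<open>x_double\<close> for m and 1. Of the two possible zeros m - 1
  and m + 1 only the second is treated here; the first is its mirror image under m -> -m.\<close>

lemma S2_even_aux:
  assumes S: "S (m - 1)" "S m" "S (m + 1)" and Z: "\<not> Z (2 * m)" "\<not> Z (m - 1)"
  shows "W (2 * m + 1) * W (2 * m - 1) = (x 1 - x (2 * m)) * W (2 * m) ^ 2"
proof -
  have zm: "\<not> Z m" using Z Z_add[of m m] by (auto simp: algebra_simps)
  have pm: "p m \<noteq> 0" using p_eq_0_iff zm Z by simp
  have b: "W (2 * m - 1) = (x (m - 1) - x m) * W (m - 1) ^ 2 * W m ^ 2"
    using W_odd_eq[of "m - 1"] S zm Z by (simp add: algebra_simps)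
  have e: "W (2 * m) = p m * W m ^ 4" using W_even_eq S zm by blast
  show ?thesis
  proof (cases "Z (m + 1)")
    case True
    have w: "W (m + 1) = 0" using S_zero[OF S(3)] True by simp
    have a: "W (2 * m + 1) = W (m + 2) * W m ^ 3" using W_odd[of m] w by simp
    have c: "W m ^ 3 * W 2 ^ 2 = - (W (m + 2) * W (m - 1) ^ 2)"
      using S_per2[OF S(3) True] by (simp add: add.commute)
    \<comment> \<open>Here mR = -R, (m - 1)R = -2R and 2mR = -2R, so only the x-coordinates of R and
      2R occur.\<close>
    have pm: "p m = - W 2" using p_add[OF True, of "-1"] p_uminus[of 1] W2 by simp
    have xm: "x m = x 1" using x_add[OF True, of "-1"] x_uminus[of 1] by simp
    have xm1: "x (m - 1) = x 2" using x_add[OF True, of "-2"] x_uminus[of 2] by simp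
    have "Z (2 * (m + 1))" using True Z_add[OF True, of "m + 1"] by (simp add: algebra_simps)
    then have x2m: "x (2 * m) = x 2"
      using x_add[of "2 * (m + 1)" "-2"] x_uminus[of 2] by simp
    have "W (2 * m + 1) * W (2 * m - 1) = (x 2 - x 1) * W m ^ 5 * (W (m + 2) * W (m - 1) ^ 2)"
      unfolding a b xm xm1 by Groebner_Basis.algebra
    also have "\<dots> = - (x 2 - x 1) * W m ^ 5 * (W m ^ 3 * W 2 ^ 2)" unfolding c by (simp add: algebra_simps)
    also have "\<dots> = (x 1 - x (2 * m)) * W (2 * m) ^ 2" unfolding e pm x2m by Groebner_Basis.algebra
    finally show ?thesis .
  next
    case False
    have ne: "x m \<noteq> x 1" using x_eq_iff[OF zm Z1] Z False by simp
    have a: "W (2 * m + 1) = (x m - x (m + 1)) * W m ^ 2 * W (m + 1) ^ 2"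
      using W_odd_eq[OF S(2,3) zm False] .
    have c: "W (m + 1) * W (m - 1) = (x 1 - x m) * W m ^ 2" using S_step S zm by blast
    have d: "(x (2 * m) - x 1) * (p m)^2 = (x m - x (m + 1)) * (x m - x (m - 1)) * (x m - x 1)^2"
      using x_double[OF zm Z1 ne pm] .
    have "W (2 * m + 1) * W (2 * m - 1) = (x m - x (m + 1)) * (x (m - 1) - x m) * W m ^ 4 * (W (m + 1) * W (m - 1)) ^ 2"
      unfolding a b by Groebner_Basis.algebra
    also have "\<dots> = - ((x m - x (m + 1)) * (x m - x (m - 1)) * (x m - x 1)^2) * W m ^ 8"
      unfolding c by Groebner_Basis.algebra
    also have "\<dots> = (x 1 - x (2 * m)) * W (2 * m) ^ 2" unfolding d[symmetric] e by Groebner_Basis.algebra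
    finally show ?thesis .
  qed
qed

lemma S2_even:
  assumes S: "S (m - 1)" "S m" "S (m + 1)" and Z: "\<not> Z (2 * m)"
  shows "W (2 * m + 1) * W (2 * m - 1) = (x 1 - x (2 * m)) * W (2 * m) ^ 2"
proof (cases "Z (m - 1)")
  case True
  have "\<not> Z (m + 1)" using Z_add[OF True, of "m + 1"] Z by (simp add: algebra_simps)
  then have "W (2 * (- m) + 1) * W (2 * (- m) - 1) = (x 1 - x (2 * (- m))) * W (2 * (- m)) ^ 2"
    using S Z S_flip Z_uminus[of "m + 1"] Z_uminus[of "2 * m"]
    by (intro S2_even_aux) (simp_all add: S_uminus)
  moreover have "W (2 * (- m) + 1) = - W (2 * m - 1)" "W (2 * (- m) - 1) = - W (2 * m + 1)"
    "W (2 * (- m)) = - W (2 * m)" "x (2 * (- m)) = x (2 * m)"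
    using W_neg[of "2 * m" 1] W_uminus[of "2 * m"] x_uminus[of "2 * m"] by simp_all
  ultimately show ?thesis by (simp add: mult.commute)
qed (rule S2_even_aux[OF assms])

text \<open>Generically both even-indexed values come from \<open>W_even_eq\<close>, and their
  product is \<open>x_diff\<close> for m + 1 and m, whose difference is R itself. If m or m + 1 is a
  zero, both sides vanish.\<close>

lemma S2_odd:
  assumes S: "S (m - 1)" "S m" "S (m + 1)" "S (m + 2)" and Z: "\<not> Z (2 * m + 1)"
  shows "W (2 * m + 2) * W (2 * m) = (x 1 - x (2 * m + 1)) * W (2 * m + 1) ^ 2"
proof -
  consider (a) "Z m" | (b) "Z (m + 1)" | (c) "\<not> Z m" "\<not> Z (m + 1)" by blast
  then show ?thesis
  proof cases
    case a
    then have z: "Z (2 * m)" using Z_add[of m m] by (simp add: algebra_simps)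
    then have "W (2 * m) = 0" using S1_even[OF S(1,2,3)] by simp
    then show ?thesis using x_add[OF z, of 1] by simp
  next
    case b
    then have z: "Z (2 * (m + 1))" using Z_add[of "m + 1" "m + 1"] by (simp add: algebra_simps)
    then have w: "W (2 * m + 2) = 0" using S1_even[of "m + 1"] S by (simp add: algebra_simps)
    have "x (2 * m + 1) = x 1" using x_add[OF z, of "-1"] x_uminus[of 1] by (simp add: add.commute)
    then show ?thesis using w by simp
  next
    case c
    have "x (m + 1) \<noteq> x m" using x_eq_iff[OF c] Z Z_uminus[of 1] Z1 by (simp add: algebra_simps)
    from x_diff[OF c(2,1) this]
    have d: "(x (2 * m + 1) - x 1) * (x (m + 1) - x m)^2 = - (p (m + 1) * p m)"
      by (simp add: algebra_simps)
    have e: "W (2 * m) = p m * W m ^ 4" using W_even_eq S c by blast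
    have f: "W (2 * m + 2) = p (m + 1) * W (m + 1) ^ 4"
      using W_even_eq[of "m + 1"] S c by (simp add: algebra_simps)
    have o: "W (2 * m + 1) = (x m - x (m + 1)) * W m ^ 2 * W (m + 1) ^ 2"
      using W_odd_eq[OF S(2,3) c] .
    have "W (2 * m + 2) * W (2 * m) = (p (m + 1) * p m) * W m ^ 4 * W (m + 1) ^ 4"
      unfolding e f by Groebner_Basis.algebra
    also have "\<dots> = - ((x (2 * m + 1) - x 1) * (x (m + 1) - x m)^2) * W m ^ 4 * W (m + 1) ^ 4"
      unfolding d by simp
    also have "\<dots> = (x 1 - x (2 * m + 1)) * W (2 * m + 1) ^ 2" unfolding o by Groebner_Basis.algebra
    finally show ?thesis .
  qed
qed

text \<open>Either mR = O, and the odd recursion collapses to one product, or mR is a point of order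
  two. In the second case \<open>p m\<close> = 0 rules out \<open>x_double\<close>, and
  \<open>p_sum\<close> takes its place.\<close>

lemma S3_even:
  assumes S: "S (m - 1)" "S m" "S (m + 1)" "S (m + 2)" and Z: "Z (2 * m)"
  shows "W (2 * m + 1) ^ 3 * W 2 ^ 2 = - (W (2 * m - 1) * W (2 * m + 2) ^ 2)"
proof (cases "Z m")
  case True
  note zn = Z_near[OF True]
  have w: "W m = 0" using S_zero[OF S(2)] True by simp
  have a: "W (2 * m + 1) = - (W (m - 1) * W (m + 1) ^ 3)" using W_odd[of m] w by simp
  have b: "W (2 * m - 1) = W (m + 1) * W (m - 1) ^ 3"
    using W_odd[of "m - 1"] w by (simp add: algebra_simps)
  have "p (m + 1) = W 2" using p_add[OF True, of 1] W2 by simp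
  then have c: "W (2 * m + 2) = W 2 * W (m + 1) ^ 4"
    using W_even_eq[of "m + 1"] S zn by (simp add: algebra_simps)
  show ?thesis unfolding a b c by Groebner_Basis.algebra
next
  case False
  have z1: "\<not> Z (m + 1)" "\<not> Z (m - 1)"
  proof -
    show "\<not> Z (m + 1)" using Z_add[of "m + 1" "m - 1"] Z_add[of "m + 1" "m + 1"] Z Z_add[OF Z, of 2] Z2
      by (auto simp: algebra_simps)
    show "\<not> Z (m - 1)" using Z_add[of "m - 1" "m + 1"] Z_add[of "m - 1" "m - 1"] Z Z_add[OF Z, of "-2"] Z2 Z_uminus[of 2]
      by (auto simp: algebra_simps)
  qed
  have pm: "p m = 0" using p_eq_0_iff[OF False] Z by simp
  have ne: "x m \<noteq> x 1" using x_eq_iff[OF False Z1] z1 by simp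
  have xx: "x (m - 1) = x (m + 1)"
    using x_add[OF Z, of "- (m + 1)"] x_uminus[of "m + 1"] by (simp add: algebra_simps)
  have d: "p (m + 1) * (x m - x 1) = - (W 2 * (x m - x (m + 1)))"
    using p_sum[OF False Z1 ne pm] W2 by simp
  have a: "W (2 * m + 1) = (x m - x (m + 1)) * W m ^ 2 * W (m + 1) ^ 2"
    using W_odd_eq[OF S(2,3) False z1(1)] .
  have b: "W (2 * m - 1) = (x (m + 1) - x m) * W (m - 1) ^ 2 * W m ^ 2"
    using W_odd_eq[of "m - 1"] S False z1 xx by (simp add: algebra_simps)
  have c: "W (2 * m + 2) = p (m + 1) * W (m + 1) ^ 4"
    using W_even_eq[of "m + 1"] S z1 by (simp add: algebra_simps)
  have f: "W (m + 1) * W (m - 1) = (x 1 - x m) * W m ^ 2" using S_step S False by blast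
  have "- (W (2 * m - 1) * W (2 * m + 2) ^ 2)
      = (x m - x (m + 1)) * W m ^ 2 * p (m + 1) ^ 2 * W (m + 1) ^ 6 * (W (m + 1) * W (m - 1)) ^ 2"
    unfolding b c by Groebner_Basis.algebra
  also have "\<dots> = (x m - x (m + 1)) * W m ^ 6 * W (m + 1) ^ 6 * (p (m + 1) * (x m - x 1)) ^ 2"
    unfolding f by Groebner_Basis.algebra
  also have "\<dots> = W (2 * m + 1) ^ 3 * W 2 ^ 2" unfolding a d by Groebner_Basis.algebra
  finally show ?thesis ..
qed

text \<open>Now (m + 1)R = -mR, so \<open>x\<close> agrees at m and m + 1 while \<open>p\<close>
  changes sign; neither index can be a zero, since otherwise R = O.\<close>

lemma S3_odd:
  assumes S: "S (m - 1)" "S m" "S (m + 1)" "S (m + 2)" and Z: "Z (2 * m + 1)"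
  shows "W (2 * m + 2) ^ 3 * W 2 ^ 2 = - (W (2 * m) * W (2 * m + 3) ^ 2)"
proof -
  have z: "\<not> Z m" "\<not> Z (m + 1)"
  proof -
    show "\<not> Z m" using Z_add[of m m] Z_add[of "2 * m" 1] Z Z1 by (auto simp: algebra_simps)
    show "\<not> Z (m + 1)" using Z_add[of "m + 1" "m + 1"] Z_add[OF Z, of 1] Z Z1 by (auto simp: algebra_simps)
  qed
  have pp: "p (m + 1) = - p m" using p_add[OF Z, of "- m"] p_uminus[of m] by (simp add: algebra_simps)
  have xx: "x (m + 1) = x m" using x_add[OF Z, of "- m"] x_uminus[of m] by (simp add: algebra_simps)
  have e: "W (2 * m) = p m * W m ^ 4" using W_even_eq S z by blast
  have f: "W (2 * m + 2) = p (m + 1) * W (m + 1) ^ 4"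
    using W_even_eq[of "m + 1"] S z by (simp add: algebra_simps)
  have g: "W (m + 2) * W m = (x 1 - x (m + 1)) * W (m + 1) ^ 2"
    using S_step[OF S(3) z(2)] by (simp add: add.commute)
  have o: "W (2 * m + 3) = W (m + 3) * W (m + 1) ^ 3 - W m * W (m + 2) ^ 3"
    using W_odd[of "m + 1"] by (simp add: algebra_simps)
  \<comment> \<open>The claim without a common factor \<open>p (m + 1)\<close>, after the
    even-indexed values are replaced by \<open>W_even_eq\<close>.\<close>
  have key: "p (m + 1) ^ 2 * W (m + 1) ^ 12 * W 2 ^ 2 = W m ^ 4 * W (2 * m + 3) ^ 2"
  proof (cases "Z (m + 2)")
    case True
    have "W (m + 2) = 0" using S_zero[OF S(4)] True by simp
    then have o': "W (2 * m + 3) = W (m + 3) * W (m + 1) ^ 3" using o by simp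
    have c: "W (m + 1) ^ 3 * W 2 ^ 2 = - (W (m + 3) * W m ^ 2)"
      using S_per2[OF S(4) True] by (simp add: algebra_simps)
    have "p (m + 1) = - W 2" using p_add[OF True, of "-1"] p_uminus[of 1] W2 by (simp add: add.commute)
    then have "p (m + 1) ^ 2 * W (m + 1) ^ 12 * W 2 ^ 2 = (W (m + 1) ^ 3 * W 2 ^ 2) ^ 2 * W (m + 1) ^ 6"
      by (simp add: eval_nat_numeral mult_ac)
    also have "\<dots> = W m ^ 4 * W (2 * m + 3) ^ 2" unfolding c o' by Groebner_Basis.algebra
    finally show ?thesis .
  next
    case False
    have "\<not> Z (m + 1 - 1)" "\<not> Z (m + 1 + 1)" using z False by (simp_all add: algebra_simps)
    then have ne: "x (m + 1) \<noteq> x 1" using x_eq_iff[OF z(2) Z1] by blast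
    have d: "(x (m + 2) - x m) * (x (m + 1) - x 1)^2 = - (p (m + 1) * W 2)"
      using x_diff[OF z(2) Z1 ne] W2 by (simp add: algebra_simps)
    have o': "W (2 * m + 3) = (x (m + 1) - x (m + 2)) * W (m + 1) ^ 2 * W (m + 2) ^ 2"
      using W_odd_eq[of "m + 1"] S z False by (simp add: algebra_simps)
    have "W m ^ 4 * W (2 * m + 3) ^ 2 = (x (m + 1) - x (m + 2)) ^ 2 * W (m + 1) ^ 4 * (W (m + 2) * W m) ^ 4"
      unfolding o' by Groebner_Basis.algebra
    also have "\<dots> = ((x (m + 2) - x m) * (x (m + 1) - x 1)^2) ^ 2 * W (m + 1) ^ 12"
      unfolding g xx by Groebner_Basis.algebra
    also have "\<dots> = p (m + 1) ^ 2 * W (m + 1) ^ 12 * W 2 ^ 2" unfolding d by Groebner_Basis.algebra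
    finally show ?thesis ..
  qed
  have "W (2 * m + 2) ^ 3 * W 2 ^ 2 = p (m + 1) * (p (m + 1) ^ 2 * W (m + 1) ^ 12 * W 2 ^ 2)"
    unfolding f by Groebner_Basis.algebra
  also have "\<dots> = p (m + 1) * (W m ^ 4 * W (2 * m + 3) ^ 2)" unfolding key ..
  also have "\<dots> = - (W (2 * m) * W (2 * m + 3) ^ 2)" unfolding e pp by simp
  finally show ?thesis .
qed

lemma S_even:
  assumes S: "S (m - 2)" "S (m - 1)" "S m" "S (m + 1)" "S (m + 2)"
  shows "S (2 * m)"
proof -
  have "W (2 * m - 1) ^ 3 * W 2 ^ 2 = - (W (2 * m + 1) * W (2 * m - 2) ^ 2)" if "Z (2 * m)"
  proof -
    have "W (2 * (- m) + 1) ^ 3 * W 2 ^ 2 = - (W (2 * (- m) - 1) * W (2 * (- m) + 2) ^ 2)"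
      using S that S_flip Z_uminus[of "2 * m"]
      by (intro S3_even) (simp_all add: S_uminus)
    moreover have "W (2 * (- m) + 1) = - W (2 * m - 1)" "W (2 * (- m) - 1) = - W (2 * m + 1)"
      "W (2 * (- m) + 2) = - W (2 * m - 2)"
      using W_neg[of "2 * m" 1] W_neg[of "2 * m" 2] by simp_all
    ultimately show ?thesis by (simp add: minus_eq_swap)
  qed
  then show ?thesis
    unfolding S_def[of "2 * m"] using S1_even[OF S(2,3,4)] S2_even[OF S(2,3,4)] S3_even[OF S(2-5)] by blast
qed

lemma S_odd:
  assumes S: "S (m - 1)" "S m" "S (m + 1)" "S (m + 2)"
  shows "S (2 * m + 1)"
proof -
  have "W (2 * m) ^ 3 * W 2 ^ 2 = - (W (2 * m + 2) * W (2 * m - 1) ^ 2)" if "Z (2 * m + 1)"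
  proof -
    \<comment> \<open>Replacing m by -m - 1 turns 2m + 1 into its negative, so the second
      periodicity relation is the reflection of the first.\<close>
    have "W (2 * (- m - 1) + 2) ^ 3 * W 2 ^ 2 = - (W (2 * (- m - 1)) * W (2 * (- m - 1) + 3) ^ 2)"
      using S that S_flip S_flip(2)[of m 2] Z_uminus[of "2 * m + 1"]
      by (intro S3_odd) (simp_all add: S_uminus algebra_simps)
    moreover have "W (2 * (- m - 1) + 2) = - W (2 * m)" "W (2 * (- m - 1)) = - W (2 * m + 2)"
      "W (2 * (- m - 1) + 3) = - W (2 * m - 1)"
      using W_uminus[of "2 * m"] W_neg[of "2 * m" 1] W_neg[of "2 * m" 2] by (simp_all add: algebra_simps)
    ultimately show ?thesis by (simp add: minus_eq_swap)
  qed
  then show ?thesis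
    unfolding S_def[of "2 * m + 1"]
    using S1_odd[OF S] S2_odd[OF S] S3_odd[OF S] by (simp add: algebra_simps)
qed

lemma S_0: "S 0" unfolding S_def using Z0 W0 W1 W_uminus[of 1] W_uminus[of 2] by simp
lemma S_1: "S 1" unfolding S_def using Z1 W0 W1 by simp
lemma S_2: "S 2" unfolding S_def using Z2 W2_ne W1 W3 by simp

lemma S_3: "S 3"
proof -
  have 1: "W 3 = 0 \<longleftrightarrow> Z 3"
    using x_eq_iff[OF Z1 Z2] Z1 Z_uminus[of 1] W2_ne W3 by auto
  have 2: "W 4 * W 2 = (x 1 - x 3) * W 3 ^ 2" if "\<not> Z 3"
  proof -
    have ne: "x 2 \<noteq> x 1" using that 1 W3 by auto
    have "(x 3 - x 1) * (x 2 - x 1)^2 = - (p 2 * W 2)"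
      using x_diff[OF Z2 Z1 ne] W2 by simp
    then show ?thesis unfolding W3 W4 by Groebner_Basis.algebra
  qed
  have 3: "W 4 ^ 3 * W 2 ^ 2 = - (W 2 * W 5 ^ 2) \<and> W 2 ^ 3 * W 2 ^ 2 = - (W 4 * W 1 ^ 2)" if z: "Z 3"
  proof -
    have "p 2 = - W 2" using p_add[OF z, of "-1"] p_uminus[of 1] W2 by simp
    then have w: "W 4 = - (W 2 ^ 5)" unfolding W4 by (simp add: eval_nat_numeral)
    have w5: "W 5 = W 4 * W 2 ^ 3" using W_odd[of 2] 1 z by simp
    show ?thesis unfolding w5 w W1 by (simp add: eval_nat_numeral)
  qed
  show ?thesis unfolding S_def using 1 2 3 by simp
qed

text \<open>\<open>S_even\<close> at m = 2 would presuppose \<open>S 4\<close>, so the relations at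
  a zero are computed from the recursion; its first two clauses already follow from the smaller
  indices.\<close>

lemma S_4: "S 4"
proof -
  have 1: "W 4 = 0 \<longleftrightarrow> Z 4" using S1_even[of 2] S_1 S_2 S_3 by simp
  have 2: "W 5 * W 3 = (x 1 - x 4) * W 4 ^ 2" if "\<not> Z 4"
    using S2_even[of 2] S_1 S_2 S_3 that by simp
  have 3: "W 5 ^ 3 * W 2 ^ 2 = - (W 3 * W 6 ^ 2) \<and> W 3 ^ 3 * W 2 ^ 2 = - (W 5 * W 2 ^ 2)" if z: "Z 4"
  proof -
    have w: "W 4 = 0" using 1 z by simp
    have w5: "W 5 = - (W 3 ^ 3)" using W_odd[of 2] w W1 by simp
    have "W 6 * W 2 = W 3 * (W 5 * W 2 ^ 2)" using W_even[of 3] w by simp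
    then have "W 6 * W 2 = (- (W 3 ^ 4 * W 2)) * W 2" unfolding w5 by (simp add: eval_nat_numeral)
    then have w6: "W 6 = - (W 3 ^ 4 * W 2)" by (rule mult_right_cancel[OF W2_ne, THEN iffD1])
    show ?thesis unfolding w5 w6 by (simp add: eval_nat_numeral)
  qed
  show ?thesis unfolding S_def using 1 2 3 by simp
qed

lemma S_nat: "S (int n)"
proof (induction n rule: less_induct)
  case (less n)
  show ?case
  \<comment> \<open>From 5 on, the indices up to m + 2 used by \<open>S_even\<close> and
    \<open>S_odd\<close> are smaller than n.\<close>
  proof (cases "n < 5")
    case True
    then have "n = 0 \<or> n = 1 \<or> n = 2 \<or> n = 3 \<or> n = 4" by auto
    then show ?thesis using S_0 S_1 S_2 S_3 S_4 by auto
  next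
    case F: False
    have IH: "S k" if "0 \<le> k" "k < int n" for k
      using less.IH[of "nat k"] that by simp
    show ?thesis
    proof (cases "even n")
      case True
      then obtain m where m: "n = 2 * m" by blast
      have "S (2 * int m)" using F m by (intro S_even IH) auto
      then show ?thesis using m by simp
    next
      case False
      then obtain m where m: "n = 2 * m + 1" using oddE by blast
      have "S (2 * int m + 1)" using F m by (intro S_odd IH) auto
      then show ?thesis using m by (simp add: add.commute)
    qed
  qed
qed

end

section \<open>The multiplication formula\<close>

declare dpred.simps [simp del]

fun xc :: "('a::zero) point \<Rightarrow> 'a" where
  "xc Infinity = 0"
| "xc (Pt x y) = x"

fun psi2 :: "('a::field) wcurve \<Rightarrow> 'a point \<Rightarrow> 'a" where
  "psi2 E Infinity = 0"
| "psi2 E (Pt x y) = 2 * y + a1 E * x + a3 E"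

lemma xc_neg [simp]: "xc (neg E P) = xc P"
  by (cases P) auto

lemma psi2_neg [simp]: "psi2 E (neg E P) = - psi2 E P"
  by (cases P) (auto simp: algebra_simps)

lemma xc_eq_iff:
  assumes "on_curve E P" "on_curve E Q" "P \<noteq> Infinity" "Q \<noteq> Infinity"
  shows "xc P = xc Q \<longleftrightarrow> Q = P \<or> Q = neg E P"
proof (cases P)
  case (Pt x y)
  show ?thesis
  proof (cases Q)
    case (Pt x' y')
    then show ?thesis
      using \<open>P = Pt x y\<close> same_x_cases[of E x y y'] assms by (auto simp del: on_curve.simps)
  qed (use assms in auto)
qed (use assms in auto)

lemma psi2_eq_0_iff: "P \<noteq> Infinity \<Longrightarrow> psi2 E P = 0 \<longleftrightarrow> add E P P = Infinity"
  unfolding add_neg_iff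
  by (cases P) (auto simp: algebra_simps eq_neg_iff_add_eq_0 eq_diff_eq simp flip: mult_2)

section \<open>How x and psi_2 behave under addition\<close>

lemma xc_add_mult:
  fixes E :: "('a::field) wcurve"
  assumes "on_curve E (Pt x1 y1)" "on_curve E (Pt x2 y2)" "x1 \<noteq> x2"
  shows "xc (add E (Pt x1 y1) (Pt x2 y2)) * (x1 - x2)^2
    = (y1 - y2)^2 + a1 E * (y1 - y2) * (x1 - x2) - (a2 E + x1 + x2) * (x1 - x2)^2"
proof -
  have "Pt x2 y2 \<noteq> neg E (Pt x1 y1)" using assms(3) by simp
  then obtain l n x3 where
    s: "add E (Pt x1 y1) (Pt x2 y2) = Pt x3 (- (l + a1 E) * x3 - n - a3 E)"
    and y: "y1 = l * x1 + n" "y2 = l * x2 + n" and x3: "x3 = l^2 + a1 E * l - a2 E - x1 - x2"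
    using add_line[OF assms(1,2)] by metis
  show ?thesis unfolding s xc.simps unfolding x3 y by Groebner_Basis.algebra
qed

text \<open>A - B differs from A + B only in the y-coordinate of the second summand. With the
  denominators cleared, the difference of the two quadratic expressions factors.\<close>

lemma xc_add_diff:
  fixes E :: "('a::field) wcurve"
  assumes "on_curve E A" "on_curve E B" "A \<noteq> Infinity" "B \<noteq> Infinity" "xc A \<noteq> xc B"
  shows "(xc (add E A B) - xc (add E A (neg E B))) * (xc A - xc B)^2 = - (psi2 E A * psi2 E B)"
proof -
  obtain x1 y1 x2 y2 where AB: "A = Pt x1 y1" "B = Pt x2 y2"
    using assms by (meson point.exhaust)
  have oc: "on_curve E (Pt x1 y1)" "on_curve E (Pt x2 y2)" "on_curve E (Pt x2 (- y2 - a1 E * x2 - a3 E))" "x1 \<noteq> x2"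
    using assms on_curve_neg[of E B] unfolding AB by (simp_all del: on_curve.simps)
  have "(xc (add E A B) - xc (add E A (neg E B))) * (xc A - xc B)^2 =
    xc (add E (Pt x1 y1) (Pt x2 y2)) * (x1 - x2)^2
    - xc (add E (Pt x1 y1) (Pt x2 (- y2 - a1 E * x2 - a3 E))) * (x1 - x2)^2"
    unfolding AB xc.simps neg.simps by (simp only: left_diff_distrib)
  also have "\<dots> = - (psi2 E A * psi2 E B)"
    unfolding xc_add_mult[OF oc(1,2,4)] xc_add_mult[OF oc(1,3,4)] AB psi2.simps
    by Groebner_Basis.algebra
  finally show ?thesis .
qed

lemma xc_dbl_mult:
  fixes E :: "('a::field) wcurve"
  assumes "on_curve E (Pt x y)" and e: "e = 2 * y + a1 E * x + a3 E" "e \<noteq> 0"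
    and n: "n = 3 * x^2 + 2 * a2 E * x + a4 E - a1 E * y"
  shows "xc (add E (Pt x y) (Pt x y)) * e^2 = n^2 + a1 E * n * e - (a2 E + 2 * x) * e^2"
    and "psi2 E (add E (Pt x y) (Pt x y)) * e^3 = - (e^4) + (2 * n + a1 E * e) * ((x - xc (add E (Pt x y) (Pt x y))) * e^2)"
proof -
  have "Pt x y \<noteq> neg E (Pt x y)"
    using psi2_eq_0_iff[of "Pt x y" E] e unfolding add_neg_iff by simp
  then obtain l m x3 where
    s: "add E (Pt x y) (Pt x y) = Pt x3 (- (l + a1 E) * x3 - m - a3 E)"
    and y: "y = l * x + m" and x3: "x3 = l^2 + a1 E * l - a2 E - x - x"
    and l: "l * e = n"
    using add_line[OF assms(1,1)] unfolding e n by metis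
  show "xc (add E (Pt x y) (Pt x y)) * e^2 = n^2 + a1 E * n * e - (a2 E + 2 * x) * e^2"
    unfolding s xc.simps x3 l[symmetric] by Groebner_Basis.algebra
  have "psi2 E (Pt x3 (- (l + a1 E) * x3 - m - a3 E)) * e^3 = - (e^4) + (2 * (l * e) + a1 E * e) * ((x - x3) * e^2)"
  proof -
    have *: "psi2 E (Pt x3 (- (l + a1 E) * x3 - m - a3 E)) = - e + (2 * l + a1 E) * (x - x3)"
      unfolding psi2.simps e(1) y by Groebner_Basis.algebra
    show ?thesis unfolding * by Groebner_Basis.algebra
  qed
  then show "psi2 E (add E (Pt x y) (Pt x y)) * e^3 = - (e^4) + (2 * n + a1 E * e) * ((x - xc (add E (Pt x y) (Pt x y))) * e^2)"
    unfolding s xc.simps l .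
qed

text \<open>The product on the right is symmetric under B -> -B, so it depends on the slope
  numerators \<open>d\<close> and \<open>d'\<close> of the two chords only through their sum and
  product; both are polynomials in the tangent data \<open>e\<close>, \<open>n\<close> and the
  difference \<open>u\<close>.\<close>

lemma xc_double:
  fixes E :: "('a::field) wcurve"
  assumes "on_curve E A" "on_curve E B" "A \<noteq> Infinity" "B \<noteq> Infinity" "xc A \<noteq> xc B" "psi2 E A \<noteq> 0"
  shows "(xc (add E A A) - xc B) * (psi2 E A)^2
    = (xc A - xc (add E A B)) * (xc A - xc (add E A (neg E B))) * (xc A - xc B)^2"
proof -
  obtain x1 y1 x2 y2 where AB: "A = Pt x1 y1" "B = Pt x2 y2"
    using assms by (meson point.exhaust)
  have oc: "on_curve E (Pt x1 y1)" "on_curve E (Pt x2 y2)" "on_curve E (Pt x2 (- y2 - a1 E * x2 - a3 E))" "x1 \<noteq> x2"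
    using assms on_curve_neg[of E B] unfolding AB by (simp_all del: on_curve.simps)
  define e where "e = 2 * y1 + a1 E * x1 + a3 E"
  define n where "n = 3 * x1^2 + 2 * a2 E * x1 + a4 E - a1 E * y1"
  define u where "u = x1 - x2"
  define k where "k = 2 * x1 + x2 + a2 E"
  define T where "T = n - k * u"
  define d where "d = y1 - y2"
  \<comment> \<open>This is y1 - y(-B). The product \<open>d * d'\<close> is divisible by
    \<open>u\<close> because both points satisfy the curve equation, and \<open>T\<close> is the
    quotient.\<close>
  define d' where "d' = y1 + y2 + a1 E * x2 + a3 E"
  have u: "u \<noteq> 0" using oc unfolding u_def by simp
  have e: "e \<noteq> 0" using assms(6) unfolding AB e_def by simp
  have sum: "d + d' = e - a1 E * u" unfolding d_def d'_def e_def u_def by Groebner_Basis.algebra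
  have prod: "d * d' = u * T"
  proof -
    have "d * d' - u * T = (y1^2 + a1 E * x1 * y1 + a3 E * y1 - (x1^3 + a2 E * x1^2 + a4 E * x1 + a6 E))
       - (y2^2 + a1 E * x2 * y2 + a3 E * y2 - (x2^3 + a2 E * x2^2 + a4 E * x2 + a6 E))"
      unfolding d_def d'_def T_def k_def u_def n_def by Groebner_Basis.algebra
    also have "\<dots> = 0" using oc(1,2) by simp
    finally show ?thesis by simp
  qed
  have L: "(xc (add E A A) - xc B) * (psi2 E A)^2 = n^2 + a1 E * n * e - k * e^2"
  proof -
    have "(xc (add E A A) - xc B) * (psi2 E A)^2 = xc (add E (Pt x1 y1) (Pt x1 y1)) * e^2 - x2 * e^2"
      unfolding AB xc.simps psi2.simps e_def[symmetric] by (simp only: left_diff_distrib)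
    also have "\<dots> = n^2 + a1 E * n * e - k * e^2"
      unfolding xc_dbl_mult(1)[OF oc(1) e_def e n_def] k_def by Groebner_Basis.algebra
    finally show ?thesis .
  qed
  have U: "(xc A - xc (add E A B)) * u^2 = k * u^2 - d^2 - a1 E * d * u"
  proof -
    have *: "(xc A - xc (add E A B)) * u^2 = x1 * u^2 - xc (add E (Pt x1 y1) (Pt x2 y2)) * (x1 - x2)^2"
      unfolding AB xc.simps u_def by (simp only: left_diff_distrib)
    show ?thesis unfolding * xc_add_mult[OF oc(1,2,4)] unfolding k_def u_def d_def by Groebner_Basis.algebra
  qed
  have V: "(xc A - xc (add E A (neg E B))) * u^2 = k * u^2 - d'^2 - a1 E * d' * u"
  proof -
    have *: "(xc A - xc (add E A (neg E B))) * u^2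
       = x1 * u^2 - xc (add E (Pt x1 y1) (Pt x2 (- y2 - a1 E * x2 - a3 E))) * (x1 - x2)^2"
      unfolding AB xc.simps neg.simps u_def by (simp only: left_diff_distrib)
    show ?thesis unfolding * xc_add_mult[OF oc(1,3,4)] unfolding k_def u_def d'_def by Groebner_Basis.algebra
  qed
  have "((xc A - xc (add E A B)) * (xc A - xc (add E A (neg E B))) * (xc A - xc B)^2) * u^2
     = ((xc A - xc (add E A B)) * u^2) * ((xc A - xc (add E A (neg E B))) * u^2)"
    unfolding AB xc.simps u_def by (simp only: mult_ac)
  also have "\<dots> = k^2 * u^4 - k * u^2 * ((d + d')^2 - 2 * (d * d') + a1 E * u * (d + d'))
      + (d * d') * (d * d' + a1 E * u * (d + d') + a1 E ^ 2 * u^2)"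
    unfolding U V by Groebner_Basis.algebra
  also have "\<dots> = ((T + k * u)^2 + a1 E * (T + k * u) * e - k * e^2) * u^2"
    unfolding sum prod by Groebner_Basis.algebra
  also have "\<dots> = ((xc (add E A A) - xc B) * (psi2 E A)^2) * u^2"
    unfolding L T_def by simp
  finally show ?thesis using u by simp
qed

text \<open>Along the line through A and B the function psi_2 is affine in x. It takes the values 0
  at A, psi_2(B) at B and -psi_2(A + B) at the third point, so these are proportional to the
  distances in x from A.\<close>

lemma psi2_add_two_torsion:
  fixes E :: "('a::field) wcurve"
  assumes "on_curve E A" "on_curve E B" "A \<noteq> Infinity" "B \<noteq> Infinity" "xc A \<noteq> xc B" "psi2 E A = 0"
  shows "psi2 E (add E A B) * (xc A - xc B) = - (psi2 E B * (xc A - xc (add E A B)))"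
proof -
  obtain x1 y1 x2 y2 where AB: "A = Pt x1 y1" "B = Pt x2 y2"
    using assms by (meson point.exhaust)
  have "Pt x2 y2 \<noteq> neg E (Pt x1 y1)" using assms(5) unfolding AB by simp
  then obtain l n x3 where
    s: "add E (Pt x1 y1) (Pt x2 y2) = Pt x3 (- (l + a1 E) * x3 - n - a3 E)"
    and y: "y1 = l * x1 + n" "y2 = l * x2 + n"
    using add_line[OF assms(1,2)[unfolded AB]] by metis
  have z: "2 * (l * x1 + n) + a1 E * x1 + a3 E = 0" using assms(6) unfolding AB psi2.simps y .
  have "psi2 E (add E A B) * (xc A - xc B) + psi2 E B * (xc A - xc (add E A B))
      = (2 * (l * x1 + n) + a1 E * x1 + a3 E) * (x2 - x3)"
    unfolding AB s psi2.simps xc.simps unfolding y by Groebner_Basis.algebra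
  then show ?thesis unfolding z by (simp add: eq_neg_iff_add_eq_0)
qed

section \<open>Division polynomials evaluated at a point\<close>

context
  fixes E :: "('a::field) wcurve" and x y :: 'a
  assumes oc: "on_curve E (Pt x y)"
begin

lemma poly_Fpoly: "poly (Fpoly E) x = (2 * y + a1 E * x + a3 E)^2"
proof -
  have "poly (Fpoly E) x = 4*x^3 + b2 E*x^2 + 2*b4 E*x + b6 E"
    unfolding Fpoly_def by (simp add: algebra_simps power2_eq_square power3_eq_cube)
  also have "\<dots> = (2 * y + a1 E * x + a3 E)^2"
    using oc[unfolded on_curve.simps] unfolding b2_def b4_def b6_def by Groebner_Basis.algebra
  finally show ?thesis .
qed

lemma poly_dpred3:
  "poly (dpred E 3) x = x * poly (Fpoly E) x - (x^4 - b4 E*x^2 - 2*b6 E*x - b8 E)"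
  unfolding dpred.simps[of E 3] Fpoly_def
  by (simp add: algebra_simps eval_nat_numeral)

lemma theta2_eq:
  "x^4 - b4 E*x^2 - 2*b6 E*x - b8 E = (3 * x^2 + 2 * a2 E * x + a4 E - a1 E * y)^2
    + a1 E * (3 * x^2 + 2 * a2 E * x + a4 E - a1 E * y) * (2 * y + a1 E * x + a3 E)
    - (a2 E + 2 * x) * (2 * y + a1 E * x + a3 E)^2"
proof -
  have a6: "a6 E = y^2 + a1 E * x * y + a3 E * y - (x^3 + a2 E * x^2 + a4 E * x)"
    using oc by (simp add: algebra_simps)
  show ?thesis
    unfolding b8_def b4_def b6_def unfolding a6 by Groebner_Basis.algebra
qed

text \<open>The shape is that of psi_2(2R) in \<open>xc_dbl_mult\<close>: the factor 6 x^2 + b2 x +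
  b4 equals 2 n + a1 e.\<close>

lemma poly_dpred4:
  "poly (dpred E 4) x = (6*x^2 + b2 E*x + b4 E) * poly (dpred E 3) x - poly (Fpoly E) x ^ 2"
proof -
  have b8: "4 * b8 E = b2 E * b6 E - b4 E ^ 2"
    unfolding b2_def b4_def b6_def b8_def by Groebner_Basis.algebra
  have 4: "poly (dpred E 4) x = (b4 E * b8 E - b6 E ^ 2) + (b2 E * b8 E - b4 E * b6 E) * x + 10 * b8 E * x^2
     + 10 * b6 E * x^3 + 5 * b4 E * x^4 + b2 E * x^5 + 2 * x^6"
    unfolding dpred.simps[of E 4] by (simp add: algebra_simps eval_nat_numeral)
  have 3: "poly (dpred E 3) x = b8 E + 3 * b6 E * x + 3 * b4 E * x^2 + b2 E * x^3 + 3 * x^4"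
    unfolding dpred.simps[of E 3] by (simp add: algebra_simps eval_nat_numeral)
  have F: "poly (Fpoly E) x = 4*x^3 + b2 E*x^2 + 2*b4 E*x + b6 E"
    unfolding Fpoly_def by (simp add: algebra_simps power2_eq_square power3_eq_cube)
  have "(6*x^2 + b2 E*x + b4 E) * poly (dpred E 3) x - poly (Fpoly E) x ^ 2 - poly (dpred E 4) x
    = x^2 * (4 * b8 E - (b2 E * b6 E - b4 E ^ 2)) * (- 1)"
    unfolding 3 4 F by Groebner_Basis.algebra
  then show ?thesis unfolding b8 by simp
qed

end

definition PG :: "('a::field) wcurve \<Rightarrow> 'a point monoid" where
  "PG E = \<lparr>carrier = {P. on_curve E P}, monoid.mult = add E, one = Infinity\<rparr>"

lemma PG_simps [simp]:
  "carrier (PG E) = {P. on_curve E P}" "monoid.mult (PG E) = add E" "one (PG E) = Infinity"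
  by (simp_all add: PG_def)

text \<open>The value of the full division polynomial: the factor psi_2 is restored at even indices,
  and negative indices are filled in as an odd function, which the reflections in the sequence
  argument require.\<close>

definition psi :: "('a::field) wcurve \<Rightarrow> 'a point \<Rightarrow> int \<Rightarrow> 'a" where
  "psi E R m = of_int (sgn m) * poly (dpred E (nat \<bar>m\<bar>)) (xc R) * (if even m then psi2 E R else 1)"

lemma dpred_small [simp]: "dpred E 0 = 0" "dpred E (Suc 0) = 1" "dpred E 1 = 1" "dpred E 2 = 1"
  by (simp_all add: dpred.simps)

lemma psi_of_nat: "psi E R (int n) = poly (dpred E n) (xc R) * (if even n then psi2 E R else 1)"
  by (cases "n = 0") (simp_all add: psi_def)

lemma psi_uminus: "psi E R (- m) = - psi E R m"
  by (simp add: psi_def)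

context
  fixes E :: "('a::field) wcurve" and R :: "'a point"
  assumes oc: "on_curve E R" and R: "R \<noteq> Infinity"
begin

lemma poly_Fpoly_psi2: "poly (Fpoly E) (xc R) = psi2 E R ^ 2"
  using oc R poly_Fpoly by (cases R) (auto simp del: on_curve.simps)

text \<open>The square of \<open>Fpoly\<close> in \<open>dpred\<close> sits on whichever product has
  even indices. Its value is psi_2^4, exactly the four factors psi_2 missing there, so the two
  parities merge into one recursion.\<close>

lemma psi_odd_nat:
  "psi E R (2 * int k + 1) = psi E R (int k + 2) * psi E R (int k) ^ 3 - psi E R (int k - 1) * psi E R (int k + 1) ^ 3"
proof -
  consider "k = 0" | "k = 1" | "k \<ge> 2" by linarith
  then show ?thesis
  proof cases
    case 1
    then show ?thesis using psi_of_nat[of E R 1] psi_of_nat[of E R 0] psi_uminus[of E R 1]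
      by simp
  next
    case 2
    then show ?thesis using psi_of_nat[of E R 1] psi_of_nat[of E R 0]
      by simp
  next
    case 3
    have i: "2 * int k + 1 = int (2 * k + 1)" "int k + 2 = int (k + 2)" "int k - 1 = int (k - 1)" "int k + 1 = int (k + 1)"
      using 3 by simp_all
    have F: "poly (Fpoly E) (xc R) ^ 2 = psi2 E R ^ 4" by (simp add: poly_Fpoly_psi2)
    let ?f = "\<lambda>n. poly (dpred E n) (xc R)"
    have d: "?f (2 * k + 1) = (if even k then psi2 E R ^ 4 * ?f (k + 2) * ?f k ^ 3 - ?f (k - 1) * ?f (k + 1) ^ 3
        else ?f (k + 2) * ?f k ^ 3 - psi2 E R ^ 4 * ?f (k - 1) * ?f (k + 1) ^ 3)"
      using 3 by (subst dpred.simps) (simp add: F)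
    show ?thesis
    proof (cases "even k")
      case True
      then have par: "even (k + 2)" "odd (k - 1)" "odd (k + 1)" "odd (2 * k + 1)" using 3 by auto
      show ?thesis
        unfolding i psi_of_nat d if_P[OF True] if_not_P[OF par(2)] if_not_P[OF par(3)] if_not_P[OF par(4)] if_P[OF par(1)]
        by Groebner_Basis.algebra
    next
      case False
      then have par: "odd (k + 2)" "even (k - 1)" "even (k + 1)" "odd (2 * k + 1)" using 3 by auto
      show ?thesis
        unfolding i psi_of_nat d if_not_P[OF False] if_not_P[OF par(1)] if_P[OF par(2)] if_P[OF par(3)] if_not_P[OF par(4)]
        by Groebner_Basis.algebra
    qed
  qed
qed

lemma psi_even_nat:
  "psi E R (2 * int k) * psi E R 2 = psi E R (int k) * (psi E R (int k + 2) * psi E R (int k - 1) ^ 2 - psi E R (int k - 2) * psi E R (int k + 1) ^ 2)"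
proof -
  consider "k = 0" | "k = 1" | "k = 2" | "k \<ge> 3" by linarith
  then show ?thesis
  proof cases
    case 1
    then show ?thesis using psi_of_nat[of E R 0] by simp
  next
    case 2
    then show ?thesis using psi_of_nat[of E R 1] psi_of_nat[of E R 0] psi_uminus[of E R 1]
      by (simp add: power2_eq_square)
  next
    case 3
    then show ?thesis using psi_of_nat[of E R 1] psi_of_nat[of E R 0]
      by simp
  next
    case 4
    have i: "2 * int k = int (2 * k)" "int k + 2 = int (k + 2)" "int k - 1 = int (k - 1)" "int k + 1 = int (k + 1)"
      "int k - 2 = int (k - 2)" "2 = int 2"
      using 4 by simp_all
    have 2: "psi E R 2 = psi2 E R" using psi_of_nat[of E R 2] by simp
    let ?f = "\<lambda>n. poly (dpred E n) (xc R)"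
    have d: "?f (2 * k) = ?f k * (?f (k + 2) * ?f (k - 1) ^ 2 - ?f (k - 2) * ?f (k + 1) ^ 2)"
      using 4 by (subst dpred.simps) simp
    have par0: "even (2 * k)" by simp
    show ?thesis
    proof (cases "even k")
      case True
      then have par: "even (k + 2)" "odd (k - 1)" "odd (k + 1)" "even (k - 2)" using 4 by auto
      show ?thesis
        unfolding 2 i(1-5) unfolding psi_of_nat d if_P[OF par0] if_P[OF True] if_not_P[OF par(2)] if_not_P[OF par(3)] if_P[OF par(4)] if_P[OF par(1)]
        by Groebner_Basis.algebra
    next
      case False
      then have par: "odd (k + 2)" "even (k - 1)" "even (k + 1)" "odd (k - 2)" using 4 by auto
      show ?thesis
        unfolding 2 i(1-5) unfolding psi_of_nat d if_P[OF par0] if_not_P[OF False] if_not_P[OF par(1)] if_P[OF par(2)] if_P[OF par(3)] if_not_P[OF par(4)]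
        by Groebner_Basis.algebra
    qed
  qed
qed

lemma psi_odd: "psi E R (2 * m + 1) = psi E R (m + 2) * psi E R m ^ 3 - psi E R (m - 1) * psi E R (m + 1) ^ 3"
proof (cases "m \<ge> 0")
  case True
  then show ?thesis using psi_odd_nat[of "nat m"] by simp
next
  case False
  define k where "k = nat (- m - 1)"
  have k: "int k = - m - 1" unfolding k_def using False by simp
  have "psi E R (- (2 * m + 1)) = psi E R (- (m - 1)) * psi E R (- (m + 1)) ^ 3 - psi E R (- (m + 2)) * psi E R (- m) ^ 3"
  proof -
    have "psi E R a = psi E R b * psi E R c ^ 3 - psi E R d * psi E R e ^ 3"
      if "a = 2 * int k + 1" "b = int k + 2" "c = int k" "d = int k - 1" "e = int k + 1" for a b c d e
      using psi_odd_nat[of k] that by simp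
    then show ?thesis by this (simp_all add: k)
  qed
  then show ?thesis unfolding psi_uminus by (simp add: algebra_simps)
qed

lemma psi_even: "psi E R (2 * m) * psi E R 2 = psi E R m * (psi E R (m + 2) * psi E R (m - 1) ^ 2 - psi E R (m - 2) * psi E R (m + 1) ^ 2)"
proof (cases "m \<ge> 0")
  case True
  then show ?thesis using psi_even_nat[of "nat m"] by simp
next
  case False
  define k where "k = nat (- m)"
  have k: "int k = - m" unfolding k_def using False by simp
  have "psi E R (- (2 * m)) * psi E R 2 = psi E R (- m) * (psi E R (- (m - 2)) * psi E R (- (m + 1)) ^ 2 - psi E R (- (m + 2)) * psi E R (- (m - 1)) ^ 2)"
  proof -
    have "psi E R a * psi E R 2 = psi E R c * (psi E R b * psi E R d ^ 2 - psi E R f * psi E R e ^ 2)"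
      if "a = 2 * int k" "b = int k + 2" "c = int k" "d = int k - 1" "e = int k + 1" "f = int k - 2" for a b c d e f
      using psi_even_nat[of k] that by simp
    then show ?thesis by this (simp_all add: k)
  qed
  then show ?thesis unfolding psi_uminus by (simp add: algebra_simps)
qed

lemma psi_base:
  assumes "psi2 E R \<noteq> 0"
  shows "psi E R 0 = 0" "psi E R 1 = 1" "psi E R 2 = psi2 E R"
    "psi E R 3 = (xc R - xc (add E R R)) * psi E R 2 ^ 2"
    "psi E R 4 = psi2 E (add E R R) * psi E R 2 ^ 4"
proof -
  show "psi E R 0 = 0" by (simp add: psi_def)
  show "psi E R 1 = 1" by (simp add: psi_def)
  show 2: "psi E R 2 = psi2 E R" by (simp add: psi_def)
  obtain x y where xy: "R = Pt x y" using R by (cases R) auto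
  have oc': "on_curve E (Pt x y)" using oc xy by simp
  define e where "e = 2 * y + a1 E * x + a3 E"
  define n where "n = 3 * x^2 + 2 * a2 E * x + a4 E - a1 E * y"
  have e: "e \<noteq> 0" using assms unfolding e_def xy by simp
  note dbl = xc_dbl_mult[OF oc' e_def e n_def]
  have 3: "poly (dpred E 3) x = (x - xc (add E (Pt x y) (Pt x y))) * e^2"
    unfolding poly_dpred3[OF oc'] theta2_eq[OF oc'] poly_Fpoly[OF oc'] e_def[symmetric] n_def[symmetric]
      dbl(1)[symmetric] by (simp add: algebra_simps)
  have p3: "psi E R 3 = poly (dpred E 3) x" unfolding xy by (simp add: psi_def)
  show "psi E R 3 = (xc R - xc (add E R R)) * psi E R 2 ^ 2"
    unfolding p3 2 3 unfolding xy by (simp add: e_def)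
  have "6*x^2 + b2 E*x + b4 E = 2 * n + a1 E * e"
    unfolding b2_def b4_def n_def e_def by Groebner_Basis.algebra
  then have 4: "poly (dpred E 4) x = psi2 E (add E (Pt x y) (Pt x y)) * e^3"
    unfolding poly_dpred4[OF oc'] 3 dbl(2) poly_Fpoly[OF oc'] e_def[symmetric] by simp
  have p4: "psi E R 4 = poly (dpred E 4) x * e" unfolding xy by (simp add: psi_def e_def)
  show "psi E R 4 = psi2 E (add E R R) * psi E R 2 ^ 4"
    unfolding p4 2 4 unfolding xy by (simp add: e_def eval_nat_numeral)
qed

end

context elliptic_curve
begin

lemma comm_group_PG: "comm_group (PG E)"
proof (rule comm_groupI)
  fix P assume "P \<in> carrier (PG E)"
  then show "\<exists>Q\<in>carrier (PG E). Q \<otimes>\<^bsub>PG E\<^esub> P = \<one>\<^bsub>PG E\<^esub>"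
    by (intro bexI[of _ "neg E P"]) (simp_all add: add_neg_iff)
next
  fix P Q assume "P \<in> carrier (PG E)" "Q \<in> carrier (PG E)"
  then show "P \<otimes>\<^bsub>PG E\<^esub> Q = Q \<otimes>\<^bsub>PG E\<^esub> P" using add_comm by simp
qed (simp_all add: on_curve_add add_assoc)

interpretation G: comm_group "PG E" by (rule comm_group_PG)

lemma inv_PG: "on_curve E P \<Longrightarrow> inv\<^bsub>PG E\<^esub> P = neg E P"
  by (rule G.inv_equality) (simp_all add: add_neg_iff)

lemma smul_eq_pow: "on_curve E P \<Longrightarrow> smul E n P = P [^]\<^bsub>PG E\<^esub> n"
proof (induction n)
  case (Suc n)
  then show ?case using on_curve_smul[of E P n] by (simp add: add_comm)
qed simp

abbreviation mm :: "'k point \<Rightarrow> int \<Rightarrow> 'k point" where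
  "mm R m \<equiv> R [^]\<^bsub>PG E\<^esub> m"

lemma mm_on_curve: "on_curve E R \<Longrightarrow> on_curve E (mm R m)"
  using G.int_pow_closed[of R m] by simp

lemma mm_add: "on_curve E R \<Longrightarrow> mm R (m + n) = add E (mm R m) (mm R n)"
  using G.int_pow_mult[of R m n] by simp

lemma mm_uminus: "on_curve E R \<Longrightarrow> mm R (- m) = neg E (mm R m)"
  using G.int_pow_neg[of R m] inv_PG[OF mm_on_curve] by simp

lemma mm_1: "on_curve E R \<Longrightarrow> mm R 1 = R"
  using G.int_pow_1[of R] by simp

lemma mm_diff: "on_curve E R \<Longrightarrow> mm R (m - n) = add E (mm R m) (neg E (mm R n))"
  using mm_add[of R m "- n"] mm_uminus[of R n] by simp

lemma eds_psi:
  assumes oc: "on_curve E R" and R: "R \<noteq> Infinity" and psi2: "psi2 E R \<noteq> 0"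
  shows "eds (\<lambda>m. xc (mm R m)) (\<lambda>m. psi2 E (mm R m)) (psi E R) (\<lambda>m. mm R m = Infinity)"
proof -
  note mm_simps = mm_add[OF oc] mm_uminus[OF oc] mm_1[OF oc] mm_diff[OF oc]
  have mm2: "mm R 2 = add E R R" using mm_add[OF oc, of 1 1] mm_1[OF oc] by simp
  have mdbl: "mm R (2 * m) = add E (mm R m) (mm R m)" for m
    using mm_add[OF oc, of m m] unfolding mult_2 .
  note c = mm_on_curve[OF oc]
  show ?thesis
  proof
    show "mm R 0 = Infinity" by simp
    show "mm R 1 \<noteq> Infinity" using R mm_1[OF oc] by simp
    show "mm R 2 \<noteq> Infinity" using psi2_eq_0_iff[OF R] psi2 unfolding mm2 by simp
    fix m n
    show "mm R (m + n) = Infinity \<longleftrightarrow> mm R n = Infinity" "xc (mm R (m + n)) = xc (mm R n)"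
      "psi2 E (mm R (m + n)) = psi2 E (mm R n)" if "mm R m = Infinity"
      using that by (simp_all add: mm_simps)
    show "mm R (- m) = Infinity \<longleftrightarrow> mm R m = Infinity" "xc (mm R (- m)) = xc (mm R m)"
      "psi2 E (mm R (- m)) = - psi2 E (mm R m)"
      by (simp_all add: mm_simps)
    show "xc (mm R m) = xc (mm R n) \<longleftrightarrow> mm R (m + n) = Infinity \<or> mm R (m - n) = Infinity"
      if "mm R m \<noteq> Infinity" "mm R n \<noteq> Infinity"
      unfolding xc_eq_iff[OF c c that] mm_add[OF oc] mm_diff[OF oc] add_neg_iff by (metis neg_neg)
    show "psi2 E (mm R m) = 0 \<longleftrightarrow> mm R (2 * m) = Infinity" if "mm R m \<noteq> Infinity"
      unfolding mdbl using psi2_eq_0_iff[OF that] .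
    show "(xc (mm R (m + n)) - xc (mm R (m - n))) * (xc (mm R m) - xc (mm R n))\<^sup>2 = - (psi2 E (mm R m) * psi2 E (mm R n))"
      if "mm R m \<noteq> Infinity" "mm R n \<noteq> Infinity" "xc (mm R m) \<noteq> xc (mm R n)"
      unfolding mm_add[OF oc] mm_diff[OF oc] by (rule xc_add_diff[OF c c that])
    show "(xc (mm R (2 * m)) - xc (mm R n)) * (psi2 E (mm R m))\<^sup>2 =
       (xc (mm R m) - xc (mm R (m + n))) * (xc (mm R m) - xc (mm R (m - n))) * (xc (mm R m) - xc (mm R n))\<^sup>2"
      if "mm R m \<noteq> Infinity" "mm R n \<noteq> Infinity" "xc (mm R m) \<noteq> xc (mm R n)" "psi2 E (mm R m) \<noteq> 0"
      unfolding mm_add[OF oc] mm_diff[OF oc] mdbl by (rule xc_double[OF c c that])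
    show "psi2 E (mm R (m + n)) * (xc (mm R m) - xc (mm R n)) = - (psi2 E (mm R n) * (xc (mm R m) - xc (mm R (m + n))))"
      if "mm R m \<noteq> Infinity" "mm R n \<noteq> Infinity" "xc (mm R m) \<noteq> xc (mm R n)" "psi2 E (mm R m) = 0"
      unfolding mm_add[OF oc] by (rule psi2_add_two_torsion[OF c c that])
    show "psi E R (- m) = - psi E R m" by (rule psi_uminus)
    show "psi E R 0 = 0" "psi E R 1 = 1" "psi E R 2 = psi2 E (mm R 1)"
      "psi E R 3 = (xc (mm R 1) - xc (mm R 2)) * psi E R 2 ^ 2"
      "psi E R 4 = psi2 E (mm R 2) * psi E R 2 ^ 4"
      using psi_base[OF oc R psi2] unfolding mm2 mm_1[OF oc] by blast+
    show "psi E R (2 * m + 1) = psi E R (m + 2) * psi E R m ^ 3 - psi E R (m - 1) * psi E R (m + 1) ^ 3"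
      by (rule psi_odd[OF oc R])
    show "psi E R (2 * m) * psi E R 2 = psi E R m * (psi E R (m + 2) * psi E R (m - 1) ^ 2 - psi E R (m - 2) * psi E R (m + 1) ^ 2)"
      by (rule psi_even[OF oc R])
  qed
qed

lemma psi_sq_eq:
  assumes "on_curve E R" "R \<noteq> Infinity"
  shows "poly (psi_sq E m) (xc R) = psi E R (int m) ^ 2"
  unfolding psi_sq_def psi_of_nat using poly_Fpoly_psi2[OF assms]
  by (simp add: power_mult_distrib)

lemma psi_nb_eq:
  assumes "on_curve E R" "R \<noteq> Infinity" "m \<ge> 1"
  shows "poly (psi_nb E m) (xc R) = psi E R (int m + 1) * psi E R (int m - 1)"
proof -
  have i: "int m + 1 = int (m + 1)" "int m - 1 = int (m - 1)" using assms(3) by simp_all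
  show ?thesis
    unfolding i psi_of_nat psi_nb_def using poly_Fpoly_psi2[OF assms(1,2)] assms(3)
    by (auto simp: power2_eq_square)
qed

text \<open>As psi_2 vanishes, each odd step of the recursion keeps only the product with odd
  indices. The induction starts from psi_3 = -theta_2, which is nonzero by
  \<open>disc_bezout\<close>.\<close>

lemma two_torsion_odd:
  assumes oc: "on_curve E (Pt x y)" and psi2: "2 * y + a1 E * x + a3 E = 0" and "odd n"
  shows "poly (dpred E n) x \<noteq> 0"
  using \<open>odd n\<close>
proof (induction n rule: less_induct)
  case (less n)
  have F: "poly (Fpoly E) x = 0" using poly_Fpoly[OF oc] psi2 by simp
  have "n = 1 \<or> n = 3 \<or> n \<ge> 5" using less.prems by presburger
  then consider "n = 1" | "n = 3" | "n \<ge> 5" by blast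
  then show ?case
  proof cases
    case 1
    then show ?thesis by simp
  next
    case 2
    have "4*x^3 + b2 E*x^2 + 2*b4 E*x + b6 E = 0"
      using F unfolding Fpoly_def by (simp add: algebra_simps power2_eq_square power3_eq_cube)
    then have "x^4 - b4 E*x^2 - 2*b6 E*x - b8 E \<noteq> 0"
      using disc_bezout[of E x] ell unfolding elliptic_def by auto
    then show ?thesis using 2 poly_dpred3[OF oc] F by simp
  next
    case 3
    obtain k where k: "n = 2 * k + 1" using less.prems oddE by blast
    show ?thesis
    proof (cases "even k")
      case True
      have "poly (dpred E (k - 1)) x \<noteq> 0" "poly (dpred E (k + 1)) x \<noteq> 0"
        using less.IH[of "k - 1"] less.IH[of "k + 1"] True 3 k by auto
      then show ?thesis using True 3 k F by (subst dpred.simps) auto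
    next
      case False
      have "k \<ge> 3" using False 3 k by (cases "k = 2") auto
      then have "poly (dpred E (k + 2)) x \<noteq> 0" "poly (dpred E k) x \<noteq> 0"
        using less.IH[of "k + 2"] less.IH[of k] False 3 k by auto
      then show ?thesis using False 3 k F by (subst dpred.simps) auto
    qed
  qed
qed

lemma two_torsion_smul:
  assumes oc: "on_curve E R" and "add E R R = Infinity"
  shows "smul E n R = (if even n then Infinity else R)"
  by (induction n) (auto simp: assms)

text \<open>If 2R is not O, these are the clauses of \<open>S\<close>: x(R) psi_m^2 - psi_(m+1)
  psi_(m-1) collapses to x(mR) psi_m^2, and at a zero of psi_m both neighbours are nonzero. If 2R =
  O, then mR and the vanishing of psi_m depend only on the parity of m.\<close>

theorem multiplication_formula:
  assumes oc: "on_curve E R" and R: "R \<noteq> Infinity" and m: "m \<ge> 1"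
  shows "smul E m R \<noteq> Infinity \<Longrightarrow> poly (psi_sq E m) (xc R) \<noteq> 0
           \<and> poly (theta E m) (xc R) = xc (smul E m R) * poly (psi_sq E m) (xc R)"
    and "smul E m R = Infinity \<Longrightarrow> poly (psi_sq E m) (xc R) = 0 \<and> poly (theta E m) (xc R) \<noteq> 0"
proof -
  have th: "poly (theta E m) (xc R) = xc R * psi E R (int m) ^ 2 - psi E R (int m + 1) * psi E R (int m - 1)"
    unfolding theta_def poly_diff poly_mult psi_sq_eq[OF oc R] psi_nb_eq[OF oc R m] by simp
  have "(smul E m R \<noteq> Infinity \<longrightarrow> poly (psi_sq E m) (xc R) \<noteq> 0
           \<and> poly (theta E m) (xc R) = xc (smul E m R) * poly (psi_sq E m) (xc R))
     \<and> (smul E m R = Infinity \<longrightarrow> poly (psi_sq E m) (xc R) = 0 \<and> poly (theta E m) (xc R) \<noteq> 0)"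
  proof (cases "psi2 E R = 0")
    case False
    interpret e: eds "\<lambda>m. xc (mm R m)" "\<lambda>m. psi2 E (mm R m)" "psi E R" "\<lambda>m. mm R m = Infinity"
      by (rule eds_psi[OF oc R False])
    have sm: "smul E m R = mm R (int m)"
      unfolding smul_eq_pow[OF oc] int_pow_int ..
    have S: "e.S (int m)" by (rule e.S_nat)
    have Sp: "e.S (int m + 1)" "e.S (int m - 1)"
      using e.S_nat[of "m + 1"] e.S_nat[of "m - 1"] m by (simp_all add: of_nat_diff add.commute)
    show ?thesis
    proof (cases "mm R (int m) = Infinity")
      case True
      then have "psi E R (int m + 1) \<noteq> 0" "psi E R (int m - 1) \<noteq> 0"
        using e.Z_near[OF True] e.S_zero[OF Sp(1)] e.S_zero[OF Sp(2)] by auto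
      then show ?thesis unfolding th psi_sq_eq[OF oc R] sm using True e.S_zero[OF S] by simp
    next
      case F: False
      then show ?thesis
        unfolding th psi_sq_eq[OF oc R] sm e.S_step[OF S F] using e.S_zero[OF S] mm_1[OF oc]
        by (simp add: algebra_simps)
    qed
  next
    case True
    obtain x y where xy: "R = Pt x y" using R by (cases R) auto
    have p0: "2 * y + a1 E * x + a3 E = 0" using True unfolding xy by simp
    have oc': "on_curve E (Pt x y)" using oc xy by simp
    have nz: "psi E R (int k) \<noteq> 0" if "odd k" for k
      unfolding psi_of_nat using two_torsion_odd[OF oc' p0 that] that by (simp add: xy)
    have ez: "psi E R (int k) = 0" if "even k" for k
      unfolding psi_of_nat using True that by simp
    have i: "int m + 1 = int (m + 1)" "int m - 1 = int (m - 1)" using m by simp_all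
    have sm: "smul E m R = (if even m then Infinity else R)"
      using two_torsion_smul[OF oc] psi2_eq_0_iff[OF R] True by simp
    show ?thesis unfolding sm th psi_sq_eq[OF oc R] i
      using nz[of m] nz[of "m + 1"] nz[of "m - 1"] ez[of m] ez[of "m + 1"] ez[of "m - 1"] m R by auto
  qed
  then show "smul E m R \<noteq> Infinity \<Longrightarrow> poly (psi_sq E m) (xc R) \<noteq> 0
           \<and> poly (theta E m) (xc R) = xc (smul E m R) * poly (psi_sq E m) (xc R)"
    and "smul E m R = Infinity \<Longrightarrow> poly (psi_sq E m) (xc R) = 0 \<and> poly (theta E m) (xc R) \<noteq> 0"
    by blast+
qed

text \<open>If mR is affine, the value is (x(mR) - x(P)) psi_m^2 with nonzero second factor. If mR =
  O, only theta_m survives, and it is nonzero.\<close>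

lemma delta_root_iff:
  assumes "on_curve E R" "R \<noteq> Infinity" "m \<ge> 1" "on_curve E P" "P \<noteq> Infinity"
  shows "poly (delta E m P) (xc R) = 0 \<longleftrightarrow> smul E m R = P \<or> smul E m R = neg E P"
proof -
  obtain x y where xy: "P = Pt x y" using assms(5) by (cases P) auto
  have d: "poly (delta E m P) (xc R) = poly (theta E m) (xc R) - xc P * poly (psi_sq E m) (xc R)"
    unfolding xy by simp
  show ?thesis
  proof (cases "smul E m R = Infinity")
    case True
    then show ?thesis using multiplication_formula(2)[OF assms(1,2,3) True] assms(5) unfolding d
      by (metis mult_zero_right diff_zero neg_eq_Infinity_iff)
  next
    case False
    have "poly (delta E m P) (xc R) = (xc (smul E m R) - xc P) * poly (psi_sq E m) (xc R)"
      unfolding d using multiplication_formula(1)[OF assms(1,2,3) False] by (simp add: left_diff_distrib)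
    then have "poly (delta E m P) (xc R) = 0 \<longleftrightarrow> xc P = xc (smul E m R)"
      using multiplication_formula(1)[OF assms(1,2,3) False] by auto
    then show ?thesis
      using xc_eq_iff[OF assms(4) on_curve_smul[OF assms(1)] assms(5) False] by simp
  qed
qed

end

section \<open>Degrees of division polynomials and torsion\<close>

text \<open>The coefficient \<open>c\<close> may be 0: division polynomials have leading
  coefficients such as m, which can vanish in positive characteristic, while the degree bound
  remains valid.\<close>

definition lead :: "'a::comm_ring_1 poly \<Rightarrow> nat \<Rightarrow> 'a \<Rightarrow> bool" where
  "lead p d c \<longleftrightarrow> Polynomial.degree p \<le> d \<and> poly.coeff p d = c"

lemma lead_mult:
  assumes "lead p d a" "lead q e b"
  shows "lead (p * q) (d + e) (a * b)"
proof -
  have "Polynomial.degree (p * q) \<le> d + e"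
    using assms degree_mult_le[of p q] unfolding lead_def by linarith
  moreover have "poly.coeff (p * q) (d + e) = a * b"
  proof (cases "Polynomial.degree p = d \<and> Polynomial.degree q = e")
    case True
    then show ?thesis using assms coeff_mult_degree_sum[of p q] unfolding lead_def by auto
  next
    case False
    then have "Polynomial.degree p + Polynomial.degree q < d + e" using assms unfolding lead_def by auto
    then have "Polynomial.degree (p * q) < d + e"
      using degree_mult_le[of p q] by linarith
    then have "poly.coeff (p * q) (d + e) = 0" by (rule coeff_eq_0)
    moreover have "a * b = 0" using False assms coeff_eq_0[of p d] coeff_eq_0[of q e]
      unfolding lead_def by (auto simp: le_less)
    ultimately show ?thesis by simp
  qed
  ultimately show ?thesis unfolding lead_def by simp
qed

lemma lead_power: "lead p d a \<Longrightarrow> lead (p ^ n) (n * d) (a ^ n)"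
proof (induction n)
  case (Suc n)
  then show ?case using lead_mult[of p d a "p ^ n" "n * d" "a ^ n"] by simp
qed (simp add: lead_def)

lemma lead_diff: "lead p d a \<Longrightarrow> lead q d b \<Longrightarrow> lead (p - q) d (a - b)"
  unfolding lead_def by (auto intro: degree_diff_le)

lemma lead_eq: "lead p d a \<Longrightarrow> d = d' \<Longrightarrow> a = a' \<Longrightarrow> lead p d' a'"
  by simp

lemma lead_pderiv:
  fixes p :: "'a::idom poly"
  shows "lead p (Suc d) a \<Longrightarrow> lead (pderiv p) d (of_nat (Suc d) * a)"
  unfolding lead_def by (auto simp: coeff_pderiv coeff_eq_0 intro!: degree_le)

lemma lead_Fpoly: "lead (Fpoly E) 3 4"
  unfolding lead_def Fpoly_def by (simp add: eval_nat_numeral)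

lemma dpred_odd_even:
  assumes "even k" "k \<ge> 2" "n = 2 * k + 1" "a = k + 2" "b = k - 1" "c = k + 1"
  shows "dpred E n = Fpoly E ^ 2 * dpred E a * dpred E k ^ 3 - dpred E b * dpred E c ^ 3"
  using assms by (subst dpred.simps) simp

lemma dpred_odd_odd:
  assumes "odd k" "k \<ge> 2" "n = 2 * k + 1" "a = k + 2" "b = k - 1" "c = k + 1"
  shows "dpred E n = dpred E a * dpred E k ^ 3 - Fpoly E ^ 2 * dpred E b * dpred E c ^ 3"
  using assms by (subst dpred.simps) simp

lemma dpred_even:
  assumes "k \<ge> 3" "n = 2 * k" "a = k + 2" "b = k - 1" "c = k - 2" "d = k + 1"
  shows "dpred E n = dpred E k * (dpred E a * dpred E b ^ 2 - dpred E c * dpred E d ^ 2)"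
  using assms by (subst dpred.simps) simp

text \<open>For m = 2j + 1 the bound is (m^2 - 1)/2 with coefficient m; for m = 2j + 2, where psi_2
  has been split off, it is (m^2 - 4)/2 with coefficient m/2. The recursion depends on the parity of
  m and of its half, whence the residues modulo 4.\<close>

lemma lead_dpred:
  fixes E :: "('a::field) wcurve"
  shows "(\<forall>j. n = 2 * j + 1 \<longrightarrow> lead (dpred E n) (2 * j * (j + 1)) (2 * of_nat j + 1)) \<and>
         (\<forall>j. n = 2 * j + 2 \<longrightarrow> lead (dpred E n) (2 * j * (j + 2)) (of_nat j + 1))"
proof (induction n rule: less_induct)
  case (less n)
  have O: "lead (dpred E (2 * j + 1)) (2 * j * (j + 1)) (2 * of_nat j + 1)" if "2 * j + 1 < n" for j
    using less.IH[OF that] by blast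
  have V: "lead (dpred E (2 * j + 2)) (2 * j * (j + 2)) (of_nat j + 1)" if "2 * j + 2 < n" for j
    using less.IH[OF that] by blast
  note F2 = lead_power[OF lead_Fpoly, of E 2]
  have "n = 0 \<or> n = 1 \<or> n = 2 \<or> n = 3 \<or> n = 4 \<or> (\<exists>i. n = 4 * i + 5) \<or> (\<exists>i. n = 4 * i + 6) \<or> (\<exists>i. n = 4 * i + 7) \<or> (\<exists>i. n = 4 * i + 8)"
    by presburger
  then consider "n = 0" | "n = 1" | "n = 2" | "n = 3" | "n = 4" | (A) i where "n = 4 * i + 5" | (D) i where "n = 4 * i + 6"
    | (B) i where "n = 4 * i + 7" | (C) i where "n = 4 * i + 8" by blast
  then show ?case
  proof cases
    assume "n = 1"
    then show ?thesis by (auto simp: lead_def)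
  next
    assume "n = 2"
    then show ?thesis by (auto simp: lead_def)
  next
    assume n: "n = 3"
    have "lead (dpred E 3) 4 3" unfolding lead_def dpred.simps[of E 3] by (simp add: eval_nat_numeral)
    moreover have "3 = 2 * j + 1 \<longleftrightarrow> j = 1" "(3::nat) \<noteq> 2 * j + 2" for j by presburger+
    ultimately show ?thesis unfolding n by simp
  next
    assume n: "n = 4"
    have "lead (dpred E 4) 6 2" unfolding lead_def dpred.simps[of E 4] by (simp add: eval_nat_numeral)
    moreover have "4 = 2 * j + 2 \<longleftrightarrow> j = 1" "(4::nat) \<noteq> 2 * j + 1" for j by presburger+
    ultimately show ?thesis unfolding n by simp
  next
    case A
    let ?i = "of_nat i :: 'a"
    have i: "2 * (i + 1) + 2 < n" "2 * i + 2 < n" "2 * i + 1 < n" "2 * (i + 1) + 1 < n" using A by auto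
    have "dpred E (2 * (2 * i + 2) + 1) = Fpoly E ^ 2 * dpred E (2 * (i + 1) + 2) * dpred E (2 * i + 2) ^ 3
       - dpred E (2 * i + 1) * dpred E (2 * (i + 1) + 1) ^ 3"
      by (rule dpred_odd_even) simp_all
    moreover have "lead (Fpoly E ^ 2 * dpred E (2 * (i + 1) + 2) * dpred E (2 * i + 2) ^ 3)
       (2 * (2 * i + 2) * (2 * i + 2 + 1)) (4 ^ 2 * (?i + 2) * (?i + 1) ^ 3)"
      by (rule lead_eq[OF lead_mult[OF lead_mult[OF F2 V[OF i(1)]] lead_power[OF V[OF i(2)]]]]) (simp_all add: algebra_simps)
    moreover have "lead (dpred E (2 * i + 1) * dpred E (2 * (i + 1) + 1) ^ 3)
       (2 * (2 * i + 2) * (2 * i + 2 + 1)) ((2 * ?i + 1) * (2 * ?i + 3) ^ 3)"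
      by (rule lead_eq[OF lead_mult[OF O[OF i(3)] lead_power[OF O[OF i(4)]]]]) (simp_all add: algebra_simps)
    ultimately have T: "lead (dpred E (2 * (2 * i + 2) + 1)) (2 * (2 * i + 2) * (2 * i + 2 + 1))
       (4 ^ 2 * (?i + 2) * (?i + 1) ^ 3 - (2 * ?i + 1) * (2 * ?i + 3) ^ 3)"
      using lead_diff by metis
    \<comment> \<open>Both products reach the same degree bound, and their quartic leading
      coefficients cancel down to the index itself.\<close>
    have co: "4 ^ 2 * (?i + 2) * (?i + 1) ^ 3 - (2 * ?i + 1) * (2 * ?i + 3) ^ 3 = 4 * ?i + 5"
      by Groebner_Basis.algebra
    have nj: "n = 2 * j + 1 \<longleftrightarrow> j = 2 * i + 2" "n \<noteq> 2 * j + 2" for j using A by presburger+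
    have nn: "n = 2 * (2 * i + 2) + 1" using A by simp
    have "lead (dpred E n) (2 * (2 * i + 2) * (2 * i + 2 + 1)) (2 * of_nat (2 * i + 2) + 1)"
      unfolding nn by (rule lead_eq[OF T refl]) (simp only: co, simp)
    then show ?thesis unfolding nj(1) using nj(2) by blast
  next
    case B
    let ?i = "of_nat i :: 'a"
    have i: "2 * (i + 2) + 1 < n" "2 * (i + 1) + 1 < n" "2 * i + 2 < n" "2 * (i + 1) + 2 < n" using B by auto
    have "dpred E (2 * (2 * i + 3) + 1) = dpred E (2 * (i + 2) + 1) * dpred E (2 * (i + 1) + 1) ^ 3
       - Fpoly E ^ 2 * dpred E (2 * i + 2) * dpred E (2 * (i + 1) + 2) ^ 3"
      by (rule dpred_odd_odd) simp_all
    moreover have "lead (dpred E (2 * (i + 2) + 1) * dpred E (2 * (i + 1) + 1) ^ 3)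
       (2 * (2 * i + 3) * (2 * i + 3 + 1)) ((2 * ?i + 5) * (2 * ?i + 3) ^ 3)"
      by (rule lead_eq[OF lead_mult[OF O[OF i(1)] lead_power[OF O[OF i(2)]]]]) (simp_all add: algebra_simps)
    moreover have "lead (Fpoly E ^ 2 * dpred E (2 * i + 2) * dpred E (2 * (i + 1) + 2) ^ 3)
       (2 * (2 * i + 3) * (2 * i + 3 + 1)) (4 ^ 2 * (?i + 1) * (?i + 2) ^ 3)"
      by (rule lead_eq[OF lead_mult[OF lead_mult[OF F2 V[OF i(3)]] lead_power[OF V[OF i(4)]]]]) (simp_all add: algebra_simps)
    ultimately have T: "lead (dpred E (2 * (2 * i + 3) + 1)) (2 * (2 * i + 3) * (2 * i + 3 + 1))
       ((2 * ?i + 5) * (2 * ?i + 3) ^ 3 - 4 ^ 2 * (?i + 1) * (?i + 2) ^ 3)"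
      using lead_diff by metis
    have co: "(2 * ?i + 5) * (2 * ?i + 3) ^ 3 - 4 ^ 2 * (?i + 1) * (?i + 2) ^ 3 = 4 * ?i + 7"
      by Groebner_Basis.algebra
    have nj: "n = 2 * j + 1 \<longleftrightarrow> j = 2 * i + 3" "n \<noteq> 2 * j + 2" for j using B by presburger+
    have nn: "n = 2 * (2 * i + 3) + 1" using B by simp
    have "lead (dpred E n) (2 * (2 * i + 3) * (2 * i + 3 + 1)) (2 * of_nat (2 * i + 3) + 1)"
      unfolding nn by (rule lead_eq[OF T refl]) (simp only: co, simp)
    then show ?thesis unfolding nj(1) using nj(2) by blast
  next
    case C
    let ?i = "of_nat i :: 'a"
    have i: "2 * (i + 1) + 2 < n" "2 * (i + 2) + 2 < n" "2 * (i + 1) + 1 < n" "2 * i + 2 < n" "2 * (i + 2) + 1 < n" using C by auto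
    have "dpred E (2 * (2 * i + 3) + 2) = dpred E (2 * (i + 1) + 2) *
        (dpred E (2 * (i + 2) + 2) * dpred E (2 * (i + 1) + 1) ^ 2 - dpred E (2 * i + 2) * dpred E (2 * (i + 2) + 1) ^ 2)"
      by (rule dpred_even) simp_all
    moreover have "lead (dpred E (2 * (i + 2) + 2) * dpred E (2 * (i + 1) + 1) ^ 2)
       (6 * (i + 2) * (i + 2)) ((?i + 3) * (2 * ?i + 3) ^ 2)"
      by (rule lead_eq[OF lead_mult[OF V[OF i(2)] lead_power[OF O[OF i(3)]]]]) (simp_all add: algebra_simps)
    moreover have "lead (dpred E (2 * i + 2) * dpred E (2 * (i + 2) + 1) ^ 2)
       (6 * (i + 2) * (i + 2)) ((?i + 1) * (2 * ?i + 5) ^ 2)"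
      by (rule lead_eq[OF lead_mult[OF V[OF i(4)] lead_power[OF O[OF i(5)]]]]) (simp_all add: algebra_simps)
    ultimately have T: "lead (dpred E (2 * (2 * i + 3) + 2)) (2 * (i + 1) * (i + 1 + 2) + 6 * (i + 2) * (i + 2))
       ((of_nat (i + 1) + 1) * ((?i + 3) * (2 * ?i + 3) ^ 2 - (?i + 1) * (2 * ?i + 5) ^ 2))"
      using lead_mult[OF V[OF i(1)] lead_diff] by metis
    have co: "(of_nat (i + 1) + 1) * ((?i + 3) * (2 * ?i + 3) ^ 2 - (?i + 1) * (2 * ?i + 5) ^ 2) = 2 * ?i + 4"
      unfolding of_nat_add of_nat_1 by Groebner_Basis.algebra
    have dg: "2 * (i + 1) * (i + 1 + 2) + 6 * (i + 2) * (i + 2) = 2 * (2 * i + 3) * (2 * i + 3 + 2)"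
      by (simp add: algebra_simps)
    have nj: "n \<noteq> 2 * j + 1" "n = 2 * j + 2 \<longleftrightarrow> j = 2 * i + 3" for j using C by presburger+
    have nn: "n = 2 * (2 * i + 3) + 2" using C by simp
    have "lead (dpred E n) (2 * (2 * i + 3) * (2 * i + 3 + 2)) (of_nat (2 * i + 3) + 1)"
      unfolding nn by (rule lead_eq[OF T dg]) (simp only: co, simp)
    then show ?thesis unfolding nj(2) using nj(1) by blast
  next
    case D
    let ?i = "of_nat i :: 'a"
    have i: "2 * (i + 1) + 1 < n" "2 * (i + 2) + 1 < n" "2 * i + 2 < n" "2 * i + 1 < n" "2 * (i + 1) + 2 < n" using D by auto
    have "dpred E (2 * (2 * i + 2) + 2) = dpred E (2 * (i + 1) + 1) *
        (dpred E (2 * (i + 2) + 1) * dpred E (2 * i + 2) ^ 2 - dpred E (2 * i + 1) * dpred E (2 * (i + 1) + 2) ^ 2)"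
      by (rule dpred_even) simp_all
    moreover have "lead (dpred E (2 * (i + 2) + 1) * dpred E (2 * i + 2) ^ 2)
       (6 * i * i + 18 * i + 12) ((2 * ?i + 5) * (?i + 1) ^ 2)"
      by (rule lead_eq[OF lead_mult[OF O[OF i(2)] lead_power[OF V[OF i(3)]]]]) (simp_all add: algebra_simps)
    moreover have "lead (dpred E (2 * i + 1) * dpred E (2 * (i + 1) + 2) ^ 2)
       (6 * i * i + 18 * i + 12) ((2 * ?i + 1) * (?i + 2) ^ 2)"
      by (rule lead_eq[OF lead_mult[OF O[OF i(4)] lead_power[OF V[OF i(5)]]]]) (simp_all add: algebra_simps)
    ultimately have T: "lead (dpred E (2 * (2 * i + 2) + 2)) (2 * (i + 1) * (i + 1 + 1) + (6 * i * i + 18 * i + 12))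
       ((2 * of_nat (i + 1) + 1) * ((2 * ?i + 5) * (?i + 1) ^ 2 - (2 * ?i + 1) * (?i + 2) ^ 2))"
      using lead_mult[OF O[OF i(1)] lead_diff] by metis
    have co: "(2 * of_nat (i + 1) + 1) * ((2 * ?i + 5) * (?i + 1) ^ 2 - (2 * ?i + 1) * (?i + 2) ^ 2) = 2 * ?i + 3"
      unfolding of_nat_add of_nat_1 by Groebner_Basis.algebra
    have dg: "2 * (i + 1) * (i + 1 + 1) + (6 * i * i + 18 * i + 12) = 2 * (2 * i + 2) * (2 * i + 2 + 2)"
      by (simp add: algebra_simps)
    have nj: "n \<noteq> 2 * j + 1" "n = 2 * j + 2 \<longleftrightarrow> j = 2 * i + 2" for j using D by presburger+
    have nn: "n = 2 * (2 * i + 2) + 2" using D by simp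
    have "lead (dpred E n) (2 * (2 * i + 2) * (2 * i + 2 + 2)) (of_nat (2 * i + 2) + 1)"
      unfolding nn by (rule lead_eq[OF T dg]) (simp only: co, simp)
    then show ?thesis unfolding nj(2) using nj(1) by blast
  qed simp
qed

lemma lead_dpred_odd: "lead (dpred E (2 * j + 1)) (2 * j * (j + 1)) (2 * of_nat j + 1)"
  and lead_dpred_even: "lead (dpred E (2 * j + 2)) (2 * j * (j + 2)) (of_nat j + 1)"
  for E :: "('a::field) wcurve"
  using lead_dpred by blast+

lemma lead_psi_sq:
  fixes E :: "('a::field) wcurve"
  assumes "m \<ge> 1"
  shows "lead (psi_sq E m) (m ^ 2 - 1) (of_nat m ^ 2)"
proof (cases "even m")
  case True
  then obtain k where "m = 2 * k" by blast
  with assms obtain j where m: "m = 2 * j + 2" by (cases k) auto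
  have "lead (Fpoly E * dpred E (2 * j + 2) ^ 2) (m ^ 2 - 1) (of_nat m ^ 2)"
    by (rule lead_eq[OF lead_mult[OF lead_Fpoly lead_power[OF lead_dpred_even]]])
      (simp_all add: m algebra_simps power2_eq_square)
  then show ?thesis unfolding psi_sq_def using True m by simp
next
  case False
  then obtain j where m: "m = 2 * j + 1" using oddE by blast
  have "lead (dpred E (2 * j + 1) ^ 2) (m ^ 2 - 1) (of_nat m ^ 2)"
    by (rule lead_eq[OF lead_power[OF lead_dpred_odd]]) (simp_all add: m algebra_simps power2_eq_square)
  then show ?thesis unfolding psi_sq_def using False m by simp
qed

text \<open>The coefficients m^2 and m^2 - 1 of the two summands differ by 1, so theta_m has degree
  m^2 in every characteristic.\<close>

lemma lead_theta:
  fixes E :: "('a::field) wcurve"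
  assumes "m \<ge> 2"
  shows "lead (theta E m) (m ^ 2) 1"
proof -
  have X: "lead [:0, 1 :: 'a:] 1 1" by (simp add: lead_def)
  have m2: "1 + (m ^ 2 - 1) = m ^ 2" using assms by (simp add: power2_eq_square)
  have 1: "lead ([:0, 1:] * psi_sq E m) (m ^ 2) (of_nat m ^ 2)"
    by (rule lead_eq[OF lead_mult[OF X lead_psi_sq]]) (use assms m2 in simp_all)
  have 2: "lead (psi_nb E m) (m ^ 2) (of_nat m ^ 2 - 1)"
  proof (cases "even m")
    case True
    then obtain k where "m = 2 * k" by blast
    with assms obtain j where m: "m = 2 * j + 2" by (cases k) auto
    have "lead (dpred E (2 * (j + 1) + 1) * dpred E (2 * j + 1)) (m ^ 2) (of_nat m ^ 2 - 1)"
      by (rule lead_eq[OF lead_mult[OF lead_dpred_odd lead_dpred_odd]])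
       (simp_all add: m algebra_simps power2_eq_square)
    then show ?thesis unfolding psi_nb_def using True m by (simp add: eval_nat_numeral)
  next
    case False
    then obtain k where "m = 2 * k + 1" using oddE by blast
    with assms obtain j where m: "m = 2 * j + 3" by (cases k) auto
    have "lead (Fpoly E * dpred E (2 * (j + 1) + 2) * dpred E (2 * j + 2)) (m ^ 2) (of_nat m ^ 2 - 1)"
      by (rule lead_eq[OF lead_mult[OF lead_mult[OF lead_Fpoly lead_dpred_even] lead_dpred_even]])
       (simp_all add: m algebra_simps power2_eq_square)
    then show ?thesis unfolding psi_nb_def using False m by (simp add: eval_nat_numeral)
  qed
  show ?thesis unfolding theta_def
    by (rule lead_eq[OF lead_diff[OF 1 2]]) simp_all
qed

lemma degree_delta:
  fixes E :: "('a::field) wcurve"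
  assumes "m \<ge> 2" "P \<noteq> Infinity"
  shows "Polynomial.degree (delta E m P) = m ^ 2"
proof -
  obtain x y where P: "P = Pt x y" using assms by (cases P) auto
  have "Polynomial.degree ([:x:] * psi_sq E m) \<le> m ^ 2 - 1"
    using lead_psi_sq[of m E] assms degree_mult_le[of "[:x:]" "psi_sq E m"] unfolding lead_def by simp
  moreover have "m ^ 2 - 1 < m ^ 2" using assms by simp
  ultimately have "lead ([:x:] * psi_sq E m) (m ^ 2) 0"
    unfolding lead_def using coeff_eq_0 by (metis le_less_trans less_imp_le)
  from lead_diff[OF lead_theta[OF assms(1), of E] this]
  have "lead (delta E m P) (m ^ 2) 1" unfolding P by simp
  then show ?thesis unfolding lead_def using le_degree[of "delta E m P" "m ^ 2"] by auto
qed

text \<open>The two products contribute m^2 * m^2 and (m^2 - 1) * m^2 in the top degree, and the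
  difference m^2 is nonzero in the field.\<close>

lemma wronskian_ne_0:
  fixes E :: "('a::field) wcurve"
  assumes "m \<ge> 2" "of_nat m \<noteq> (0 :: 'a)"
  shows "pderiv (theta E m) * psi_sq E m - theta E m * pderiv (psi_sq E m) \<noteq> 0"
proof -
  define d where "d = m ^ 2 - 2"
  have d: "m ^ 2 = Suc (Suc d)" using assms(1) power_mono[of 2 m 2] unfolding d_def by simp
  have t: "lead (theta E m) (Suc (Suc d)) 1" using lead_theta[OF assms(1), of E] unfolding d .
  have p: "lead (psi_sq E m) (Suc d) (of_nat m ^ 2)" using lead_psi_sq[of m E] assms(1) unfolding d by simp
  have "lead (pderiv (theta E m) * psi_sq E m) (Suc d + Suc d) (of_nat (Suc (Suc d)) * 1 * of_nat m ^ 2)"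
    by (rule lead_mult[OF lead_pderiv[OF t] p])
  moreover have "lead (theta E m * pderiv (psi_sq E m)) (Suc d + Suc d) (of_nat (Suc d) * of_nat m ^ 2)"
    by (rule lead_eq[OF lead_mult[OF t lead_pderiv[OF p]]]) simp_all
  ultimately have "lead (pderiv (theta E m) * psi_sq E m - theta E m * pderiv (psi_sq E m)) (Suc d + Suc d)
     (of_nat (Suc (Suc d)) * 1 * of_nat m ^ 2 - of_nat (Suc d) * of_nat m ^ 2)"
    by (rule lead_diff)
  moreover have "of_nat (Suc (Suc d)) * 1 * of_nat m ^ 2 - of_nat (Suc d) * of_nat m ^ 2 = (of_nat m :: 'a) ^ 2"
    by (simp add: algebra_simps)
  ultimately show ?thesis using assms(2) unfolding lead_def by auto
qed

lemma card_roots_simple: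
  fixes p :: "'a::alg_closed_field poly"
  assumes "p \<noteq> 0" "\<And>r. poly p r = 0 \<Longrightarrow> poly (pderiv p) r \<noteq> 0"
  shows "card {r. poly p r = 0} = Polynomial.degree p"
  using assms
proof (induction "Polynomial.degree p" arbitrary: p)
  case 0
  then obtain c where "p = [:c:]" "c \<noteq> 0" by (metis degree_eq_zeroE pCons_0_0)
  then show ?case by simp
next
  case (Suc n)
  then obtain r where r: "poly p r = 0" using alg_closed_imp_poly_has_root[of p] by auto
  then obtain q where q: "p = [:-r, 1:] * q" by (metis dvdE poly_eq_0_iff_dvd)
  have q0: "q \<noteq> 0" using Suc.prems q by auto
  have dq: "Polynomial.degree q = n" using Suc.hyps(2) q0 unfolding q by (subst (asm) degree_mult_eq) auto
  have pd: "pderiv p = q + [:-r, 1:] * pderiv q" proof -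
    have "pderiv [:-r, 1:] = 1" by (simp add: pderiv_pCons one_pCons)
    then show ?thesis unfolding q pderiv_mult by (simp only: mult_1_right add.commute)
  qed
  have qr: "poly q r \<noteq> 0" using Suc.prems(2)[OF r] unfolding pd by simp
  have "card {r. poly q r = 0} = n"
  proof -
    have "poly (pderiv q) s \<noteq> 0" if "poly q s = 0" for s
      using Suc.prems(2)[of s] that unfolding pd by (simp add: q)
    then show ?thesis using Suc.hyps(1)[of q] dq q0 by simp
  qed
  moreover have "{r. poly p r = 0} = insert r {r. poly q r = 0}" unfolding q by auto
  ultimately show ?case using qr poly_roots_finite[OF q0] Suc.hyps(2) by simp
qed

text \<open>Removing one factor at a double root would leave the same roots for a polynomial of
  smaller degree. This returns from a root count to simplicity.\<close>

lemma simple_roots_if_card: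
  fixes p :: "'a::field poly"
  assumes "p \<noteq> 0" "card {r. poly p r = 0} = Polynomial.degree p" "poly p r = 0"
  shows "poly (pderiv p) r \<noteq> 0"
proof
  assume d: "poly (pderiv p) r = 0"
  obtain q where q: "p = [:-r, 1:] * q" using assms(3) by (metis dvdE poly_eq_0_iff_dvd)
  have q0: "q \<noteq> 0" using assms q by auto
  have "pderiv p = q + [:-r, 1:] * pderiv q" proof -
    have "pderiv [:-r, 1:] = 1" by (simp add: pderiv_pCons one_pCons)
    then show ?thesis unfolding q pderiv_mult by (simp only: mult_1_right add.commute)
  qed
  then have "poly q r = 0" using d by simp
  then have "{r. poly p r = 0} = {r. poly q r = 0}" unfolding q by auto
  then have "card {r. poly p r = 0} \<le> Polynomial.degree q"
    using card_poly_roots_bound[OF q0] by simp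
  moreover have "Polynomial.degree p = Suc (Polynomial.degree q)"
    unfolding q using q0 by (subst degree_mult_eq) auto
  ultimately show False using assms(2) by simp
qed

section \<open>Fibres of multiplication by m\<close>

context elliptic_curve
begin

definition fibre :: "nat \<Rightarrow> 'k point \<Rightarrow> 'k point set" where
  "fibre m P = {Q. on_curve E Q \<and> smul E m Q = P}"

lemma smul_add: "on_curve E P \<Longrightarrow> on_curve E Q \<Longrightarrow> smul E m (add E P Q) = add E (smul E m P) (smul E m Q)"
proof -
  assume "on_curve E P" "on_curve E Q"
  interpret comm_group "PG E" by (rule comm_group_PG)
  show ?thesis using nat_pow_distrib[of P Q m] \<open>on_curve E P\<close> \<open>on_curve E Q\<close>
    by (simp add: smul_eq_pow on_curve_add)
qed

lemma add_neg_self: "on_curve E P \<Longrightarrow> add E P (neg E P) = Infinity"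
  by (simp add: add_neg_iff)

lemma smul_neg: "on_curve E P \<Longrightarrow> smul E m (neg E P) = neg E (smul E m P)"
proof -
  assume P: "on_curve E P"
  have inf: "smul E m Infinity = Infinity" by (induction m) auto
  have "add E (smul E m P) (smul E m (neg E P)) = Infinity"
    using smul_add[of P "neg E P" m] P add_neg_self[OF P] inf by simp
  then show ?thesis by (simp add: add_neg_iff)
qed

text \<open>A root belongs to a pair of points R and -R, one lying over P and the other over -P. As
  P differs from -P, exactly one of them is in the fibre.\<close>

lemma fibre_bij_roots:
  assumes "m \<ge> 1" "on_curve E P" "P \<noteq> Infinity" "psi2 E P \<noteq> 0"
  shows "bij_betw xc (fibre m P) {r. poly (delta E m P) r = 0}"
proof (rule bij_betwI')
  have ninf: "smul E m Infinity = Infinity" by (induction m) auto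
  have nP: "neg E P \<noteq> P" using psi2_eq_0_iff[OF assms(3)] assms(4) unfolding add_neg_iff by metis
  fix Q assume Q: "Q \<in> fibre m P"
  then have Q': "on_curve E Q" "smul E m Q = P" "Q \<noteq> Infinity"
    using assms(3) ninf unfolding fibre_def by auto
  show "xc Q \<in> {r. poly (delta E m P) r = 0}"
    using delta_root_iff[OF Q'(1,3) assms(1-3)] Q' by simp
  fix S assume "S \<in> fibre m P"
  then have S': "on_curve E S" "smul E m S = P" "S \<noteq> Infinity"
    using assms(3) ninf unfolding fibre_def by auto
  show "xc Q = xc S \<longleftrightarrow> Q = S"
    unfolding xc_eq_iff[OF Q'(1) S'(1) Q'(3) S'(3)] using smul_neg[OF Q'(1)] Q' S' nP by metis
next
  fix r assume r: "r \<in> {r. poly (delta E m P) r = 0}"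
  obtain y where y: "on_curve E (Pt r y)" using ex_on_curve by blast
  have "smul E m (Pt r y) = P \<or> smul E m (Pt r y) = neg E P"
    using delta_root_iff[OF y _ assms(1-3)] r by simp
  then show "\<exists>Q\<in>fibre m P. r = xc Q"
  proof
    assume "smul E m (Pt r y) = P"
    then show ?thesis using y unfolding fibre_def by (intro bexI[of _ "Pt r y"]) auto
  next
    assume "smul E m (Pt r y) = neg E P"
    then have "smul E m (neg E (Pt r y)) = P" using smul_neg[OF y] by simp
    moreover have "on_curve E (neg E (Pt r y))" using y by (simp only: on_curve_neg)
    ultimately show ?thesis unfolding fibre_def by (intro bexI[of _ "neg E (Pt r y)"]) auto
  qed
qed

lemma fibre_nonempty:
  assumes "m \<ge> 2" "on_curve E P"
  shows "fibre m P \<noteq> {}"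
proof (cases "P = Infinity")
  case True
  have "smul E m Infinity = Infinity" by (induction m) auto
  then show ?thesis using True unfolding fibre_def by force
next
  case False
  have "Polynomial.degree (delta E m P) > 0" using degree_delta[OF assms(1) False] assms(1) by simp
  then obtain r where r: "poly (delta E m P) r = 0" using alg_closed_imp_poly_has_root by blast
  obtain y where y: "on_curve E (Pt r y)" using ex_on_curve by blast
  have "smul E m (Pt r y) = P \<or> smul E m (Pt r y) = neg E P"
    using delta_root_iff[OF y _ _ assms(2) False] r assms(1) by simp
  then show ?thesis
  proof
    assume "smul E m (Pt r y) = P"
    then show ?thesis using y unfolding fibre_def by blast
  next
    assume "smul E m (Pt r y) = neg E P"
    then have "smul E m (neg E (Pt r y)) = P" using smul_neg[OF y] by simp
    moreover have "on_curve E (neg E (Pt r y))" using y by (simp only: on_curve_neg)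
    ultimately show ?thesis unfolding fibre_def by blast
  qed
qed

lemma fibre_translate:
  assumes "Q \<in> fibre m P" "on_curve E P"
  shows "bij_betw (add E Q) (fibre m Infinity) (fibre m P)"
proof -
  have Q: "on_curve E Q" "smul E m Q = P" using assms unfolding fibre_def by auto
  interpret comm_group "PG E" by (rule comm_group_PG)
  show ?thesis
  proof (rule bij_betwI[where g = "add E (neg E Q)"])
    show "add E Q \<in> fibre m Infinity \<rightarrow> fibre m P"
      using Q unfolding fibre_def by (auto simp: on_curve_add smul_add)
    show "add E (neg E Q) \<in> fibre m P \<rightarrow> fibre m Infinity"
      using Q unfolding fibre_def by (auto simp: on_curve_add smul_add smul_neg add_neg_iff)
    show "add E (neg E Q) (add E Q T) = T" if "T \<in> fibre m Infinity" for T
      using that Q add_assoc[of "neg E Q" Q T] add_neg_iff[of E "neg E Q" Q] unfolding fibre_def by simp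
    show "add E Q (add E (neg E Q) T) = T" if "T \<in> fibre m P" for T
      using that Q add_assoc[of Q "neg E Q" T] add_neg_iff[of E Q "neg E Q"] unfolding fibre_def by simp
  qed
qed

text \<open>At a multiple root r of \<open>delta\<close>, both theta_m = c psi_m^2 and its
  derivative hold at r, so the Wronskian vanishes and c is a critical value of theta_m / psi_m^2.
  The finite set \<open>B\<close> collects these values and the x-coordinates of the points of order
  two; any c outside it gives m^2 simple roots.\<close>

lemma card_fibre_exists:
  assumes "m \<ge> 2" "of_nat m \<noteq> (0 :: 'k)"
  shows "\<exists>P. on_curve E P \<and> card (fibre m P) = m ^ 2"
proof -
  define W where "W = pderiv (theta E m) * psi_sq E m - theta E m * pderiv (psi_sq E m)"
  have "W \<noteq> 0" unfolding W_def using wronskian_ne_0[OF assms] .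
  define B where "B = (\<lambda>r. poly (theta E m) r / poly (psi_sq E m) r) ` {r. poly W r = 0} \<union> {r. poly (Fpoly E) r = 0}"
  have "Fpoly E \<noteq> 0"
  proof
    assume "Fpoly E = 0"
    then have "b2 E = 0" "b6 E = 0" "2 * b4 E = 0" "(4::'k) = 0" unfolding Fpoly_def by simp_all
    \<comment> \<open>Only 2 b4 is known to vanish, not b4; the remaining term 8 b4^3 of the
      discriminant disappears because 4 = 0.\<close>
    moreover have "(8 :: 'k) = 2 * 4" by simp
    ultimately have "disc E = 0" unfolding disc_def by simp
    then show False using ell unfolding elliptic_def by simp
  qed
  then have "finite B" unfolding B_def using poly_roots_finite \<open>W \<noteq> 0\<close> by blast
  then obtain c where c: "c \<notin> B" using infinite_alg_closed ex_new_if_finite by metis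
  obtain y where oc: "on_curve E (Pt c y)" using ex_on_curve by blast
  define P where "P = Pt c y"
  have P: "on_curve E P" "P \<noteq> Infinity" using oc unfolding P_def by simp_all
  have "poly (Fpoly E) c \<noteq> 0" using c unfolding B_def by simp
  then have psi2: "psi2 E P \<noteq> 0" using poly_Fpoly[OF oc] unfolding P_def by auto
  have d0: "delta E m P \<noteq> 0" using degree_delta[OF assms(1) P(2), where E = E] assms(1) by auto
  have simple: "poly (pderiv (delta E m P)) r \<noteq> 0" if r: "poly (delta E m P) r = 0" for r
  proof
    assume d: "poly (pderiv (delta E m P)) r = 0"
    have 1: "poly (theta E m) r = c * poly (psi_sq E m) r" using r unfolding P_def by simp
    have 2: "poly (pderiv (theta E m)) r = c * poly (pderiv (psi_sq E m)) r"
      using d unfolding P_def by (simp add: pderiv_diff pderiv_smult)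
    have "poly W r = 0" unfolding W_def using 1 2 by simp
    obtain z where z: "on_curve E (Pt r z)" using ex_on_curve by blast
    \<comment> \<open>Otherwise theta_m would vanish at r as well, but theta_m and psi_m^2 have no
      common zero.\<close>
    have "poly (psi_sq E m) r \<noteq> 0"
      using multiplication_formula[OF z, of m] 1 assms(1) by (cases "smul E m (Pt r z) = Infinity") auto
    then have "c = poly (theta E m) r / poly (psi_sq E m) r" using 1 by simp
    then show False using c \<open>poly W r = 0\<close> unfolding B_def by blast
  qed
  have "card (fibre m P) = card {r. poly (delta E m P) r = 0}"
    using bij_betw_same_card[OF fibre_bij_roots[OF _ P psi2]] assms(1) by simp
  also have "\<dots> = m ^ 2"
    using card_roots_simple[OF d0 simple] degree_delta[OF assms(1) P(2)] by simp
  finally show ?thesis using P by blast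
qed

theorem card_torsion:
  assumes "m \<ge> 2" "of_nat m \<noteq> (0 :: 'k)" "on_curve E P"
  shows "card (fibre m P) = m ^ 2"
proof -
  have c: "card (fibre m P) = card (fibre m Infinity)" if "on_curve E P" for P
    using fibre_nonempty[OF assms(1) that] bij_betw_same_card[OF fibre_translate[OF _ that]] by (metis ex_in_conv)
  then show ?thesis using card_fibre_exists[OF assms(1,2)] assms(3) by metis
qed

text \<open>The Wronskian argument covers only generic P. Here simplicity follows from counting: the
  fibre supplies m^2 distinct roots, which is the degree.\<close>

lemma delta_simple_roots:
  assumes "m \<ge> 2" "of_nat m \<noteq> (0 :: 'k)" "on_curve E P" "P \<noteq> Infinity" "psi2 E P \<noteq> 0" "poly (delta E m P) r = 0"
  shows "poly (pderiv (delta E m P)) r \<noteq> 0"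
proof (rule simple_roots_if_card[OF _ _ assms(6)])
  show "delta E m P \<noteq> 0" using degree_delta[OF assms(1,4), where E = E] assms(1) by auto
  show "card {r. poly (delta E m P) r = 0} = Polynomial.degree (delta E m P)"
    using bij_betw_same_card[OF fibre_bij_roots[OF _ assms(3-5)]] card_torsion[OF assms(1-3)]
      degree_delta[OF assms(1,4)] assms(1) by simp
qed

end

section \<open>Field homomorphisms and Galois descent\<close>

text \<open>Used twice: for the inclusion \<open>to_ac\<close>, and for Galois automorphisms, whose
  compatibility with the group law is the same statement.\<close>

locale field_hom =
  fixes h :: "'a::field \<Rightarrow> 'b::field"
  assumes h_add: "h (u + v) = h u + h v" and h_mult: "h (u * v) = h u * h v" and h_1: "h 1 = 1"
begin

lemma h_0 [simp]: "h 0 = 0"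
  using h_add[of 0 0] by (metis add.right_neutral add_left_cancel)

lemma h_minus: "h (- u) = - h u"
  using h_add[of u "- u"] by (simp add: eq_neg_iff_add_eq_0 add.commute)

lemma h_diff: "h (u - v) = h u - h v"
  using h_add[of u "- v"] h_minus[of v] by simp

lemma h_eq_0: "h u = 0 \<longleftrightarrow> u = 0"
proof
  assume "h u = 0"
  then have "h (u * inverse u) = 0" by (simp add: h_mult)
  then show "u = 0" using h_1 by (metis right_inverse zero_neq_one)
qed simp

lemma h_eq: "h u = h v \<longleftrightarrow> u = v"
  using h_eq_0[of "u - v"] by (simp add: h_diff)

lemma h_inj: "inj h"
  using h_eq by (auto simp: inj_on_def)

lemma h_divide: "h (u / v) = h u / h v"
proof (cases "v = 0")
  case False
  then have "h (u / v) * h v = h u" by (simp flip: h_mult)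
  then show ?thesis using False by (simp add: eq_divide_eq h_eq_0)
qed simp

lemma h_power: "h (u ^ n) = h u ^ n"
  by (induction n) (simp_all add: h_1 h_mult)

lemma h_of_nat: "h (of_nat n) = of_nat n"
  by (induction n) (simp_all add: h_1 h_add)

lemma h_numeral: "h (numeral n) = numeral n"
  using h_of_nat[of "numeral n"] by simp

lemma h_sum: "h (\<Sum>x\<in>A. f x) = (\<Sum>x\<in>A. h (f x))"
  by (induction A rule: infinite_finite_induct) (simp_all add: h_add)

lemmas h_simps = h_add h_mult h_1 h_minus h_diff h_divide h_power h_of_nat h_numeral

lemma map_poly_add: "map_poly h (p + q) = map_poly h p + map_poly h q"
  by (rule poly_eqI) (simp add: coeff_map_poly h_add)

lemma map_poly_diff: "map_poly h (p - q) = map_poly h p - map_poly h q"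
  by (rule poly_eqI) (simp add: coeff_map_poly h_diff)

lemma map_poly_mult: "map_poly h (p * q) = map_poly h p * map_poly h q"
  by (rule poly_eqI) (simp add: coeff_map_poly coeff_mult h_sum h_mult)

lemma map_poly_power: "map_poly h (p ^ n) = map_poly h p ^ n"
  by (induction n) (simp_all add: map_poly_mult h_1)

lemma map_poly_pderiv: "map_poly h (pderiv p) = pderiv (map_poly h p)"
  by (rule poly_eqI) (simp only: coeff_map_poly h_0 coeff_pderiv h_mult h_of_nat)

lemma poly_map_poly: "poly (map_poly h p) (h x) = h (poly p x)"
  by (induction p) (simp_all add: map_poly_pCons h_add h_mult)

lemma degree_map: "Polynomial.degree (map_poly h p) = Polynomial.degree p"
  by (rule degree_map_poly) (simp add: h_eq_0)

lemma map_wcurve_simps: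
  "a1 (map_wcurve h E) = h (a1 E)" "a2 (map_wcurve h E) = h (a2 E)" "a3 (map_wcurve h E) = h (a3 E)"
  "a4 (map_wcurve h E) = h (a4 E)" "a6 (map_wcurve h E) = h (a6 E)"
  by (simp_all add: map_wcurve_def)

lemma map_b:
  "b2 (map_wcurve h E) = h (b2 E)" "b4 (map_wcurve h E) = h (b4 E)"
  "b6 (map_wcurve h E) = h (b6 E)" "b8 (map_wcurve h E) = h (b8 E)"
  by (simp_all add: b2_def b4_def b6_def b8_def map_wcurve_simps h_simps)

lemma map_disc: "disc (map_wcurve h E) = h (disc E)"
  by (simp add: disc_def map_b h_simps)

lemma elliptic_map: "elliptic (map_wcurve h E) \<longleftrightarrow> elliptic E"
  by (simp add: elliptic_def map_disc h_eq_0)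

lemma on_curve_map: "on_curve (map_wcurve h E) (map_point h P) \<longleftrightarrow> on_curve E P"
proof (cases P)
  case (Pt x y)
  have "on_curve (map_wcurve h E) (map_point h P) \<longleftrightarrow>
    h (y ^ 2 + a1 E * x * y + a3 E * y) = h (x ^ 3 + a2 E * x ^ 2 + a4 E * x + a6 E)"
    unfolding Pt by (simp add: map_wcurve_simps h_simps)
  then show ?thesis unfolding Pt h_eq by simp
qed simp

lemma map_point_eq_Infinity: "map_point h P = Infinity \<longleftrightarrow> P = Infinity"
  by (cases P) auto

lemma map_point_inj: "map_point h P = map_point h Q \<longleftrightarrow> P = Q"
  by (cases P; cases Q) (auto simp: h_eq)

lemma map_add: "map_point h (add E P Q) = add (map_wcurve h E) (map_point h P) (map_point h Q)"
proof (cases "P = Infinity \<or> Q = Infinity")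
  case True
  then show ?thesis by auto
next
  case False
  then obtain x1 y1 x2 y2 where PQ: "P = Pt x1 y1" "Q = Pt x2 y2" by (meson point.exhaust)
  have 0: "y1 + y2 + a1 E * x2 + a3 E = 0 \<longleftrightarrow> h y1 + h y2 + h (a1 E) * h x2 + h (a3 E) = 0"
    using h_eq_0[of "y1 + y2 + a1 E * x2 + a3 E"] by (simp add: h_simps)
  show ?thesis
    unfolding PQ by (simp add: Let_def map_wcurve_simps 0 h_eq) (simp add: h_simps)
qed

lemma map_smul: "map_point h (smul E n P) = smul (map_wcurve h E) n (map_point h P)"
  by (induction n) (simp_all add: map_add)

lemma map_Fpoly: "map_poly h (Fpoly E) = Fpoly (map_wcurve h E)"
  by (simp add: Fpoly_def map_poly_pCons map_b h_simps)

lemma map_dpred: "map_poly h (dpred E n) = dpred (map_wcurve h E) n"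
proof (induction n rule: less_induct)
  case (less n)
  consider "n = 0" | "n = 1" | "n = 2" | "n = 3" | "n = 4" | "n \<ge> 5" by linarith
  then show ?case
  proof cases
    case 4
    show ?thesis unfolding 4 dpred.simps[of _ 3] by (simp add: map_poly_pCons map_b h_simps)
  next
    case 5
    show ?thesis unfolding 5 dpred.simps[of _ 4] by (simp add: map_poly_pCons map_b h_simps)
  next
    case 6
    have IH: "map_poly h (dpred E k) = dpred (map_wcurve h E) k" if "k < n" for k
      using less.IH[OF that] .
    have lt: "n div 2 + 2 < n" "n div 2 + 1 < n" "n div 2 < n" "n div 2 - 1 < n" "n div 2 - 2 < n"
      if "n \<noteq> 0" using 6 by auto
    show ?thesis
      unfolding dpred.simps[of _ n] using 6 lt
      by (simp add: map_poly_mult map_poly_diff map_poly_power map_Fpoly IH)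
  qed (simp_all add: h_1)
qed

lemma map_delta: "map_poly h (delta E m P) = delta (map_wcurve h E) m (map_point h P)"
  by (cases P)
    (simp_all add: psi_sq_def theta_def psi_nb_def map_poly_diff map_poly_mult map_poly_power map_dpred map_Fpoly
      map_poly_pCons h_1 map_poly_smult h_mult)

end

interpretation ac: field_hom to_ac
  by standard simp_all

section \<open>Extending embeddings to automorphisms of the algebraic closure\<close>

type_synonym 'a acpair = "'a alg_closure \<times> 'a alg_closure"

text \<open>Graphs of partial \<open>K\<close>-embeddings of the algebraic closure into itself.\<close>
definition emb :: "('a::field) acpair set \<Rightarrow> bool" where
  "emb \<Gamma> \<longleftrightarrow> (\<forall>c. (to_ac c, to_ac c) \<in> \<Gamma>)
     \<and> (\<forall>u u' v v'. (u, u') \<in> \<Gamma> \<longrightarrow> (v, v') \<in> \<Gamma> \<longrightarrow> (u + v, u' + v') \<in> \<Gamma> \<and> (u * v, u' * v') \<in> \<Gamma>)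
     \<and> (\<forall>v. (0, v) \<in> \<Gamma> \<longrightarrow> v = 0)"

context
  fixes \<Gamma> :: "('a::field) acpair set"
  assumes emb: "emb \<Gamma>"
begin

lemma emb_const: "(to_ac c, to_ac c) \<in> \<Gamma>"
  and emb_add: "(u, u') \<in> \<Gamma> \<Longrightarrow> (v, v') \<in> \<Gamma> \<Longrightarrow> (u + v, u' + v') \<in> \<Gamma>"
  and emb_mult: "(u, u') \<in> \<Gamma> \<Longrightarrow> (v, v') \<in> \<Gamma> \<Longrightarrow> (u * v, u' * v') \<in> \<Gamma>"
  and emb_zeroD: "(0, v) \<in> \<Gamma> \<Longrightarrow> v = 0"
  using emb unfolding emb_def by blast+

lemma emb_0: "(0, 0) \<in> \<Gamma>" and emb_1: "(1, 1) \<in> \<Gamma>"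
  using emb_const[of 0] emb_const[of 1] by simp_all

lemma emb_diff:
  assumes "(u, u') \<in> \<Gamma>" "(v, v') \<in> \<Gamma>"
  shows "(u - v, u' - v') \<in> \<Gamma>"
  using emb_add[OF assms(1) emb_mult[OF emb_const[of "- 1"] assms(2)]] by simp

lemma emb_fun: "(u, v) \<in> \<Gamma> \<Longrightarrow> (u, v') \<in> \<Gamma> \<Longrightarrow> v = v'"
  using emb_diff[of u v u v'] emb_zeroD[of "v - v'"] by simp

lemma emb_sum: "(\<And>i. i \<in> A \<Longrightarrow> (f i, g i) \<in> \<Gamma>) \<Longrightarrow> (sum f A, sum g A) \<in> \<Gamma>"
  by (induction A rule: infinite_finite_induct) (auto intro: emb_0 emb_add)

lemma emb_poly: "(u, u') \<in> \<Gamma> \<Longrightarrow> (poly (map_poly to_ac r) u, poly (map_poly to_ac r) u') \<in> \<Gamma>"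
proof (induction r)
  case (pCons a p)
  then show ?case using emb_add[OF emb_const[of a] emb_mult[OF pCons.prems]] by (simp add: map_poly_pCons)
qed (simp add: emb_0)

text \<open>The inverse of an algebraic u is a polynomial in u: cancel powers of u in an equation
  for u until its constant term is nonzero, then solve for that term.\<close>

lemma emb_inverse:
  assumes "(u, u') \<in> \<Gamma>" "u \<noteq> 0"
  shows "\<exists>w. (inverse u, w) \<in> \<Gamma>"
proof -
  obtain p :: "'a poly" where p: "p \<noteq> 0" "poly (map_poly to_ac p) u = 0"
    by (rule alg_closure_algebraic)
  then show ?thesis
  proof (induction p)
    case (pCons a p)
    show ?case
    proof (cases "a = 0")
      case True
      then show ?thesis using pCons assms(2) by (auto simp: map_poly_pCons)
    next
      case False
      have "to_ac a + u * poly (map_poly to_ac p) u = 0"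
        using pCons.prems by (simp add: map_poly_pCons)
      then have "u * poly (map_poly to_ac p) u = - to_ac a" by (simp add: eq_neg_iff_add_eq_0 add.commute)
      then have "u * (to_ac (- (1 / a)) * poly (map_poly to_ac p) u) = 1"
        using False by (simp add: mult.left_commute)
      then have "inverse u = to_ac (- (1 / a)) * poly (map_poly to_ac p) u"
        by (rule inverse_unique)
      then show ?thesis using emb_mult[OF emb_const emb_poly[OF assms(1)]] by metis
    qed
  qed simp
qed

text \<open>The graph of the map induced on polynomials, coefficient by coefficient.\<close>

definition Pp :: "('a alg_closure poly \<times> 'a alg_closure poly) set" where
  "Pp = {(q, q'). \<forall>i. (poly.coeff q i, poly.coeff q' i) \<in> \<Gamma>}"

lemma Pp_coeff: "(q, q') \<in> Pp \<Longrightarrow> (poly.coeff q i, poly.coeff q' i) \<in> \<Gamma>"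
  unfolding Pp_def by blast

lemma Pp_add: "(q, q') \<in> Pp \<Longrightarrow> (r, r') \<in> Pp \<Longrightarrow> (q + r, q' + r') \<in> Pp"
  unfolding Pp_def by (auto intro: emb_add)

lemma Pp_diff: "(q, q') \<in> Pp \<Longrightarrow> (r, r') \<in> Pp \<Longrightarrow> (q - r, q' - r') \<in> Pp"
  unfolding Pp_def by (auto intro: emb_diff)

lemma Pp_mult: "(q, q') \<in> Pp \<Longrightarrow> (r, r') \<in> Pp \<Longrightarrow> (q * r, q' * r') \<in> Pp"
  unfolding Pp_def by (auto simp: coeff_mult intro!: emb_sum emb_mult)

lemma Pp_monom: "(c, c') \<in> \<Gamma> \<Longrightarrow> (monom c k, monom c' k) \<in> Pp"
  unfolding Pp_def by (auto intro: emb_0)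

lemma Pp_zero: "(0, q') \<in> Pp \<Longrightarrow> q' = 0"
  using Pp_coeff[of 0 q'] emb_zeroD by (intro poly_eqI) (metis coeff_0)

text \<open>Take a monic relation \<open>p\<close> of least degree for a over the domain of the
  embedding, transport its coefficients to \<open>p'\<close>, and let b be a root of
  \<open>p'\<close>. Sending q(a) to q'(b) is then a well-defined embedding.\<close>

lemma emb_extend: "\<exists>\<Gamma>' b. emb \<Gamma>' \<and> \<Gamma> \<subseteq> \<Gamma>' \<and> (a, b) \<in> \<Gamma>'"
proof -
  define Q where "Q = (\<lambda>n. \<exists>p p'. (p, p') \<in> Pp \<and> p \<noteq> 0 \<and> poly p a = 0 \<and> Polynomial.degree p = n)"
  obtain p0 :: "'a poly" where p0: "p0 \<noteq> 0" "poly (map_poly to_ac p0) a = 0"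
    by (rule alg_closure_algebraic)
  have "(map_poly to_ac p0, map_poly to_ac p0) \<in> Pp"
    unfolding Pp_def by (simp add: coeff_map_poly emb_const)
  then have "Q (Polynomial.degree (map_poly to_ac p0))"
    unfolding Q_def using p0 by (intro exI[of _ "map_poly to_ac p0"]) (auto simp: map_poly_eq_0_iff)
  then have "Q (LEAST n. Q n)" by (rule LeastI)
  then obtain p1 p1' where p1: "(p1, p1') \<in> Pp" "p1 \<noteq> 0" "poly p1 a = 0" "Polynomial.degree p1 = (LEAST n. Q n)"
    unfolding Q_def by blast
  define c where "c = poly.coeff p1 (Polynomial.degree p1)"
  have "c \<noteq> 0" unfolding c_def using p1(2) by (simp add: leading_coeff_0_iff)
  obtain w where w: "(inverse c, w) \<in> \<Gamma>"
    using emb_inverse[OF Pp_coeff[OF p1(1)]] \<open>c \<noteq> 0\<close> unfolding c_def by blast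
  define p where "p = monom (inverse c) 0 * p1"
  define p' where "p' = monom w 0 * p1'"
  have pp: "(p, p') \<in> Pp" unfolding p_def p'_def by (intro Pp_mult Pp_monom w p1)
  define d where "d = Polynomial.degree p1"
  have dp: "Polynomial.degree p = d" and lp: "poly.coeff p d = 1" and pa: "poly p a = 0"
    unfolding p_def d_def using p1 \<open>c \<noteq> 0\<close> by (simp_all add: monom_0 c_def)
  have lp': "poly.coeff p' d = 1"
    using Pp_coeff[OF pp, of d] emb_fun[OF emb_1] unfolding lp by metis
  have "d > 0"
  proof (rule ccontr)
    assume "\<not> d > 0"
    then have "p = [:1:]" using dp lp by (metis degree_eq_zeroE coeff_pCons_0 gr0I)
    then show False using pa by simp
  qed
  moreover have "Polynomial.degree p' \<ge> d" using lp' by (intro le_degree) simp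
  ultimately obtain b where b: "poly p' b = 0" using alg_closed_imp_poly_has_root[of p'] by auto
  \<comment> \<open>Division with remainder, carried out in parallel: subtracting a monomial
    multiple of the monic \<open>p\<close> from q and of \<open>p'\<close> from q' lowers the degree
    of q and keeps the value of q' at b. No relation is shorter than \<open>p\<close>, so the
    process ends at 0.\<close>
  have wd: "poly q' b = 0" if "(q, q') \<in> Pp" "poly q a = 0" for q q'
    using that
  proof (induction "Polynomial.degree q" arbitrary: q q' rule: less_induct)
    case less
    show ?case
    proof (cases "q = 0")
      case True
      then have "q' = 0" using less.prems by (intro Pp_zero) simp
      then show ?thesis by simp
    next
      case False
      have "Q (Polynomial.degree q)" unfolding Q_def using less.prems False by blast
      then have dq: "d \<le> Polynomial.degree q" unfolding d_def p1(4) by (rule Least_le)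
      define n where "n = Polynomial.degree q"
      define k where "k = n - d"
      define r where "r = q - monom (poly.coeff q n) k * p"
      define r' where "r' = q' - monom (poly.coeff q' n) k * p'"
      have rr: "(r, r') \<in> Pp" unfolding r_def r'_def
        by (intro Pp_diff Pp_mult Pp_monom Pp_coeff less.prems pp)
      have ra: "poly r a = 0" unfolding r_def using less.prems pa by simp
      have q'b: "poly q' b = poly r' b" unfolding r'_def using b by simp
      have "Polynomial.degree (monom (poly.coeff q n) k * p) \<le> k + d"
        using degree_mult_le[of "monom (poly.coeff q n) k" p] degree_monom_le[of "poly.coeff q n" k] dp by linarith
      then have "Polynomial.degree r \<le> n"
        unfolding r_def using dq by (intro degree_diff_le) (simp_all add: n_def k_def)
      moreover have "poly.coeff r n = 0"
        unfolding r_def using dq lp by (simp add: coeff_monom_mult n_def k_def)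
      ultimately have "r = 0 \<or> Polynomial.degree r < n"
        by (metis le_less leading_coeff_0_iff)
      then have "poly r' b = 0"
      proof
        assume "r = 0"
        then have "r' = 0" using rr by (intro Pp_zero) simp
        then show ?thesis by simp
      next
        assume "Polynomial.degree r < n"
        then show ?thesis using less.hyps[OF _ rr ra] unfolding n_def by simp
      qed
      then show ?thesis using q'b by simp
    qed
  qed
  define \<Gamma>' where "\<Gamma>' = (\<lambda>(q, q'). (poly q a, poly q' b)) ` Pp"
  have const: "([:u:], [:u':]) \<in> Pp" if "(u, u') \<in> \<Gamma>" for u u'
    using Pp_monom[OF that, of 0] by (simp add: monom_0)
  have X: "([:0, 1:], [:0, 1:]) \<in> Pp"
    using Pp_monom[OF emb_1, of 1] by (simp add: monom_altdef)
  have sub: "\<Gamma> \<subseteq> \<Gamma>'"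
    unfolding \<Gamma>'_def using const by (auto intro!: image_eqI[of _ _ "([:_:], [:_:])"])
  moreover have "(a, b) \<in> \<Gamma>'" unfolding \<Gamma>'_def using X by (auto intro!: image_eqI[of _ _ "([:0, 1:], [:0, 1:])"])
  moreover have "emb \<Gamma>'"
    unfolding emb_def
  proof (intro conjI allI impI)
    show "(to_ac c, to_ac c) \<in> \<Gamma>'" for c using sub emb_const by blast
    show "v = 0" if "(0, v) \<in> \<Gamma>'" for v using that wd unfolding \<Gamma>'_def by auto
    fix u u' v v' assume "(u, u') \<in> \<Gamma>'" "(v, v') \<in> \<Gamma>'"
    then obtain q q' r r' where q: "(q, q') \<in> Pp" "u = poly q a" "u' = poly q' b"
      and r: "(r, r') \<in> Pp" "v = poly r a" "v' = poly r' b"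
      unfolding \<Gamma>'_def by auto
    show "(u + v, u' + v') \<in> \<Gamma>'" unfolding \<Gamma>'_def
      using Pp_add[OF q(1) r(1)] q r by (intro image_eqI[of _ _ "(q + r, q' + r')"]) auto
    show "(u * v, u' * v') \<in> \<Gamma>'" unfolding \<Gamma>'_def
      using Pp_mult[OF q(1) r(1)] q r by (intro image_eqI[of _ _ "(q * r, q' * r')"]) auto
  qed
  ultimately show ?thesis by blast
qed

end

text \<open>Surjectivity: an element b is a root of a polynomial over K, and an injective map fixing
  K permutes the finite set of its roots.\<close>

lemma emb_total_gal_aut:
  assumes emb: "emb \<Gamma>" and tot: "\<And>a. \<exists>b. (a, b) \<in> \<Gamma>"
  shows "\<exists>\<sigma>. gal_aut \<sigma> \<and> (\<forall>a. (a, \<sigma> a) \<in> \<Gamma>)"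
proof -
  obtain \<sigma> where \<sigma>: "\<And>a. (a, \<sigma> a) \<in> \<Gamma>" using tot by metis
  note fn = emb_fun[OF emb]
  have 1: "\<sigma> (u + v) = \<sigma> u + \<sigma> v" for u v using fn[OF \<sigma> emb_add[OF emb \<sigma> \<sigma>]] .
  have 2: "\<sigma> (u * v) = \<sigma> u * \<sigma> v" for u v using fn[OF \<sigma> emb_mult[OF emb \<sigma> \<sigma>]] .
  have 3: "\<sigma> (to_ac c) = to_ac c" for c using fn[OF \<sigma> emb_const[OF emb]] .
  have 4: "\<sigma> 1 = 1" using 3[of 1] by simp
  interpret s: field_hom \<sigma> by standard (fact 1 2 4)+
  have "surj \<sigma>"
    unfolding surj_def
  proof
    fix b
    obtain g :: "'a poly" where g: "g \<noteq> 0" "poly (map_poly to_ac g) b = 0"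
      by (rule alg_closure_algebraic)
    define Z where "Z = {r. poly (map_poly to_ac g) r = 0}"
    have fin: "finite Z" unfolding Z_def using g by (intro poly_roots_finite) (simp add: map_poly_eq_0_iff)
    have mg: "map_poly \<sigma> (map_poly to_ac g) = map_poly to_ac g"
      by (rule poly_eqI) (simp add: coeff_map_poly 3)
    have "\<sigma> ` Z \<subseteq> Z"
    proof
      fix r assume "r \<in> \<sigma> ` Z"
      then obtain z where z: "r = \<sigma> z" "poly (map_poly to_ac g) z = 0" unfolding Z_def by auto
      show "r \<in> Z" using s.poly_map_poly[of "map_poly to_ac g" z] z unfolding mg Z_def by simp
    qed
    moreover have "inj_on \<sigma> Z" using s.h_inj by (rule inj_on_subset) simp
    ultimately have "\<sigma> ` Z = Z" using fin by (intro endo_inj_surj)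
    moreover have "b \<in> Z" unfolding Z_def using g by simp
    ultimately show "\<exists>a. b = \<sigma> a" by blast
  qed
  then have "gal_aut \<sigma>" unfolding gal_aut_def bij_def using s.h_inj 1 2 3 4 by blast
  then show ?thesis using \<sigma> by metis
qed

text \<open>Zorn's lemma gives a maximal embedding, which is total by
  \<open>emb_extend\<close>.\<close>

lemma emb_extends_to_gal_aut:
  assumes "emb \<Gamma>"
  shows "\<exists>\<sigma>. gal_aut \<sigma> \<and> (\<forall>a b. (a, b) \<in> \<Gamma> \<longrightarrow> \<sigma> a = b)"
proof -
  define A where "A = {\<Delta>. emb \<Delta> \<and> \<Gamma> \<subseteq> \<Delta>}"
  have "\<exists>M\<in>A. \<forall>Y\<in>A. M \<subseteq> Y \<longrightarrow> Y = M"
  proof (rule subset_Zorn_nonempty)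
    show "A \<noteq> {}" unfolding A_def using assms by blast
    fix C assume C: "C \<noteq> {}" "subset.chain A C"
    have el: "emb Y" "\<Gamma> \<subseteq> Y" if "Y \<in> C" for Y
      using C that unfolding A_def subset.chain_def by auto
    have two: "\<exists>Y\<in>C. s \<in> Y \<and> t \<in> Y" if "s \<in> \<Union>C" "t \<in> \<Union>C" for s t
    proof -
      from that obtain Y1 Y2 where *: "Y1 \<in> C" "Y2 \<in> C" "s \<in> Y1" "t \<in> Y2" by blast
      then have "Y1 \<subseteq> Y2 \<or> Y2 \<subseteq> Y1" using C(2) unfolding subset_chain_def by blast
      then show ?thesis using * by blast
    qed
    obtain X0 where X0: "X0 \<in> C" using C by blast
    have "emb (\<Union>C)"
      unfolding emb_def
    proof (intro conjI allI impI)
      show "(to_ac c, to_ac c) \<in> \<Union>C" for c using emb_const[OF el(1)[OF X0]] X0 by blast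
      show "v = 0" if "(0, v) \<in> \<Union>C" for v using that emb_zeroD el by blast
      fix u u' v v' assume "(u, u') \<in> \<Union>C" "(v, v') \<in> \<Union>C"
      then obtain Y where Y: "Y \<in> C" "(u, u') \<in> Y" "(v, v') \<in> Y" using two by blast
      show "(u + v, u' + v') \<in> \<Union>C" using emb_add[OF el(1)[OF Y(1)] Y(2,3)] Y by blast
      show "(u * v, u' * v') \<in> \<Union>C" using emb_mult[OF el(1)[OF Y(1)] Y(2,3)] Y by blast
    qed
    moreover have "\<Gamma> \<subseteq> \<Union>C" using el(2)[OF X0] X0 by blast
    ultimately show "\<Union>C \<in> A" unfolding A_def by blast
  qed
  then obtain M where MA: "M \<in> A" "\<forall>Y\<in>A. M \<subseteq> Y \<longrightarrow> Y = M" by blast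
  then have M: "emb M" "\<Gamma> \<subseteq> M" unfolding A_def by simp_all
  have max: "Y = M" if "emb Y" "M \<subseteq> Y" for Y
  proof -
    have "Y \<in> A" unfolding A_def using that M by auto
    then show ?thesis using MA(2) that by blast
  qed
  have "\<exists>b. (a, b) \<in> M" for a using emb_extend[OF M(1), of a] max by blast
  then obtain \<sigma> where \<sigma>: "gal_aut \<sigma>" "\<And>a. (a, \<sigma> a) \<in> M" using emb_total_gal_aut[OF M(1)] by metis
  have "\<sigma> a = b" if "(a, b) \<in> \<Gamma>" for a b
    using emb_fun[OF M(1) \<sigma>(2)] that M(2) by (meson subsetD)
  then show ?thesis using \<sigma>(1) by blast
qed

text \<open>The minimal polynomial \<open>m\<close> divides \<open>p\<close>, so \<alpha> is a
  simple root of \<open>m\<close> too. If \<open>m\<close> were not linear, it would have another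
  root \<beta>, different from \<alpha>; the map r(\<alpha>) -> r(\<beta>) would extend to an
  automorphism that moves \<alpha>. Simplicity of the root stands in for separability.\<close>

theorem gal_fixed_imp_rational:
  fixes \<alpha> :: "('a::field) alg_closure" and p :: "'a poly"
  assumes root: "poly (map_poly to_ac p) \<alpha> = 0" and simple: "poly (map_poly to_ac (pderiv p)) \<alpha> \<noteq> 0"
    and fixed: "\<And>\<sigma>. gal_aut \<sigma> \<Longrightarrow> \<sigma> \<alpha> = \<alpha>"
  shows "\<alpha> \<in> range to_ac"
proof -
  define Q where "Q = (\<lambda>n. \<exists>q::'a poly. q \<noteq> 0 \<and> poly (map_poly to_ac q) \<alpha> = 0 \<and> Polynomial.degree q = n)"
  have "p \<noteq> 0" using simple by auto
  then have "Q (Polynomial.degree p)" unfolding Q_def using root by blast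
  then have "Q (LEAST n. Q n)" by (rule LeastI)
  then obtain m :: "'a poly" where m: "m \<noteq> 0" "poly (map_poly to_ac m) \<alpha> = 0" "Polynomial.degree m = (LEAST n. Q n)"
    unfolding Q_def by blast
  have dvd: "m dvd q" if "poly (map_poly to_ac q) \<alpha> = 0" for q
  proof (rule ccontr)
    assume "\<not> m dvd q"
    then have nz: "q mod m \<noteq> 0" by (simp add: dvd_eq_mod_eq_0)
    have "map_poly to_ac q = map_poly to_ac (q div m) * map_poly to_ac m + map_poly to_ac (q mod m)"
      by (simp flip: ac.map_poly_mult ac.map_poly_add)
    then have "poly (map_poly to_ac (q mod m)) \<alpha> = 0" using that m by simp
    then have "Q (Polynomial.degree (q mod m))" unfolding Q_def using nz by blast
    then have "Polynomial.degree m \<le> Polynomial.degree (q mod m)" unfolding m(3) by (rule Least_le)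
    then show False using degree_mod_less[OF m(1), of q] nz by simp
  qed
  have dm: "poly (pderiv (map_poly to_ac m)) \<alpha> \<noteq> 0"
  proof
    assume *: "poly (pderiv (map_poly to_ac m)) \<alpha> = 0"
    obtain s where p: "p = m * s" using dvd[OF root] by blast
    have "map_poly to_ac (pderiv (m * s)) = map_poly to_ac m * pderiv (map_poly to_ac s) + map_poly to_ac s * pderiv (map_poly to_ac m)"
      by (simp only: pderiv_mult ac.map_poly_add ac.map_poly_mult ac.map_poly_pderiv)
    then show False using simple m * unfolding p by simp
  qed
  obtain q where q: "map_poly to_ac m = [:-\<alpha>, 1:] * q" using m(2) by (metis dvdE poly_eq_0_iff_dvd)
  have "pderiv (map_poly to_ac m) = [:-\<alpha>, 1:] * pderiv q + q * pderiv [:-\<alpha>, 1:]"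
    unfolding q pderiv_mult ..
  moreover have "pderiv [:-\<alpha>, 1:] = 1" by (simp add: pderiv_pCons one_pCons)
  ultimately have q\<alpha>: "poly q \<alpha> \<noteq> 0" using dm by simp
  show ?thesis
  proof (cases "Polynomial.degree q = 0")
    case True
    then obtain k where k: "q = [:k:]" by (rule degree_eq_zeroE)
    then have mm: "map_poly to_ac m = [:- \<alpha> * k, k:]" unfolding q by simp
    then have "k = to_ac (poly.coeff m 1)" "- \<alpha> * k = to_ac (poly.coeff m 0)"
      using coeff_map_poly[of to_ac m 1] coeff_map_poly[of to_ac m 0] by simp_all
    moreover have "k \<noteq> 0" using q\<alpha> k by simp
    ultimately have "\<alpha> = to_ac (- (poly.coeff m 0 / poly.coeff m 1))"
      by (metis ac.h_divide ac.h_minus minus_mult_left minus_minus nonzero_mult_div_cancel_right minus_divide_left)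
    then show ?thesis by blast
  next
    case False
    then obtain \<beta> where \<beta>: "poly q \<beta> = 0" using alg_closed_imp_poly_has_root[of q] by auto
    have m\<beta>: "poly (map_poly to_ac m) \<beta> = 0" unfolding q using \<beta> by simp
    define \<Gamma> where "\<Gamma> = range (\<lambda>r. (poly (map_poly to_ac r) \<alpha>, poly (map_poly to_ac r) \<beta>))"
    have "emb \<Gamma>"
      unfolding emb_def
    proof (intro conjI allI impI)
      show "(to_ac c, to_ac c) \<in> \<Gamma>" for c
        unfolding \<Gamma>_def by (rule image_eqI[of _ _ "[:c:]"]) (simp_all add: map_poly_pCons)
      show "v = 0" if "(0, v) \<in> \<Gamma>" for v
      proof -
        from that obtain r where r: "poly (map_poly to_ac r) \<alpha> = 0" "v = poly (map_poly to_ac r) \<beta>"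
          unfolding \<Gamma>_def by auto
        then obtain s where "r = m * s" using dvd by blast
        then show ?thesis using r m\<beta> by (simp add: ac.map_poly_mult)
      qed
      fix u u' v v' assume "(u, u') \<in> \<Gamma>" "(v, v') \<in> \<Gamma>"
      then obtain r s where "u = poly (map_poly to_ac r) \<alpha>" "u' = poly (map_poly to_ac r) \<beta>"
         "v = poly (map_poly to_ac s) \<alpha>" "v' = poly (map_poly to_ac s) \<beta>"
        unfolding \<Gamma>_def by auto
      then show "(u + v, u' + v') \<in> \<Gamma>" "(u * v, u' * v') \<in> \<Gamma>"
        unfolding \<Gamma>_def
        by (simp_all add: image_eqI[of _ _ "r + s"] image_eqI[of _ _ "r * s"] ac.map_poly_add ac.map_poly_mult)
    qed
    then obtain \<sigma> where \<sigma>: "gal_aut \<sigma>" "\<And>a b. (a, b) \<in> \<Gamma> \<Longrightarrow> \<sigma> a = b"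
      using emb_extends_to_gal_aut by blast
    have "(\<alpha>, \<beta>) \<in> \<Gamma>" unfolding \<Gamma>_def by (rule image_eqI[of _ _ "[:0, 1:]"]) (simp_all add: map_poly_pCons)
    then have "\<beta> = \<alpha>" using \<sigma> fixed by metis
    then show ?thesis using \<beta> q\<alpha> by simp
  qed
qed

section \<open>Groups of affine maps of a plane over a prime field\<close>

lemma card_fibres:
  assumes "finite H" "\<And>a b. a \<in> f ` H \<Longrightarrow> b \<in> f ` H \<Longrightarrow> card {h \<in> H. f h = a} \<le> card {h \<in> H. f h = b}"
    and "a \<in> f ` H"
  shows "card H = card (f ` H) * card {h \<in> H. f h = a}"
proof -
  have "card H = (\<Sum>b\<in>f ` H. card {h \<in> H. f h = b})"
    using sum.image_gen[OF assms(1), of "\<lambda>_. 1::nat" f] by simp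
  also have "\<dots> = (\<Sum>b\<in>f ` H. card {h \<in> H. f h = a})"
    using assms(2,3) by (intro sum.cong) (auto intro: le_antisym)
  finally show ?thesis by simp
qed

text \<open>Written multiplicatively: \<open>A\<close> is E over the algebraic closure,
  \<open>V\<close> is E[l], \<open>XS\<close> is the fibre over P, and \<open>Gs\<close> is the
  Galois action. Powers act as scalars of F_l on \<open>V\<close>; each map is affine on
  \<open>XS\<close> because it is additive on all of \<open>A\<close>. The assumption
  \<open>no_line\<close> denies a stable subgroup of order l, and \<open>Y\<close> is the part cut
  out by a proper factor.\<close>

locale affine_action = comm_group A for A (structure) +
  fixes l :: nat and p :: 'a and Gs :: "('a \<Rightarrow> 'a) set" and V XS Y :: "'a set"
  assumes prime_l: "Factorial_Ring.prime l"
    and V_def: "V = {v \<in> carrier A. v [^] l = \<one>}" and card_V: "card V = l ^ 2"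
    and p: "p \<in> carrier A" and XS_def: "XS = {x \<in> carrier A. x [^] l = p}"
    and g_closed: "\<And>g x. g \<in> Gs \<Longrightarrow> x \<in> carrier A \<Longrightarrow> g x \<in> carrier A"
    and g_mult: "\<And>g x y. g \<in> Gs \<Longrightarrow> x \<in> carrier A \<Longrightarrow> y \<in> carrier A \<Longrightarrow> g (x \<otimes> y) = g x \<otimes> g y"
    and g_p: "\<And>g. g \<in> Gs \<Longrightarrow> g p = p"
    and g_comp: "\<And>g h. g \<in> Gs \<Longrightarrow> h \<in> Gs \<Longrightarrow> g \<circ> h \<in> Gs"
    and g_inv: "\<And>g. g \<in> Gs \<Longrightarrow> \<exists>h\<in>Gs. \<forall>x. h (g x) = x \<and> g (h x) = x"
    and g_id: "id \<in> Gs"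
    and no_line: "\<And>v. v \<in> V \<Longrightarrow> v \<noteq> \<one> \<Longrightarrow> \<exists>g\<in>Gs. g v \<notin> range (\<lambda>n::nat. v [^] n)"
    and Y: "Y \<subseteq> XS" "Y \<noteq> {}" "Y \<noteq> XS" and g_Y: "\<And>g. g \<in> Gs \<Longrightarrow> g ` Y \<subseteq> Y"
begin

abbreviation span :: "'a \<Rightarrow> 'a set" where "span v \<equiv> range (\<lambda>n::nat. v [^] n)"

lemma l_gt_1: "l > 1" using prime_l prime_gt_1_nat by blast

lemma V_carrier: "v \<in> V \<Longrightarrow> v \<in> carrier A" and V_pow: "v \<in> V \<Longrightarrow> v [^] l = \<one>"
  and X_carrier: "x \<in> XS \<Longrightarrow> x \<in> carrier A" and X_pow: "x \<in> XS \<Longrightarrow> x [^] l = p"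
  unfolding V_def XS_def by auto

lemma one_V: "\<one> \<in> V" unfolding V_def by simp

lemma V_mult: "u \<in> V \<Longrightarrow> v \<in> V \<Longrightarrow> u \<otimes> v \<in> V"
  unfolding V_def by (simp add: nat_pow_distrib)

lemma V_npow: "v \<in> V \<Longrightarrow> v [^] (n::nat) \<in> V"
  by (induction n) (simp_all add: one_V V_mult)

lemma pow_mod: "v \<in> V \<Longrightarrow> v [^] (n::nat) = v [^] (n mod l)"
proof -
  assume v: "v \<in> V"
  have "v [^] (l * (n div l) + n mod l) = v [^] (n mod l)"
    using V_pow[OF v] V_carrier[OF v]
    by (simp only: nat_pow_mult[symmetric] nat_pow_pow[symmetric]) simp
  then show ?thesis by simp
qed

lemma pow_cong: "v \<in> V \<Longrightarrow> [m = n] (mod l) \<Longrightarrow> v [^] (m::nat) = v [^] (n::nat)"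
  using pow_mod[of v m] pow_mod[of v n] unfolding cong_def by metis

lemma inv_eq_pow: "v \<in> V \<Longrightarrow> inv v = v [^] (l - 1)"
proof -
  assume v: "v \<in> V"
  have "v [^] (l - 1) \<otimes> v = v [^] l" using l_gt_1 nat_pow_Suc[of v "l - 1"] by simp
  then show ?thesis using V_pow[OF v] V_carrier[OF v] by (intro inv_equality) simp_all
qed

lemma span_V: "v \<in> V \<Longrightarrow> span v \<subseteq> V"
  using V_npow by blast

lemma span_pow: "v \<in> V \<Longrightarrow> u \<in> span v \<Longrightarrow> u [^] (n::nat) \<in> span v"
  using V_carrier by (auto simp: nat_pow_pow)

lemma span_mult: "v \<in> V \<Longrightarrow> u \<in> span v \<Longrightarrow> u' \<in> span v \<Longrightarrow> u \<otimes> u' \<in> span v"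
  using V_carrier by (auto simp: nat_pow_mult)

lemma span_inv: "v \<in> V \<Longrightarrow> u \<in> span v \<Longrightarrow> inv u \<in> span v"
  using inv_eq_pow[of u] span_V span_pow by (metis subsetD)

lemma ex_inverse_mod:
  assumes "\<not> l dvd j"
  shows "\<exists>k::nat. [j * k = 1] (mod l)"
proof -
  have "coprime j l" using assms prime_l by (metis coprime_commute prime_imp_coprime)
  then show ?thesis using cong_solve_coprime_nat[of j l] by simp
qed

lemma span_root:
  assumes "v \<in> V" "w \<in> V" "w [^] (j::nat) \<in> span v" "\<not> l dvd j"
  shows "w \<in> span v"
proof -
  obtain k where "[j * k = 1] (mod l)" using ex_inverse_mod[OF assms(4)] by blast
  then have "(w [^] j) [^] k = w [^] (1::nat)"
    using pow_cong[OF assms(2)] V_carrier[OF assms(2)] by (simp only: nat_pow_pow)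
  then have "(w [^] j) [^] k = w" using V_carrier[OF assms(2)] by simp
  then show ?thesis using span_pow[OF assms(1,3), of k] by simp
qed

lemma pow_eq_one: "v \<in> V \<Longrightarrow> v \<noteq> \<one> \<Longrightarrow> v [^] (j::nat) = \<one> \<longleftrightarrow> l dvd j"
proof
  assume v: "v \<in> V" "v \<noteq> \<one>" and "v [^] j = \<one>"
  then have "v [^] j \<in> span \<one>" by simp
  then show "l dvd j" using span_root[OF one_V v(1), of j] v by auto
next
  assume v: "v \<in> V" and "l dvd j"
  then show "v [^] j = \<one>" using pow_mod[OF v, of j] by simp
qed

lemma finite_V: "finite V"
  using card_V l_gt_1 card.infinite by fastforce

text \<open>The dimension is encoded in \<open>card_V\<close>: the l^2 products with exponents below
  l are distinct, so they exhaust \<open>V\<close>.\<close>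

lemma basis:
  assumes v: "v \<in> V" "v \<noteq> \<one>" and w: "w \<in> V" "w \<notin> span v" and u: "u \<in> V"
  shows "\<exists>i<l. \<exists>j<l. u = v [^] i \<otimes> w [^] j"
proof -
  define f where "f = (\<lambda>(i, j). v [^] (i::nat) \<otimes> w [^] (j::nat))"
  have vc: "v \<in> carrier A" and wc: "w \<in> carrier A" using V_carrier v w by auto
  have aux: "j = j'" if "v [^] i \<otimes> w [^] j = v [^] i' \<otimes> w [^] j'" "j \<le> j'" "j' < l" for i i' j j' :: nat
  proof (rule ccontr)
    assume ne: "j \<noteq> j'"
    define a b b' d where abbr: "a = w [^] j" "b = v [^] i" "b' = v [^] i'" "d = w [^] (j' - j)"
    have ac: "a \<in> carrier A" "b \<in> carrier A" "b' \<in> carrier A" "d \<in> carrier A"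
      unfolding abbr using vc wc by simp_all
    have "w [^] j' = a \<otimes> d" unfolding abbr using that(2) wc by (simp add: nat_pow_mult)
    then have "b \<otimes> a = b' \<otimes> (a \<otimes> d)" using that(1) unfolding abbr by simp
    then have "a \<otimes> b = a \<otimes> (b' \<otimes> d)" using ac by (simp only: m_lcomm m_comm)
    then have "b = b' \<otimes> d" using ac by simp
    then have "d = inv b' \<otimes> b" using ac inv_solve_left[of d b' b] by simp
    then have "w [^] (j' - j) = inv (v [^] i') \<otimes> v [^] i" unfolding abbr .
    also have "\<dots> \<in> span v" by (intro span_mult span_inv v) auto
    finally have "w [^] (j' - j) \<in> span v" .
    moreover have "\<not> l dvd j' - j" using ne that by (intro nat_dvd_not_less) auto
    ultimately have "w \<in> span v" using span_root[OF v(1) w(1)] by blast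
    then show False using w by simp
  qed
  have inj: "inj_on f ({..<l} \<times> {..<l})"
  proof (rule inj_onI, clarsimp simp: f_def)
    fix i j i' j' assume lt: "i < l" "j < l" "i' < l" "j' < l"
      and eq: "v [^] i \<otimes> w [^] j = v [^] i' \<otimes> w [^] j'"
    have jj: "j = j'" using aux[OF eq] aux[OF eq[symmetric]] lt by (metis nat_le_linear)
    then have vi: "v [^] i = v [^] i'" using eq vc wc by simp
    have "a = b" if "v [^] a = v [^] b" "a \<le> b" "b < l" for a b :: nat
    proof -
      have "v [^] a \<otimes> v [^] (b - a) = v [^] b" using that(2) vc by (simp add: nat_pow_mult)
      then have "v [^] a \<otimes> \<one> = v [^] a \<otimes> v [^] (b - a)" using that(1) vc by simp
      then have "v [^] (b - a) = \<one>" using vc by (metis l_cancel nat_pow_closed one_closed)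
      then have "l dvd b - a" using pow_eq_one[OF v] by simp
      moreover have "b - a < l" using that by simp
      ultimately have "b - a = 0" by (metis dvd_imp_le linorder_not_less not_gr_zero)
      then show ?thesis using that by simp
    qed
    then show "i = i' \<and> j = j'" using jj vi lt by (metis nat_le_linear)
  qed
  have "card (f ` ({..<l} \<times> {..<l})) = card V"
    using card_image[OF inj] card_V by (simp add: power2_eq_square)
  moreover have "f ` ({..<l} \<times> {..<l}) \<subseteq> V"
    unfolding f_def using V_mult V_npow v w by auto
  ultimately have "f ` ({..<l} \<times> {..<l}) = V"
    using finite_V by (intro card_subset_eq) auto
  then show ?thesis using u unfolding f_def by auto
qed

lemma ex_not_span: "v \<in> V \<Longrightarrow> \<exists>w\<in>V. w \<notin> span v"
proof (rule ccontr)
  assume v: "v \<in> V" and all: "\<not> (\<exists>w\<in>V. w \<notin> span v)"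
  have "V \<subseteq> (\<lambda>n. v [^] n) ` {..<l}"
  proof
    fix x assume "x \<in> V"
    then obtain n :: nat where "x = v [^] n" using all by blast
    then have "x = v [^] (n mod l)" using pow_mod[OF v] by metis
    then show "x \<in> (\<lambda>n. v [^] n) ` {..<l}" using l_gt_1 by simp
  qed
  then have "card V \<le> card ((\<lambda>n. v [^] n) ` {..<l})" by (intro card_mono) auto
  also have "\<dots> \<le> l" using card_image_le[of "{..<l}"] by simp
  finally show False using card_V l_gt_1 by (simp add: power2_eq_square)
qed

lemma g_one: "g \<in> Gs \<Longrightarrow> g \<one> = \<one>"
  using g_mult[of g \<one> \<one>] g_closed[of g \<one>] by (metis l_one one_closed r_cancel_one')

lemma g_inverse: "g \<in> Gs \<Longrightarrow> x \<in> carrier A \<Longrightarrow> g (inv x) = inv (g x)"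
  using g_mult[of g "inv x" x] g_one[of g] g_closed by (intro inv_equality[symmetric]) auto

lemma g_pow: "g \<in> Gs \<Longrightarrow> x \<in> carrier A \<Longrightarrow> g (x [^] (n::nat)) = g x [^] n"
  by (induction n) (simp_all add: g_one g_mult)

lemma g_V: "g \<in> Gs \<Longrightarrow> v \<in> V \<Longrightarrow> g v \<in> V"
  using g_pow[of g v l] g_one[of g] g_closed unfolding V_def by simp

lemma g_X: "g \<in> Gs \<Longrightarrow> x \<in> XS \<Longrightarrow> g x \<in> XS"
  using g_pow[of g x l] g_p[of g] g_closed unfolding XS_def by simp

lemma g_inj: "g \<in> Gs \<Longrightarrow> g x = g y \<longleftrightarrow> x = y"
  using g_inv by metis

lemma X_V: "x \<in> XS \<Longrightarrow> v \<in> V \<Longrightarrow> x \<otimes> v \<in> XS"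
  unfolding XS_def V_def using p by (auto simp: nat_pow_distrib)

lemma X_diff: "x \<in> XS \<Longrightarrow> y \<in> XS \<Longrightarrow> inv x \<otimes> y \<in> V"
  unfolding XS_def V_def using p by (auto simp: nat_pow_distrib nat_pow_inv)

lemma X_split: "x \<in> XS \<Longrightarrow> y \<in> XS \<Longrightarrow> y = x \<otimes> (inv x \<otimes> y)"
  using X_carrier by (simp add: m_assoc[symmetric])

lemma finite_X: "finite XS"
proof -
  obtain x where x: "x \<in> XS" using Y by blast
  have "XS \<subseteq> (\<lambda>v. x \<otimes> v) ` V" using X_split[OF x] X_diff[OF x] by blast
  then show ?thesis using finite_V finite_surj by blast
qed

lemma g_image: "g \<in> Gs \<Longrightarrow> finite Z \<Longrightarrow> g ` Z \<subseteq> Z \<Longrightarrow> g ` Z = Z"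
  using g_inj by (intro endo_inj_surj) (auto simp: inj_on_def)

text \<open>The product s of the elements of \<open>Z\<close> is fixed and satisfies s^l = p^(card
  Z). Dividing by \<open>card Z\<close> means raising to an inverse exponent modulo l and correcting
  by a power of \<open>p\<close>.\<close>

lemma barycentre:
  assumes Z: "Z \<subseteq> XS" and st: "\<And>g. g \<in> Gs \<Longrightarrow> g ` Z \<subseteq> Z" and nd: "\<not> l dvd card Z"
  shows "\<exists>x\<in>XS. \<forall>g\<in>Gs. g x = x"
proof -
  have finZ: "finite Z" using Z finite_X finite_subset by blast
  define s where "s = finprod A (\<lambda>z. z) Z"
  have Zc: "Z \<subseteq> carrier A" using Z X_carrier by blast
  have s: "s \<in> carrier A" unfolding s_def using Zc by (intro finprod_closed) auto
  have sp: "finprod A (\<lambda>z. z) W [^] l = p [^] card W" if "finite W" "W \<subseteq> Z" for W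
    using that
  proof (induction W)
    case (insert w W)
    have "W \<subseteq> carrier A" "w \<in> carrier A" using insert Zc by auto
    moreover have "w [^] l = p" using insert Z X_pow by auto
    moreover have "finprod A (\<lambda>z. z) W \<in> carrier A" using calculation by (intro finprod_closed) auto
    ultimately show ?case using insert p by (subst finprod_insert) (auto simp: nat_pow_distrib m_comm)
  qed simp
  have gs: "g s = s" if g: "g \<in> Gs" for g
  proof -
    have "g (finprod A (\<lambda>z. z) W) = finprod A g W" if "finite W" "W \<subseteq> Z" for W
      using that
    proof (induction W)
      case (insert w W)
      have W: "W \<subseteq> carrier A" "w \<in> carrier A" using insert Zc by auto
      have c: "finprod A (\<lambda>z. z) W \<in> carrier A" using W by (intro finprod_closed) auto
      show ?case using insert W c g g_closed[OF g] by (subst (1 2) finprod_insert) (auto simp: g_mult)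
    qed (use g g_one in simp)
    then have "g s = finprod A g Z" unfolding s_def using finZ by simp
    also have "\<dots> = finprod A (\<lambda>z. z) (g ` Z)"
    proof (rule finprod_reindex[symmetric])
      show "(\<lambda>z. z) \<in> g ` Z \<rightarrow> carrier A" using Zc g_closed[OF g] by auto
      show "inj_on g Z" using g_inj[OF g] by (simp add: inj_on_def)
    qed
    also have "g ` Z = Z" by (rule g_image[OF g finZ st[OF g]])
    finally show ?thesis unfolding s_def .
  qed
  obtain k where k: "[card Z * k = 1] (mod l)" using ex_inverse_mod[OF nd] by blast
  then have "1 \<le> card Z * k" using l_gt_1 by (cases "card Z * k") (auto simp: cong_def)
  moreover from k this obtain t where "card Z * k = 1 + l * t"
    by (metis cong_to_1_nat dvd_def le_add_diff_inverse)
  ultimately have t: "card Z * k = l * t + 1" by simp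
  \<comment> \<open>With card Z * k = l t + 1, the l-th power of s^k is p^(l t + 1), so the factor
    p^(-t) brings it back to \<open>p\<close>.\<close>
  define b where "b = s [^] k \<otimes> inv (p [^] t)"
  have bc: "b \<in> carrier A" unfolding b_def using s p by simp
  have "b [^] l = (s [^] l) [^] k \<otimes> inv ((p [^] t) [^] l)"
  proof -
    have "b [^] l = (s [^] k) [^] l \<otimes> inv ((p [^] t) [^] l)"
      unfolding b_def using s p by (simp add: nat_pow_distrib nat_pow_inv)
    also have "(s [^] k) [^] l = (s [^] l) [^] k" using s by (simp only: nat_pow_pow mult.commute)
    finally show ?thesis .
  qed
  also have "(s [^] l) [^] k = p [^] (l * t) \<otimes> p"
    using sp[OF finZ] p t unfolding s_def by (simp add: nat_pow_pow)
  also have "(p [^] t) [^] l = p [^] (l * t)" using p by (simp only: nat_pow_pow mult.commute)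
  also have "p [^] (l * t) \<otimes> p \<otimes> inv (p [^] (l * t)) = p"
    using p by (simp add: m_comm[of _ p] m_assoc)
  finally have "b [^] l = p" .
  then have "b \<in> XS" unfolding XS_def using bc by simp
  moreover have "g b = b" if "g \<in> Gs" for g
    unfolding b_def using that s p gs[OF that] g_p[OF that] by (simp add: g_mult g_inverse g_pow)
  ultimately show ?thesis by blast
qed

text \<open>A nontrivial translation together with a conjugate of it would generate all translations.\<close>
lemma no_translation:
  assumes g: "g \<in> Gs" and gV: "\<And>v. v \<in> V \<Longrightarrow> g v = v" and x: "x \<in> XS"
  shows "g x = x"
proof (rule ccontr)
  assume ne: "g x \<noteq> x"
  define t where "t = inv x \<otimes> g x"
  have tV: "t \<in> V" unfolding t_def using X_diff[OF x g_X[OF g x]] .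
  have gt: "g z = z \<otimes> t" if z: "z \<in> XS" for z
  proof -
    have "g z = g x \<otimes> (inv x \<otimes> z)"
      using X_split[OF x z] g_mult[OF g, of x "inv x \<otimes> z"] gV[OF X_diff[OF x z]] X_carrier x z by auto
    then show ?thesis unfolding t_def using X_carrier[OF x] X_carrier[OF z] g_closed[OF g] by (simp add: m_ac)
  qed
  have "t \<noteq> \<one>" using gt[OF x] ne X_carrier[OF x] by auto
  then obtain k where k: "k \<in> Gs" "k t \<notin> span t" using no_line[OF tV] by blast
  obtain k' where k': "k' \<in> Gs" "\<And>x. k' (k x) = x" "\<And>x. k (k' x) = x" using g_inv[OF k(1)] by metis
  define h where "h = k \<circ> (g \<circ> k')"
  have h: "h \<in> Gs" unfolding h_def by (intro g_comp k(1) k'(1) g)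
  have ht: "h z = z \<otimes> k t" if z: "z \<in> XS" for z
  proof -
    have "h z = k (k' z \<otimes> t)" unfolding h_def using gt[OF g_X[OF k'(1) z]] by simp
    also have "\<dots> = z \<otimes> k t" using g_mult[OF k(1)] g_closed[OF k'(1)] X_carrier[OF z] V_carrier[OF tV] k'(3) by simp
    finally show ?thesis .
  qed
  have iter: "z \<otimes> s [^] n \<in> Y" if "z \<in> Y" "\<And>z. z \<in> XS \<Longrightarrow> f z = z \<otimes> s" "f \<in> Gs" "s \<in> V" for f s z and n :: nat
  proof (induction n)
    case 0
    then show ?case using that Y X_carrier by auto
  next
    case (Suc n)
    have "f (z \<otimes> s [^] n) = z \<otimes> s [^] n \<otimes> s" using that(2) Suc Y by blast
    also have "\<dots> = z \<otimes> s [^] Suc n" using that(1,4) Y X_carrier V_carrier by (auto simp: m_assoc)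
    finally show ?case using g_Y[OF that(3)] Suc by force
  qed
  obtain y where y: "y \<in> Y" using Y by blast
  \<comment> \<open>\<open>Y\<close> is closed under the translations by \<open>t\<close> and
    \<open>k t\<close>; the two directions are independent, so every difference of points of
    \<open>XS\<close> is reached.\<close>
  have "XS \<subseteq> Y"
  proof
    fix z assume z: "z \<in> XS"
    have yX: "y \<in> XS" using y Y by blast
    obtain i j :: nat where ij: "inv y \<otimes> z = t [^] i \<otimes> k t [^] j"
      using basis[OF tV \<open>t \<noteq> \<one>\<close> g_V[OF k(1) tV] k(2) X_diff[OF yX z]] by blast
    have "y \<otimes> t [^] i \<in> Y" using iter[OF y gt g tV] .
    then have "y \<otimes> t [^] i \<otimes> k t [^] j \<in> Y" using iter[OF _ ht h g_V[OF k(1) tV]] by blast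
    moreover have "y \<otimes> t [^] i \<otimes> k t [^] j = z"
      using X_split[OF yX z] ij X_carrier[OF yX] V_carrier[OF tV] V_carrier[OF g_V[OF k(1) tV]] by (simp add: m_assoc)
    ultimately show "z \<in> Y" by simp
  qed
  then show False using Y by blast
qed

text \<open>\<open>Gs\<close> may be infinite, but its restriction to the finite set
  \<open>V \<union> XS\<close> is a finite group of maps, to which counting applies.\<close>

definition H :: "('a \<Rightarrow> 'a) set" where "H = (\<lambda>g. restrict g (V \<union> XS)) ` Gs"

lemma finite_H: "finite H"
proof (rule finite_subset)
  show "H \<subseteq> (V \<union> XS) \<rightarrow>\<^sub>E (V \<union> XS)"
  proof
    fix f assume "f \<in> H"
    then obtain g where "g \<in> Gs" "f = restrict g (V \<union> XS)" unfolding H_def by blast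
    then show "f \<in> (V \<union> XS) \<rightarrow>\<^sub>E (V \<union> XS)" using g_V g_X by (auto simp only: restrict_PiE_iff)
  qed
  show "finite ((V \<union> XS) \<rightarrow>\<^sub>E (V \<union> XS))" using finite_V finite_X by (intro finite_PiE) auto
qed

text \<open>Orbit and stabiliser: composing with a map that carries a to b injects the maps sending
  z to a into those sending z to b, so all fibres over the orbit have one size.\<close>

lemma card_H:
  assumes z: "z \<in> V \<union> XS"
  shows "card H = card ((\<lambda>g. g z) ` Gs) * card {h \<in> H. h z = z}"
proof -
  have im: "(\<lambda>h. h z) ` H = (\<lambda>g. g z) ` Gs" unfolding H_def image_image using z by simp
  have "card {h \<in> H. h z = a} \<le> card {h \<in> H. h z = b}" if "a \<in> (\<lambda>h. h z) ` H" "b \<in> (\<lambda>h. h z) ` H" for a b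
  proof -
    from that obtain g1 g2 where g: "g1 \<in> Gs" "g2 \<in> Gs" "a = g1 z" "b = g2 z" unfolding im by blast
    obtain g1' where g1': "g1' \<in> Gs" "\<And>x. g1' (g1 x) = x" using g_inv[OF g(1)] by metis
    define k where "k = g2 \<circ> g1'"
    have k: "k \<in> Gs" "k a = b" unfolding k_def using g_comp[OF g(2) g1'(1)] g g1' by auto
    define F where "F = (\<lambda>h. restrict (k \<circ> h) (V \<union> XS))"
    have "inj_on F {h \<in> H. h z = a}"
    proof (rule inj_onI)
      fix h h' assume h: "h \<in> {h \<in> H. h z = a}" "h' \<in> {h \<in> H. h z = a}" and eq: "F h = F h'"
      show "h = h'"
      proof (rule extensionalityI[where A = "V \<union> XS"])
        show "h \<in> extensional (V \<union> XS)" "h' \<in> extensional (V \<union> XS)" using h unfolding H_def by auto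
        fix x assume "x \<in> V \<union> XS"
        then have "k (h x) = k (h' x)" using fun_cong[OF eq, of x] unfolding F_def by simp
        then show "h x = h' x" using g_inj[OF k(1)] by simp
      qed
    qed
    moreover have "F ` {h \<in> H. h z = a} \<subseteq> {h \<in> H. h z = b}"
    proof
      fix f assume "f \<in> F ` {h \<in> H. h z = a}"
      then obtain g where g: "g \<in> Gs" "restrict g (V \<union> XS) z = a" "f = F (restrict g (V \<union> XS))"
        unfolding H_def by blast
      have "F (restrict g (V \<union> XS)) = restrict (k \<circ> g) (V \<union> XS)" unfolding F_def by auto
      then show "f \<in> {h \<in> H. h z = b}"
        using g_comp[OF k(1) g(1)] g(2,3) k(2) z unfolding H_def by auto
    qed
    ultimately show ?thesis using finite_H by (intro card_inj_on_le) auto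
  qed
  moreover have "z \<in> (\<lambda>h. h z) ` H" unfolding im using g_id by (intro image_eqI[of _ _ id]) auto
  ultimately show ?thesis using card_fibres[OF finite_H, of "\<lambda>h. h z" z] im by simp
qed

text \<open>The orbit of a point is stable; if its size were prime to l, its barycentre would be a
  fixed point.\<close>

lemma l_dvd_card_H:
  assumes "\<not> (\<exists>x\<in>XS. \<forall>g\<in>Gs. g x = x)"
  shows "l dvd card H"
proof -
  obtain y where y: "y \<in> Y" using Y by blast
  have yX: "y \<in> XS" using y Y by blast
  have "l dvd card ((\<lambda>g. g y) ` Gs)"
  proof (rule ccontr)
    assume "\<not> ?thesis"
    moreover have "(\<lambda>g. g y) ` Gs \<subseteq> XS" using g_X yX by blast
    moreover have "g ` (\<lambda>g. g y) ` Gs \<subseteq> (\<lambda>g. g y) ` Gs" if "g \<in> Gs" for g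
    proof -
      have "g (h y) \<in> (\<lambda>g. g y) ` Gs" if "h \<in> Gs" for h
        using g_comp[OF \<open>g \<in> Gs\<close> that] by (intro image_eqI[of _ _ "g \<circ> h"]) auto
      then show ?thesis by blast
    qed
    ultimately show False using barycentre assms by blast
  qed
  then show ?thesis using card_H[of y] yX by simp
qed

text \<open>The size of \<open>V - {\<one>}\<close> is prime to \<open>l\<close>, hence so is the size of some orbit.\<close>
lemma ex_large_stabilizer:
  assumes "l dvd card H"
  shows "\<exists>v\<in>V. v \<noteq> \<one> \<and> l \<le> card {h \<in> H. h v = v}"
proof -
  define orb where "orb = (\<lambda>v. (\<lambda>g. g v) ` Gs)"
  have orb_sub: "orb v \<subseteq> V - {\<one>}" if "v \<in> V - {\<one>}" for v
    unfolding orb_def using that g_V g_one g_inj by auto (metis g_inj g_one)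
  have self: "v \<in> orb v" for v unfolding orb_def using g_id by (intro image_eqI[of _ _ id]) auto
  have orb_eq: "orb u = orb v" if "u \<in> orb v" for u v
  proof -
    from that obtain g where g: "g \<in> Gs" "u = g v" unfolding orb_def by blast
    obtain g' where g': "g' \<in> Gs" "\<And>x. g' (g x) = x" using g_inv[OF g(1)] by metis
    have "h u \<in> orb v" if "h \<in> Gs" for h
      unfolding orb_def using g_comp[OF that g(1)] g by (intro image_eqI[of _ _ "h \<circ> g"]) auto
    moreover have "h v \<in> orb u" if "h \<in> Gs" for h
      unfolding orb_def using g_comp[OF that g'(1)] g g' by (intro image_eqI[of _ _ "h \<circ> g'"]) auto
    ultimately show ?thesis unfolding orb_def by blast
  qed
  have "\<exists>v\<in>V - {\<one>}. \<not> l dvd card (orb v)"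
  proof (rule ccontr)
    assume *: "\<not> ?thesis"
    have U: "\<Union>(orb ` (V - {\<one>})) = V - {\<one>}" using orb_sub self by blast
    have "l dvd card (\<Union>(orb ` (V - {\<one>})))"
    proof (rule dvd_partition)
      show "finite (\<Union>(orb ` (V - {\<one>})))" unfolding U using finite_V by simp
      show "\<forall>c\<in>orb ` (V - {\<one>}). l dvd card c" using * by blast
      show "\<forall>c1\<in>orb ` (V - {\<one>}). \<forall>c2\<in>orb ` (V - {\<one>}). c1 \<noteq> c2 \<longrightarrow> c1 \<inter> c2 = {}"
        using orb_eq by blast
    qed
    then have "l dvd l ^ 2 - 1" unfolding U using card_V one_V finite_V by simp
    moreover have "l dvd l ^ 2" by simp
    moreover have "l ^ 2 \<ge> 1" using l_gt_1 by simp
    ultimately have "l dvd 1" by (metis dvd_diff_nat diff_diff_cancel)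
    then show False using l_gt_1 by simp
  qed
  then obtain v where v: "v \<in> V" "v \<noteq> \<one>" "\<not> l dvd card (orb v)" by blast
  have "l dvd card (orb v) * card {h \<in> H. h v = v}"
    using assms card_H[of v] v(1) unfolding orb_def by simp
  then have "l dvd card {h \<in> H. h v = v}" using v(3) prime_dvd_mult_iff[OF prime_l] by blast
  moreover have "restrict id (V \<union> XS) \<in> {h \<in> H. h v = v}" unfolding H_def using g_id v by auto
  then have "card {h \<in> H. h v = v} > 0" using finite_H by (auto simp: card_gt_0_iff)
  ultimately show ?thesis using v dvd_imp_le by blast
qed

lemma g_eqI:
  assumes "g \<in> Gs" "h \<in> Gs" "v \<in> V" "v \<noteq> \<one>" "w \<in> V" "w \<notin> span v" "g v = h v" "g w = h w" "u \<in> V"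
  shows "g u = h u"
proof -
  obtain i j :: nat where "u = v [^] i \<otimes> w [^] j" using basis[OF assms(3-6,9)] by blast
  then show ?thesis using assms V_carrier by (simp add: g_mult g_pow)
qed

text \<open>Maps fixing \<open>v\<close> send \<open>w\<close> to v^i w^j with 0 < j < l. At least l
  of them exist, so two share j; their quotient fixes \<open>v\<close> and multiplies the image of
  \<open>w\<close> by an element \<open>c\<close> of the span of \<open>v\<close>.\<close>

lemma ex_transvection:
  assumes "l dvd card H"
  shows "\<exists>u\<in>Gs. \<exists>v\<in>V. \<exists>w\<in>V. v \<noteq> \<one> \<and> w \<notin> span v \<and> u v = v \<and> u w = v \<otimes> w"
proof -
  obtain v where v: "v \<in> V" "v \<noteq> \<one>" and big: "l \<le> card {h \<in> H. h v = v}"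
    using ex_large_stabilizer[OF assms] by blast
  obtain w where w: "w \<in> V" "w \<notin> span v" using ex_not_span[OF v(1)] by blast
  have vc: "v \<in> carrier A" and wc: "w \<in> carrier A" using V_carrier v w by auto
  have wout: "g w \<notin> span v" if "g \<in> Gs" "g v = v" for g
  proof
    assume "g w \<in> span v"
    then obtain n :: nat where "g w = v [^] n" by blast
    then have "g w = g (v [^] n)" using g_pow[OF that(1) vc] that(2) by simp
    then show False using g_inj[OF that(1)] w by simp
  qed
  have ex: "\<exists>j. 0 < j \<and> j < l \<and> (\<exists>i. h w = v [^] (i::nat) \<otimes> w [^] (j::nat))" if hv: "h \<in> {h \<in> H. h v = v}" for h
  proof -
    obtain g where g: "g \<in> Gs" "h = restrict g (V \<union> XS)" using hv unfolding H_def by blast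
    have gv: "g v = v" "h w = g w" using hv g v w by auto
    obtain i j :: nat where ij: "i < l" "j < l" "g w = v [^] i \<otimes> w [^] j"
      using basis[OF v w g_V[OF g(1) w(1)]] by blast
    have "j \<noteq> 0" using wout[OF g(1) gv(1)] ij(3) vc by (cases j) auto
    then show ?thesis using ij gv by auto
  qed
  define e where "e = (\<lambda>h. SOME j. 0 < j \<and> j < l \<and> (\<exists>i. h w = v [^] (i::nat) \<otimes> w [^] (j::nat)))"
  have e: "0 < e h \<and> e h < l \<and> (\<exists>i. h w = v [^] (i::nat) \<otimes> w [^] e h)" if "h \<in> {h \<in> H. h v = v}" for h
    unfolding e_def by (rule someI_ex[OF ex[OF that]])
  have "\<not> inj_on e {h \<in> H. h v = v}"
  proof
    assume "inj_on e {h \<in> H. h v = v}"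
    then have "card {h \<in> H. h v = v} \<le> card {0<..<l}"
      using e by (intro card_inj_on_le) auto
    then show False using big l_gt_1 by simp
  qed
  then obtain h1 h2 where h: "h1 \<in> {h \<in> H. h v = v}" "h2 \<in> {h \<in> H. h v = v}" "e h1 = e h2" "h1 \<noteq> h2"
    unfolding inj_on_def by blast
  obtain g1 g2 where g: "g1 \<in> Gs" "h1 = restrict g1 (V \<union> XS)" "g2 \<in> Gs" "h2 = restrict g2 (V \<union> XS)"
    using h unfolding H_def by blast
  have gv: "g1 v = v" "g2 v = v" "h1 w = g1 w" "h2 w = g2 w" using h g v w by auto
  obtain i1 i2 where i: "g1 w = v [^] (i1::nat) \<otimes> w [^] e h1" "g2 w = v [^] (i2::nat) \<otimes> w [^] e h1"
    using e[OF h(1)] e[OF h(2)] gv h(3) by auto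
  obtain g2' where g2': "g2' \<in> Gs" "\<And>x. g2' (g2 x) = x" "\<And>x. g2 (g2' x) = x" using g_inv[OF g(3)] by metis
  define c where "c = v [^] i1 \<otimes> inv (v [^] i2)"
  have cs: "c \<in> span v" unfolding c_def by (intro span_mult span_inv v) auto
  then have cV: "c \<in> V" using span_V v by blast
  define u where "u = g1 \<circ> g2'"
  have u: "u \<in> Gs" unfolding u_def using g_comp g g2' by blast
  have uv: "u v = v" unfolding u_def using g2'(2)[of v] gv by simp
  have uw: "u (g2 w) = c \<otimes> g2 w"
  proof -
    define a b d where abbr: "a = v [^] i1" "b = v [^] i2" "d = w [^] e h1"
    have ac: "a \<in> carrier A" "b \<in> carrier A" "d \<in> carrier A" unfolding abbr using vc wc by simp_all
    have "inv b \<otimes> (b \<otimes> d) = d" using ac by (simp add: m_assoc[symmetric])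
    then have "a \<otimes> inv b \<otimes> (b \<otimes> d) = a \<otimes> d" using ac by (simp add: m_assoc)
    then have "c \<otimes> g2 w = g1 w" unfolding i c_def abbr .
    moreover have "u (g2 w) = g1 w" unfolding u_def comp_apply g2'(2) ..
    ultimately show ?thesis by simp
  qed
  \<comment> \<open>Otherwise \<open>g1\<close> and \<open>g2\<close> agree on \<open>V\<close>;
    their quotient then acts trivially on \<open>XS\<close> by \<open>no_translation\<close>, and
    \<open>h1\<close> = \<open>h2\<close>.\<close>
  have "c \<noteq> \<one>"
  proof
    assume "c = \<one>"
    have "g1 w = u (g2 w)" unfolding u_def comp_apply g2'(2) ..
    also have "\<dots> = g2 w" unfolding uw \<open>c = \<one>\<close> using g_closed[OF g(3) wc] by simp
    finally have gw: "g1 w = g2 w" .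
    have gV: "g1 z = g2 z" if "z \<in> V" for z
      by (rule g_eqI[OF g(1,3) v w _ gw that]) (simp only: gv(1,2))
    have "(g2' \<circ> g1) x = x" if "x \<in> XS" for x
    proof (rule no_translation[OF g_comp[OF g2'(1) g(1)] _ that])
      show "(g2' \<circ> g1) z = z" if "z \<in> V" for z
        unfolding comp_apply gV[OF that] by (rule g2'(2))
    qed
    then have gX: "g1 x = g2 x" if "x \<in> XS" for x using that g2'(3)[of "g1 x"] by simp
    have "h1 = h2" unfolding g by (rule restrict_ext) (use gV gX in auto)
    then show False using h by simp
  qed
  moreover have "g2 w \<notin> span c"
  proof
    assume "g2 w \<in> span c"
    then have "g2 w \<in> span v" using span_pow[OF v(1) cs] by auto
    then show False using wout[OF g(3) gv(2)] by simp
  qed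
  moreover have "u c = c"
    using cs uv g_pow[OF u vc] by auto
  ultimately show ?thesis using u cV g_V[OF g(3) w(1)] uw by blast
qed

lemma u_pow: "u \<in> Gs \<Longrightarrow> (u ^^ n) \<in> Gs"
  by (induction n) (simp_all add: g_id g_comp)

text \<open>With a transvection \<open>u\<close> fixing \<open>v\<close> and a conjugate fixing \<open>w\<close>, the identity
  \<open>((1 1; 0 1) (1 0; -1 1) (1 1; 0 1))\<^sup>2 = -1\<close> of matrices yields the map \<open>-1\<close>.\<close>
lemma ex_minus_one:
  assumes "l dvd card H"
  shows "\<exists>z\<in>Gs. \<forall>v\<in>V. z v = inv v"
proof -
  obtain u v0 w0 where u: "u \<in> Gs" and v0: "v0 \<in> V" "v0 \<noteq> \<one>" and w0: "w0 \<in> V" "w0 \<notin> span v0"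
    and uv0: "u v0 = v0" and uw0: "u w0 = v0 \<otimes> w0"
    using ex_transvection[OF assms] by blast
  have v0c: "v0 \<in> carrier A" and w0c: "w0 \<in> carrier A" using V_carrier v0 w0 by auto
  have uz: "\<exists>k. u z = z \<otimes> v0 [^] (k::nat) \<and> (\<exists>i. z = v0 [^] (i::nat) \<otimes> w0 [^] k)" if zV: "z \<in> V" for z
  proof -
    obtain i k :: nat where z: "z = v0 [^] i \<otimes> w0 [^] k" using basis[OF v0 w0 zV] by blast
    have "u z = v0 [^] i \<otimes> (v0 \<otimes> w0) [^] k"
      unfolding z using u v0c w0c uv0 uw0 by (simp add: g_mult g_pow)
    then have "u z = z \<otimes> v0 [^] k" unfolding z using v0c w0c by (simp add: nat_pow_distrib m_ac)
    then show ?thesis using z by blast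
  qed
  obtain h where h: "h \<in> Gs" "h v0 \<notin> span v0" using no_line[OF v0] by blast
  define w where "w = h v0"
  have w: "w \<in> V" unfolding w_def using g_V h v0 by blast
  have wc: "w \<in> carrier A" using V_carrier w by blast
  obtain j where uw: "u w = w \<otimes> v0 [^] (j::nat)" and j: "\<exists>i. w = v0 [^] (i::nat) \<otimes> w0 [^] j"
    using uz[OF w] by blast
  \<comment> \<open>Rescaling the axis of \<open>u\<close> turns the shear into u w = w v. The
    vector is nontrivial because \<open>w\<close> lies off the axis.\<close>
  define v where "v = v0 [^] j"
  have v: "v \<in> V" unfolding v_def using V_npow v0 by blast
  have vc: "v \<in> carrier A" using V_carrier v by blast
  have v1: "v \<noteq> \<one>"
  proof
    assume "v = \<one>"
    then have "l dvd j" using pow_eq_one[OF v0] unfolding v_def by simp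
    then have "w0 [^] j = \<one>" using pow_mod[OF w0(1), of j] by simp
    then show False using j h(2) v0c unfolding w_def by auto
  qed
  have wnv: "w \<notin> span v"
  proof
    assume "w \<in> span v"
    then have "w \<in> span v0" using span_pow[OF v0(1), of v] unfolding v_def by auto
    then show False using h(2) unfolding w_def by simp
  qed
  have uv: "u v = v" unfolding v_def using g_pow[OF u v0c] uv0 by simp
  have uw': "u w = w \<otimes> v" using uw unfolding v_def .
  obtain h' where h': "h' \<in> Gs" "\<And>x. h' (h x) = x" "\<And>x. h (h' x) = x" using g_inv[OF h(1)] by metis
  define u' where "u' = h \<circ> (u \<circ> h')"
  have u': "u' \<in> Gs" unfolding u'_def by (intro g_comp h(1) h'(1) u)
  have u'w: "u' w = w" unfolding u'_def w_def using h'(2)[of v0] uv0 by simp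
  obtain m where m: "u' v = v \<otimes> w [^] (m::nat)"
  proof -
    obtain k where "u (h' v) = h' v \<otimes> v0 [^] (k::nat)" using uz[OF g_V[OF h'(1) v]] by blast
    then have "u' v = v \<otimes> w [^] k"
      unfolding u'_def w_def using g_mult[OF h(1)] g_pow[OF h(1) v0c] g_closed[OF h'(1) vc] v0c h'(3) by simp
    then show thesis by (rule that)
  qed
  \<comment> \<open>If the shear coefficient of \<open>u'\<close> were 0, then \<open>u'\<close> and
    its conjugate \<open>u\<close> would be trivial on \<open>V\<close>.\<close>
  have "\<not> l dvd m"
  proof
    assume "l dvd m"
    then have "u' v = v" using m pow_mod[OF w, of m] vc by simp
    then have u'V: "u' z = z" if "z \<in> V" for z
      using g_eqI[OF u' g_id v v1 w wnv _ _ that] u'w by simp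
    have "u w = w"
      using u'V[OF g_V[OF h(1) w]] h'(2) g_inj[OF h(1)] unfolding u'_def by simp
    then show False using uw' v1 wc vc by simp
  qed
  then obtain k where k: "[m * k = 1] (mod l)" using ex_inverse_mod by blast
  \<comment> \<open>Modulo l, \<open>m * k\<close> is 1 and \<open>l - 1\<close> is -1, so the n-th
    power of \<open>u'\<close> sends \<open>v\<close> to v w^(-1).\<close>
  define n where "n = k * (l - 1)"
  define q where "q = u' ^^ n"
  have q: "q \<in> Gs" unfolding q_def by (rule u_pow[OF u'])
  have qw: "q w = w" unfolding q_def by (induction n) (simp_all add: u'w)
  have "(u' ^^ i) v = v \<otimes> w [^] (m * i)" for i
  proof (induction i)
    case (Suc i)
    have "(u' ^^ Suc i) v = u' v \<otimes> u' w [^] (m * i)"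
      using Suc g_mult[OF u'] g_pow[OF u'] vc wc by simp
    then show ?case unfolding m u'w using vc wc by (simp add: m_assoc nat_pow_mult)
  qed (use vc in simp)
  then have "q v = v \<otimes> (w [^] (m * k)) [^] (l - 1)"
    unfolding q_def n_def using wc by (simp add: nat_pow_pow mult.assoc)
  also have "w [^] (m * k) = w" using pow_cong[OF w k] wc by simp
  finally have qv: "q v = v \<otimes> inv w" using inv_eq_pow[OF w] by simp
  \<comment> \<open>On the basis this is the quarter turn v -> w^(-1), w -> v, whose square is
    -1.\<close>
  define s where "s = u \<circ> (q \<circ> u)"
  have s: "s \<in> Gs" unfolding s_def using g_comp u q by blast
  have sv: "s v = inv w"
    unfolding s_def using uv qv uw' g_mult[OF u] g_inverse[OF u] vc wc by (simp add: inv_mult m_ac) (simp add: m_assoc[symmetric])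
  have sw: "s w = v"
    unfolding s_def using uv qv uw' qw g_mult[OF u] g_mult[OF q] g_inverse[OF u] vc wc
    by (simp add: m_ac)
  define z where "z = s \<circ> s"
  have z: "z \<in> Gs" unfolding z_def using g_comp s by blast
  have zv: "z v = inv v" unfolding z_def using sv sw g_inverse[OF s wc] by simp
  have zw: "z w = inv w" unfolding z_def using sv sw by simp
  have "z x = inv x" if x: "x \<in> V" for x
  proof -
    obtain i j :: nat where ij: "x = v [^] i \<otimes> w [^] j" using basis[OF v v1 w wnv x] by blast
    show ?thesis unfolding ij using z vc wc zv zw by (simp add: g_mult g_pow nat_pow_inv inv_mult)
  qed
  then show ?thesis using z by blast
qed

text \<open>The map z inducing -1 has exactly one fixed point \<open>f\<close> on \<open>XS\<close>.
  A commutator of z with any g is trivial on \<open>V\<close>, hence on \<open>XS\<close> by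
  \<open>no_translation\<close>; so g f is fixed by z as well and equals f.\<close>

lemma fixed_point_odd:
  assumes "odd l"
  shows "\<exists>x\<in>XS. \<forall>g\<in>Gs. g x = x"
proof (rule ccontr)
  assume no: "\<not> ?thesis"
  obtain z where z: "z \<in> Gs" "\<And>v. v \<in> V \<Longrightarrow> z v = inv v"
    using ex_minus_one[OF l_dvd_card_H[OF no]] by blast
  obtain x where x: "x \<in> XS" using Y by blast
  define t where "t = inv x \<otimes> z x"
  have tV: "t \<in> V" unfolding t_def using X_diff[OF x g_X[OF z(1) x]] .
  have tc: "t \<in> carrier A" and xc: "x \<in> carrier A" using V_carrier tV X_carrier x by auto
  obtain r where r: "l = 2 * r + 1" using assms oddE by blast
  \<comment> \<open>\<open>r + 1\<close> is the inverse of 2 modulo l, so \<open>f\<close> is the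
    midpoint of x and z x.\<close>
  define f where "f = x \<otimes> t [^] (r + 1)"
  have fX: "f \<in> XS" unfolding f_def using X_V[OF x V_npow[OF tV]] .
  have zx: "z x = x \<otimes> t" unfolding t_def by (rule X_split[OF x g_X[OF z(1) x]])
  have zf: "z f = f"
  proof -
    have "z f = x \<otimes> t \<otimes> inv (t [^] (r + 1))"
      unfolding f_def g_mult[OF z(1) xc nat_pow_closed[OF tc]] zx z(2)[OF V_npow[OF tV]] ..
    also have "inv (t [^] (r + 1)) = t [^] r"
    proof (rule inv_equality)
      have "r + (r + 1) = l" using r by simp
      then show "t [^] r \<otimes> t [^] (r + 1) = \<one>" using V_pow[OF tV] tc by (simp only: nat_pow_mult)
    qed (use tc in simp_all)
    also have "x \<otimes> t \<otimes> t [^] r = f" unfolding f_def using tc xc by (simp add: m_ac)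
    finally show ?thesis .
  qed
  have uniq: "y = f" if y: "y \<in> XS" "z y = y" for y
  proof -
    define d where "d = inv f \<otimes> y"
    have dV: "d \<in> V" unfolding d_def using X_diff[OF fX y(1)] .
    have dc: "d \<in> carrier A" and fc: "f \<in> carrier A" using V_carrier dV X_carrier fX by auto
    have yd: "y = f \<otimes> d" unfolding d_def by (rule X_split[OF fX y(1)])
    have "f \<otimes> inv d = f \<otimes> d" using y(2) zf z(2)[OF dV] g_mult[OF z(1) fc dc] unfolding yd by simp
    then have "inv d = d" using fc dc by simp
    then have "d \<otimes> d = \<one>" using dc r_inv[OF dc] by simp
    then have "d [^] (2::nat) = \<one>" using dc by (simp add: numeral_2_eq_2)
    moreover have "\<not> l dvd 2" using primes_dvd_imp_eq[OF prime_l two_is_prime_nat] assms by auto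
    ultimately have "d = \<one>" using pow_eq_one[OF dV, of 2] by blast
    then show ?thesis using yd fc by simp
  qed
  have "g f = f" if g: "g \<in> Gs" for g
  proof (rule uniq)
    show gf: "g f \<in> XS" using g_X[OF g fX] .
    obtain g' where g': "g' \<in> Gs" "\<And>x. g' (g x) = x" "\<And>x. g (g' x) = x" using g_inv[OF g] by metis
    obtain z' where z': "z' \<in> Gs" "\<And>x. z' (z x) = x" "\<And>x. z (z' x) = x" using g_inv[OF z(1)] by metis
    define k where "k = z' \<circ> (g' \<circ> (z \<circ> g))"
    have k: "k \<in> Gs" unfolding k_def by (intro g_comp g g'(1) z(1) z'(1))
    have "k v = v" if v: "v \<in> V" for v
    proof -
      have "g' (z (g v)) = z v"
        using z(2)[OF g_V[OF g v]] z(2)[OF v] g_inverse[OF g' (1) g_closed[OF g V_carrier[OF v]]] g'(2) by simp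
      then show ?thesis unfolding k_def using z'(2) by simp
    qed
    then have "k f = f" using no_translation[OF k _ fX] by blast
    then have "g' (z (g f)) = z f" unfolding k_def using z'(3) by (metis comp_apply)
    then show "z (g f) = g f" using zf g'(3) by metis
  qed
  then show False using no fX by blast
qed

lemma fixed_point_two:
  assumes "l = 2"
  shows "\<exists>x\<in>XS. \<forall>g\<in>Gs. g x = x"
proof (rule ccontr)
  assume no: "\<not> ?thesis"
  have d: "2 dvd card Y" using barycentre[OF Y(1) g_Y] no assms by blast
  obtain x where x: "x \<in> XS" using Y by blast
  have "XS = (\<lambda>v. x \<otimes> v) ` V" using X_split[OF x] X_diff[OF x] X_V[OF x] by blast
  then have "card XS \<le> 4" using card_image_le[OF finite_V, of "\<lambda>v. x \<otimes> v"] card_V assms by simp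
  moreover have "Y \<subset> XS" using Y by blast
  ultimately have "card Y < 4" using psubset_card_mono[OF finite_X, of Y] by linarith
  moreover have "card Y \<noteq> 0" using Y finite_X finite_subset by (metis card_eq_0_iff)
  ultimately have "card Y = 2" using d by presburger
  then obtain y1 y2 where y: "Y = {y1, y2}" "y1 \<noteq> y2" by (auto simp: card_2_iff)
  have yX: "y1 \<in> XS" "y2 \<in> XS" using y Y by auto
  have yc: "y1 \<in> carrier A" "y2 \<in> carrier A" using X_carrier yX by auto
  define s where "s = inv y1 \<otimes> y2"
  have sV: "s \<in> V" unfolding s_def using X_diff yX by blast
  have "s \<noteq> \<one>" using X_split[OF yX] y(2) yc unfolding s_def by auto
  then obtain g where g: "g \<in> Gs" "g s \<notin> span s" using no_line[OF sV] by blast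
  have gs: "g s = inv (g y1) \<otimes> g y2" unfolding s_def using g yc by (simp add: g_mult g_inverse)
  \<comment> \<open>Because \<open>s\<close> is its own inverse, it is preserved whether
    \<open>g\<close> fixes the two points or swaps them.\<close>
  have ss: "inv s = s" using inv_eq_pow[OF sV] V_carrier[OF sV] assms by simp
  have "inv y2 \<otimes> y1 = inv s" unfolding s_def using yc by (simp add: inv_mult_group)
  then have "inv y2 \<otimes> y1 = s" unfolding ss .
  moreover have "{g y1, g y2} \<subseteq> {y1, y2}" "g y1 \<noteq> g y2" using g_Y[OF g(1)] y g_inj[OF g(1)] by auto
  ultimately have "inv (g y1) \<otimes> g y2 = s" using s_def by auto
  then have "g s = s" unfolding gs .
  moreover have "s \<in> span s" using V_carrier[OF sV] by (intro image_eqI[of _ _ 1]) auto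
  ultimately show False using g by simp
qed

theorem fixed_point: "\<exists>x\<in>XS. \<forall>g\<in>Gs. g x = x"
  using fixed_point_odd fixed_point_two prime_l primes_dvd_imp_eq[OF two_is_prime_nat prime_l] by blast

end

section \<open>The main theorem\<close>

lemma gal_aut_field_hom: "gal_aut \<sigma> \<Longrightarrow> field_hom \<sigma>"
  unfolding gal_aut_def field_hom_def by blast

lemma gal_aut_comp: "gal_aut \<sigma> \<Longrightarrow> gal_aut \<tau> \<Longrightarrow> gal_aut (\<sigma> \<circ> \<tau>)"
  unfolding gal_aut_def by (auto intro: bij_comp)

lemma gal_aut_id: "gal_aut id"
  unfolding gal_aut_def by simp

lemma gal_aut_inv:
  assumes "gal_aut \<sigma>"
  shows "gal_aut (inv_into UNIV \<sigma>)"
proof -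
  let ?\<tau> = "inv_into UNIV \<sigma>"
  have b: "bij \<sigma>" and a: "\<And>u v. \<sigma> (u + v) = \<sigma> u + \<sigma> v" and m: "\<And>u v. \<sigma> (u * v) = \<sigma> u * \<sigma> v"
    and o: "\<sigma> 1 = 1" and c: "\<And>c. \<sigma> (to_ac c) = to_ac c"
    using assms unfolding gal_aut_def by blast+
  have r: "\<sigma> (?\<tau> x) = x" for x using b by (simp add: bij_is_surj surj_f_inv_f)
  have e: "?\<tau> x = y" if "x = \<sigma> y" for x y using b that by (simp add: bij_is_inj)
  show ?thesis unfolding gal_aut_def
  proof (intro conjI allI)
    show "bij ?\<tau>" using b by (rule bij_imp_bij_inv)
    show "?\<tau> (u + v) = ?\<tau> u + ?\<tau> v" for u v by (rule e) (simp add: a r)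
    show "?\<tau> (u * v) = ?\<tau> u * ?\<tau> v" for u v by (rule e) (simp add: m r)
    show "?\<tau> 1 = 1" by (rule e) (simp add: o)
    show "?\<tau> (to_ac c) = to_ac c" for c by (rule e) (simp add: assms c)
  qed
qed

lemma gal_aut_wcurve: "gal_aut \<sigma> \<Longrightarrow> map_wcurve \<sigma> (map_wcurve to_ac E) = map_wcurve to_ac E"
  unfolding gal_aut_def map_wcurve_def by simp

lemma gal_aut_map_point: "gal_aut \<sigma> \<Longrightarrow> map_point \<sigma> (map_point to_ac P) = map_point to_ac P"
  unfolding gal_aut_def by (cases P) auto

lemma map_point_comp: "map_point f (map_point g P) = map_point (f \<circ> g) P"
  by (cases P) auto

lemma map_point_id: "map_point id P = P"
  by (cases P) auto

lemma gal_aut_poly_root: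
  assumes "gal_aut \<sigma>" "poly (map_poly to_ac p) r = 0"
  shows "poly (map_poly to_ac p) (\<sigma> r) = 0"
proof -
  interpret field_hom \<sigma> by (rule gal_aut_field_hom[OF assms(1)])
  have "map_poly \<sigma> (map_poly to_ac p) = map_poly to_ac p"
    using assms(1) unfolding gal_aut_def by (intro poly_eqI) (simp add: coeff_map_poly)
  then show ?thesis using poly_map_poly[of "map_poly to_ac p" r] assms(2) by simp
qed

lemma smul_cyclic_stable:
  fixes EE :: "('b::alg_closed_field) wcurve"
  assumes "elliptic_curve EE" "on_curve EE T" "on_curve EE T'" "T' \<in> range (\<lambda>n. smul EE n T)"
  shows "range (\<lambda>n. smul EE n T') \<subseteq> range (\<lambda>n. smul EE n T)"
proof -
  interpret elliptic_curve EE by fact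
  interpret G: comm_group "PG EE" by (rule comm_group_PG)
  obtain k where k: "T' = smul EE k T" using assms(4) by blast
  have "smul EE n T' = smul EE (k * n) T" for n
    using smul_eq_pow[OF assms(2)] smul_eq_pow[OF assms(3)] k G.nat_pow_pow[of T k n] assms(2) by simp
  then show ?thesis by auto
qed

context
  fixes E :: "('a::field) wcurve" and l :: nat and P :: "'a point"
  assumes prime_l: "Factorial_Ring.prime l" and ell: "elliptic E" and char: "\<not> CHAR('a) dvd l"
    and oc: "on_curve E P" and PO: "P \<noteq> Infinity"
begin

abbreviation EE :: "'a alg_closure wcurve" where "EE \<equiv> map_wcurve to_ac E"
abbreviation PP :: "'a alg_closure point" where "PP \<equiv> map_point to_ac P"

lemma elliptic_curve_EE: "elliptic_curve EE"
  unfolding elliptic_curve_def ac.elliptic_map using ell .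

interpretation elliptic_curve EE by (rule elliptic_curve_EE)

lemma l_ge_2: "l \<ge> 2"
  using prime_l prime_ge_2_nat by blast

lemma of_nat_l: "of_nat l \<noteq> (0 :: 'a alg_closure)"
  using char by (simp add: of_nat_eq_0_iff_char_dvd)

lemma oc_PP: "on_curve EE PP" and PP_ne: "PP \<noteq> Infinity"
  using oc PO by (simp_all add: ac.on_curve_map ac.map_point_eq_Infinity)

lemma psi2_PP: "psi2 E P \<noteq> 0 \<Longrightarrow> psi2 EE PP \<noteq> 0"
  by (cases P) (simp_all add: ac.map_wcurve_simps flip: to_ac_mult to_ac_add to_ac_numeral)

lemma gal_on_curve: "gal_aut \<sigma> \<Longrightarrow> on_curve EE (map_point \<sigma> Q) \<longleftrightarrow> on_curve EE Q"
  using field_hom.on_curve_map[OF gal_aut_field_hom, of \<sigma> EE Q] gal_aut_wcurve[of \<sigma> E] by simp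

lemma gal_add: "gal_aut \<sigma> \<Longrightarrow> map_point \<sigma> (add EE Q R) = add EE (map_point \<sigma> Q) (map_point \<sigma> R)"
  using field_hom.map_add[OF gal_aut_field_hom, of \<sigma> EE Q R] gal_aut_wcurve[of \<sigma> E] by simp

lemma gal_smul: "gal_aut \<sigma> \<Longrightarrow> map_point \<sigma> (smul EE n Q) = smul EE n (map_point \<sigma> Q)"
  using field_hom.map_smul[OF gal_aut_field_hom, of \<sigma> EE n Q] gal_aut_wcurve[of \<sigma> E] by simp

lemma two_torsion_case:
  assumes "psi2 E P = 0"
  shows "has_rational_cyclic_subgroup E l \<or> (\<exists>Q. on_curve E Q \<and> smul E l Q = P)"
proof (cases "even l")
  case True
  then have l: "l = 2" using prime_l primes_dvd_imp_eq two_is_prime_nat by blast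
  have "add E P P = Infinity" using psi2_eq_0_iff[OF PO] assms by simp
  then have "map_point to_ac (smul E l P) = Infinity" unfolding l by (simp add: numeral_2_eq_2)
  then have PP2: "smul EE l PP = Infinity" by (simp add: ac.map_smul)
  have "map_point \<sigma> ` range (\<lambda>n. smul EE n PP) = range (\<lambda>n. smul EE n PP)" if "gal_aut \<sigma>" for \<sigma>
    unfolding image_image gal_smul[OF that] gal_aut_map_point[OF that] ..
  then show ?thesis
    unfolding has_rational_cyclic_subgroup_def Let_def using oc_PP PP_ne PP2 by blast
next
  case False
  have "add E P P = Infinity" using psi2_eq_0_iff[OF PO] assms by simp
  then have "smul E n P = (if even n then Infinity else P)" for n
    by (induction n) auto
  then show ?thesis using oc False by auto
qed

text \<open>Both coordinates are Galois-fixed simple roots of polynomials over K: first x for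
  \<open>delta\<close>, then, with x known to be rational, y for the curve equation.\<close>

lemma fixed_imp_rational:
  assumes psi2: "psi2 E P \<noteq> 0" and Q: "Q \<in> fibre l PP" and fixed: "\<And>\<sigma>. gal_aut \<sigma> \<Longrightarrow> map_point \<sigma> Q = Q"
  shows "\<exists>Q. on_curve E Q \<and> smul E l Q = P"
proof -
  have Q': "on_curve EE Q" "smul EE l Q = PP" using Q unfolding fibre_def by auto
  have inf: "smul EE l Infinity = Infinity" by (induction l) auto
  have QO: "Q \<noteq> Infinity" using Q' inf PP_ne by auto
  obtain x y where xy: "Q = Pt x y" using QO by (cases Q) auto
  have fx: "\<sigma> x = x" "\<sigma> y = y" if "gal_aut \<sigma>" for \<sigma> using fixed[OF that] xy by auto
  note p2' = psi2_PP[OF psi2]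
  have root: "poly (delta EE l PP) x = 0"
    using delta_root_iff[OF Q'(1) QO _ oc_PP PP_ne, of l] Q' xy l_ge_2 by simp
  have simple: "poly (pderiv (delta EE l PP)) x \<noteq> 0"
    by (rule delta_simple_roots[OF l_ge_2 of_nat_l oc_PP PP_ne p2' root])
  have "x \<in> range to_ac"
  proof (rule gal_fixed_imp_rational[of "delta E l P"])
    show "poly (map_poly to_ac (delta E l P)) x = 0" using root by (simp add: ac.map_delta)
    show "poly (map_poly to_ac (pderiv (delta E l P))) x \<noteq> 0"
      using simple by (simp add: ac.map_poly_pderiv ac.map_delta)
  qed (rule fx)
  then obtain x0 where x0: "x = to_ac x0" by blast
  \<comment> \<open>The curve equation as a polynomial in y. Its derivative at y is psi_2(Q), which
    is nonzero in every characteristic because 2Q = O would force 2P = O.\<close>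
  define q where "q = [:- (x0^3 + a2 E * x0^2 + a4 E * x0 + a6 E), a1 E * x0 + a3 E, 1:]"
  have mq: "map_poly to_ac q = [:- (x^3 + a2 EE * x^2 + a4 EE * x + a6 EE), a1 EE * x + a3 EE, 1:]"
    unfolding q_def x0 by (simp add: map_poly_pCons ac.map_wcurve_simps)
  have "psi2 EE Q \<noteq> 0"
  proof
    assume "psi2 EE Q = 0"
    then have "Q = neg EE Q" using psi2_eq_0_iff[OF QO] unfolding add_neg_iff by simp
    then have "PP = neg EE PP" using smul_neg[OF Q'(1), of l] Q' by simp
    then show False using p2' psi2_eq_0_iff[OF PP_ne, of EE] unfolding add_neg_iff by simp
  qed
  then have py: "2 * y + a1 EE * x + a3 EE \<noteq> 0" unfolding xy by simp
  have "y \<in> range to_ac"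
  proof (rule gal_fixed_imp_rational[of q])
    show "poly (map_poly to_ac q) y = 0"
      using Q'(1) unfolding mq xy by (simp add: algebra_simps power2_eq_square)
    have "poly (map_poly to_ac (pderiv q)) y = 2 * y + a1 EE * x + a3 EE"
      unfolding ac.map_poly_pderiv mq by (simp add: pderiv_pCons algebra_simps)
    then show "poly (map_poly to_ac (pderiv q)) y \<noteq> 0" using py by simp
  qed (rule fx)
  then obtain y0 where y0: "y = to_ac y0" by blast
  have Q0: "Q = map_point to_ac (Pt x0 y0)" unfolding xy x0 y0 by simp
  have "on_curve E (Pt x0 y0)" using Q'(1) unfolding Q0 ac.on_curve_map .
  moreover have "smul E l (Pt x0 y0) = P"
    using Q'(2) unfolding Q0 ac.map_smul[symmetric] ac.map_point_inj .
  ultimately show ?thesis by blast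
qed

text \<open>Positive degree turns reducibility into two nonconstant factors. A common root would be
  a multiple root of \<open>delta\<close>, so the factors have disjoint nonempty sets of roots, and
  these correspond to points of the fibre.\<close>

lemma reducible_imp_stable_subset:
  assumes psi2: "psi2 E P \<noteq> 0" and red: "\<not> Factorial_Ring.irreducible (delta E l P)"
  shows "\<exists>Y. Y \<subseteq> fibre l PP \<and> Y \<noteq> {} \<and> Y \<noteq> fibre l PP \<and> (\<forall>\<sigma>. gal_aut \<sigma> \<longrightarrow> map_point \<sigma> ` Y \<subseteq> Y)"
proof -
  note p2' = psi2_PP[OF psi2]
  have deg: "Polynomial.degree (delta E l P) = l ^ 2" by (rule degree_delta[OF l_ge_2 PO])
  then have d0: "delta E l P \<noteq> 0" using l_ge_2 by auto
  then have nu: "\<not> delta E l P dvd 1" using deg l_ge_2 by (simp add: is_unit_iff_degree)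
  obtain f g where fg: "delta E l P = f * g" "\<not> f dvd 1" "\<not> g dvd 1"
    using red d0 nu unfolding Factorial_Ring.irreducible_def by blast
  have nz: "f \<noteq> 0" "g \<noteq> 0" using fg d0 by auto
  let ?f = "map_poly to_ac f" and ?g = "map_poly to_ac g"
  have dfg: "Polynomial.degree ?f > 0" "Polynomial.degree ?g > 0"
    using fg nz by (simp_all add: ac.degree_map is_unit_iff_degree)
  have D: "delta EE l PP = ?f * ?g" using fg(1) by (simp flip: ac.map_delta ac.map_poly_mult)
  have disj: "poly ?g r \<noteq> 0" if "poly ?f r = 0" for r
  proof
    assume "poly ?g r = 0"
    then have "poly (delta EE l PP) r = 0" "poly (pderiv (delta EE l PP)) r = 0"
      unfolding D pderiv_mult using that by simp_all
    then show False using delta_simple_roots[OF l_ge_2 of_nat_l oc_PP PP_ne p2'] by blast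
  qed
  define Y where "Y = {Q \<in> fibre l PP. poly ?f (xc Q) = 0}"
  have ex: "\<exists>Q\<in>fibre l PP. xc Q = r" if "poly (delta EE l PP) r = 0" for r
  proof -
    have "r \<in> xc ` fibre l PP"
      using fibre_bij_roots[OF _ oc_PP PP_ne p2', of l] that l_ge_2 by (simp add: bij_betw_def)
    then show ?thesis by blast
  qed
  obtain r where r: "poly ?f r = 0" using dfg alg_closed_imp_poly_has_root by blast
  obtain r' where r': "poly ?g r' = 0" using dfg alg_closed_imp_poly_has_root by blast
  have "Y \<noteq> {}" using ex[of r] r unfolding D Y_def by auto
  moreover have "Y \<noteq> fibre l PP"
  proof -
    obtain Q where "Q \<in> fibre l PP" "xc Q = r'" using ex[of r'] r' unfolding D by auto
    then show ?thesis using disj[of r'] r' unfolding Y_def by auto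
  qed
  moreover have "map_point \<sigma> ` Y \<subseteq> Y" if \<sigma>: "gal_aut \<sigma>" for \<sigma>
  proof
    fix R assume "R \<in> map_point \<sigma> ` Y"
    then obtain Q where Q: "R = map_point \<sigma> Q" "on_curve EE Q" "smul EE l Q = PP" "poly ?f (xc Q) = 0"
      unfolding Y_def fibre_def by blast
    have "smul EE l R = PP"
      unfolding Q(1) gal_smul[OF \<sigma>, symmetric] Q(3) by (rule gal_aut_map_point[OF \<sigma>])
    moreover have "xc R = \<sigma> (xc Q)" unfolding Q(1)
      using field_hom.h_0[OF gal_aut_field_hom[OF \<sigma>]] by (cases Q) auto
    ultimately show "R \<in> Y" unfolding Y_def fibre_def
      using Q gal_on_curve[OF \<sigma>] gal_aut_poly_root[OF \<sigma> Q(4)] by simp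
  qed
  moreover have "Y \<subseteq> fibre l PP" unfolding Y_def by blast
  ultimately show ?thesis by blast
qed

text \<open>A failure of \<open>no_line\<close> is an l-torsion point whose multiples include all
  its conjugates, that is, a generator of a stable cyclic subgroup; so the abstract fixed point
  theorem applies.\<close>

lemma main_case:
  assumes psi2: "psi2 E P \<noteq> 0" and red: "\<not> Factorial_Ring.irreducible (delta E l P)"
    and nosub: "\<not> has_rational_cyclic_subgroup E l"
  shows "\<exists>Q. on_curve E Q \<and> smul E l Q = P"
proof -
  obtain Y where Y: "Y \<subseteq> fibre l PP" "Y \<noteq> {}" "Y \<noteq> fibre l PP" "\<And>\<sigma>. gal_aut \<sigma> \<Longrightarrow> map_point \<sigma> ` Y \<subseteq> Y"
    using reducible_imp_stable_subset[OF psi2 red] by blast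
  define Gs where "Gs = {map_point \<sigma> |\<sigma> :: 'a alg_closure \<Rightarrow> 'a alg_closure. gal_aut \<sigma>}"
  have fibP: "fibre l R = {x \<in> carrier (PG EE). x [^]\<^bsub>PG EE\<^esub> l = R}" for R
    unfolding fibre_def using smul_eq_pow by auto
  have invG: "\<exists>h\<in>Gs. \<forall>x. h (g x) = x \<and> g (h x) = x" if "g \<in> Gs" for g
  proof -
    obtain \<sigma> where \<sigma>: "gal_aut \<sigma>" "g = map_point \<sigma>" using \<open>g \<in> Gs\<close> unfolding Gs_def by blast
    have b: "bij \<sigma>" using \<sigma> unfolding gal_aut_def by blast
    have "map_point (inv_into UNIV \<sigma>) \<in> Gs" unfolding Gs_def using gal_aut_inv[OF \<sigma>(1)] by blast
    moreover have "inv_into UNIV \<sigma> \<circ> \<sigma> = id" using bij_is_inj[OF b] unfolding inj_iff .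
    moreover have "\<sigma> \<circ> inv_into UNIV \<sigma> = id" using bij_is_surj[OF b] unfolding surj_iff .
    ultimately show ?thesis unfolding \<sigma>(2)
      by (intro bexI[of _ "map_point (inv_into UNIV \<sigma>)"]) (simp_all add: map_point_comp map_point_id)
  qed
  have "affine_action (PG EE) l PP Gs (fibre l Infinity) (fibre l PP) Y"
  proof (intro affine_action.intro affine_action_axioms.intro comm_group_PG prime_l)
    show "fibre l Infinity = {v \<in> carrier (PG EE). v [^]\<^bsub>PG EE\<^esub> l = \<one>\<^bsub>PG EE\<^esub>}"
      unfolding fibP by simp
    show "card (fibre l Infinity) = l ^ 2"
      by (rule card_torsion[OF l_ge_2 of_nat_l]) simp
    show "PP \<in> carrier (PG EE)" using oc_PP by simp
    show "fibre l PP = {x \<in> carrier (PG EE). x [^]\<^bsub>PG EE\<^esub> l = PP}" by (rule fibP)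
    show "g x \<in> carrier (PG EE)" if "g \<in> Gs" "x \<in> carrier (PG EE)" for g x
      using that gal_on_curve unfolding Gs_def by auto
    show "g (x \<otimes>\<^bsub>PG EE\<^esub> y) = g x \<otimes>\<^bsub>PG EE\<^esub> g y" if "g \<in> Gs" for g x y
      using that gal_add unfolding Gs_def by auto
    show "g PP = PP" if "g \<in> Gs" for g
      using that gal_aut_map_point unfolding Gs_def by auto
    show "g \<circ> h \<in> Gs" if "g \<in> Gs" "h \<in> Gs" for g h
    proof -
      obtain \<sigma> \<tau> where st: "gal_aut \<sigma>" "gal_aut \<tau>" "g = map_point \<sigma>" "h = map_point \<tau>"
        using \<open>g \<in> Gs\<close> \<open>h \<in> Gs\<close> unfolding Gs_def by blast
      have "g \<circ> h = map_point (\<sigma> \<circ> \<tau>)" unfolding st by (auto simp: fun_eq_iff map_point_comp)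
      then show ?thesis unfolding Gs_def using gal_aut_comp[OF st(1,2)] by blast
    qed
    show "\<exists>h\<in>Gs. \<forall>x. h (g x) = x \<and> g (h x) = x" if "g \<in> Gs" for g
      by (rule invG[OF that])
    have "map_point id = (id :: 'a alg_closure point \<Rightarrow> _)" by (auto simp: fun_eq_iff map_point_id)
    then show "id \<in> Gs" unfolding Gs_def using gal_aut_id by (metis (mono_tags, lifting) mem_Collect_eq)
    show "\<exists>g\<in>Gs. g v \<notin> range (\<lambda>n::nat. v [^]\<^bsub>PG EE\<^esub> n)"
      if v: "v \<in> fibre l Infinity" "v \<noteq> \<one>\<^bsub>PG EE\<^esub>" for v
    proof (rule ccontr)
      assume "\<not> ?thesis"
      have v': "on_curve EE v" "smul EE l v = Infinity" "v \<noteq> Infinity" using v unfolding fibre_def by auto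
      have st: "map_point \<sigma> v \<in> range (\<lambda>n. smul EE n v)" if "gal_aut \<sigma>" for \<sigma>
        using \<open>\<not> (\<exists>g\<in>Gs. g v \<notin> range (\<lambda>n::nat. v [^]\<^bsub>PG EE\<^esub> n))\<close> that
        unfolding Gs_def smul_eq_pow[OF v'(1)] by blast
      have sub: "map_point \<sigma> ` range (\<lambda>n. smul EE n v) \<subseteq> range (\<lambda>n. smul EE n v)" if \<sigma>: "gal_aut \<sigma>" for \<sigma>
      proof -
        have "map_point \<sigma> ` range (\<lambda>n. smul EE n v) = range (\<lambda>n. smul EE n (map_point \<sigma> v))"
          by (simp add: image_image gal_smul[OF \<sigma>])
        also have "\<dots> \<subseteq> range (\<lambda>n. smul EE n v)"
          using gal_on_curve[OF \<sigma>] v'(1) st[OF \<sigma>] by (intro smul_cyclic_stable[OF elliptic_curve_EE]) auto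
        finally show ?thesis .
      qed
      have "map_point \<sigma> ` range (\<lambda>n. smul EE n v) = range (\<lambda>n. smul EE n v)" if \<sigma>: "gal_aut \<sigma>" for \<sigma>
      proof
        \<comment> \<open>Stability under the inverse automorphism upgrades the inclusion to the
          equality demanded of the subgroup.\<close>
        show "range (\<lambda>n. smul EE n v) \<subseteq> map_point \<sigma> ` range (\<lambda>n. smul EE n v)"
        proof
          fix T assume T: "T \<in> range (\<lambda>n. smul EE n v)"
          have "surj \<sigma>" using \<sigma> bij_is_surj unfolding gal_aut_def by blast
          then have "\<sigma> \<circ> inv_into UNIV \<sigma> = id" unfolding surj_iff .
          then have "T = map_point \<sigma> (map_point (inv_into UNIV \<sigma>) T)"
            by (simp add: map_point_comp map_point_id)
          moreover have "map_point (inv_into UNIV \<sigma>) T \<in> range (\<lambda>n. smul EE n v)"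
            using sub[OF gal_aut_inv[OF \<sigma>]] T by blast
          ultimately show "T \<in> map_point \<sigma> ` range (\<lambda>n. smul EE n v)" by blast
        qed
      qed (rule sub[OF \<sigma>])
      then have "has_rational_cyclic_subgroup E l"
        unfolding has_rational_cyclic_subgroup_def Let_def using v' by (intro exI[of _ v] conjI allI impI)
      then show False using nosub by blast
    qed
    show "g ` Y \<subseteq> Y" if "g \<in> Gs" for g using that Y(4) unfolding Gs_def by blast
  qed (fact Y)+
  then obtain Q where Q: "Q \<in> fibre l PP" "\<forall>g\<in>Gs. g Q = Q" using affine_action.fixed_point by metis
  then have "map_point \<sigma> Q = Q" if "gal_aut \<sigma>" for \<sigma> using that unfolding Gs_def by blast
  then show ?thesis using fixed_imp_rational[OF psi2 Q(1)] by blast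
qed

end

theorem theorem1p2:
  fixes E :: "('a::field) wcurve" and l :: nat and P :: "'a point"
  assumes "prime l"
    and "elliptic E"
    and "\<not> CHAR('a) dvd l"
    and "on_curve E P"
  shows "Factorial_Ring.irreducible (delta E l P)
         \<or> has_rational_cyclic_subgroup E l
         \<or> (\<exists>Q. on_curve E Q \<and> smul E l Q = P)"
proof (cases "P = Infinity")
  case True
  \<comment> \<open>For P = O alternative (iii) holds with Q = O.\<close>
  have "smul E l Infinity = Infinity" by (induction l) auto
  then show ?thesis using True by (metis on_curve.simps(1))
next
  case False
  show ?thesis
    using two_torsion_case[OF assms False] main_case[OF assms False] by blast
qed

end
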